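(* Let $\alpha>-\frac12$. Suppose $T$ is an operator of (I)-type or of (II)-type (as defined in the context). When $T$ is of (I)-type, set $X=\mathbb{C}$ and read $K_t$ below as the kernel $K$ of $T$ (so $\|\cdot\|_X=|\cdot|$); when $T$ is of (II)-type, $X$ and $K_t$ are the Banach space and kernels associated with $T$, and the norm $\|\cdot\|_X$ is taken in the variable $t$. (a) Assume that $T$ is bounded on $L^2((0,\infty),\gamma_\alpha)$ and $$\sup_{I\in \mathcal{B}_1}\ \sup_{x,z\in I}\int_{(2I)^c}\|K_t(x,y)-K_t(z,y)\|_X\, d\gamma_\alpha(y)<\infty.$$ Then $T$ is bounded from $L^\infty((0,\infty),\gamma_\alpha)$ into $\mathrm{BMO}((0,\infty),\gamma_\alpha)$. (b) Assume that $T$ is bounded on $L^2((0,\infty),\gamma_\alpha)$ and that it can be extended from $L^2((0,\infty),\gamma_\alpha)$ to $L^1((0,\infty),\gamma_\alpha)$ as a bounded operator from $L^1((0,\infty),\gamma_\alpha)$ into $L^{1,\infty}((0,\infty),\gamma_\alpha)$. Also suppose that $$\sup_{I\in \mathcal{B}_1}\ \sup_{y,z\in I}\int_{(2I)^c}\|K_t(x,y)-K_t(x,z)\|_X\, d\gamma_\alpha(x)<\infty.$$ Then $T$ can be extended from $H^1((0,\infty),\gamma_\alpha)\cap L^2((0,\infty),\gamma_\alpha)$ to $H^1((0,\infty),\gamma_\alpha)$ as a bounded operator from $H^1((0,\infty),\gamma_\alpha)$ into $L^1((0,\infty),\gamma_\alpha)$.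
   Context: Measure: $d\gamma_\alpha(x)=\frac{2}{\Gamma(\alpha+1)}x^{2\alpha+1}e^{-x^2}dx$ on $(0,\infty)$, a probability measure. Intervals: $m(x)=\min\{1,1/x\}$ for $x\in(0,\infty)$. $I(x,r)=(x-r,x+r)\cap(0,\infty)$ for $x,r\in(0,\infty)$. For $a>0$, $\mathcal{B}_a$ is the family of intervals $(x-r,x+r)$ with $0<r\le x$ and $r\le a\,m(x)$. For $I$ with center $c_I$ and radius $r_I$, $2I$ is the interval with center $c_I$ and radius $2r_I$ (intersected with $(0,\infty)$), and $(2I)^c=(0,\infty)\setminus 2I$. Hardy space: let $a>0$, $1<q\le\infty$. A measurable function $b$ on $(0,\infty)$ is an $(a,q,\alpha)$-atom if either $b\equiv1$, or there exist $0<r_0\le x_0$ with $I(x_0,r_0)\in\mathcal{B}_a$ such that (i) $\mathrm{supp}(b)\subset I(x_0,r_0)$; (ii) $\|b\|_{L^q((0,\infty),\gamma_\alpha)}\le\gamma_\alpha(I(x_0,r_0))^{\frac1q-1}$ (with $\frac1q=0$ if $q=\infty$); (iii) $\int_0^\infty b\,d\gamma_\alpha=0$. $H^{1,q}_a((0,\infty),\gamma_\alpha)$ is the space of $f\in L^1((0,\infty),\gamma_\alpha)$ that can be written $f=\sum_{j=0}^\infty\lambda_jb_j$ with $b_j$ $(a,q,\alpha)$-atoms and $\lambda_j\in\mathbb{C}$, $\sum_j|\lambda_j|<\infty$; its norm is the infimum of $\sum_j|\lambda_j|$ over all such representations. It is known that the space does not depend on $a>0$ and $1<q\le\infty$; it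 is denoted $H^1((0,\infty),\gamma_\alpha)$. BMO space: for $a>0$, $f\in L^1((0,\infty),\gamma_\alpha)$ is in $\mathrm{BMO}_a((0,\infty),\gamma_\alpha)$ if $\|f\|_{*,a,\alpha}=\sup_{I\in\mathcal{B}_a}\frac1{\gamma_\alpha(I)}\int_I|f-f_I|\,d\gamma_\alpha<\infty$, where $f_I=\frac1{\gamma_\alpha(I)}\int_If\,d\gamma_\alpha$. The norm is $\|f\|_{L^1((0,\infty),\gamma_\alpha)}+\|f\|_{*,a,\alpha}$. It is known that the space does not depend on $a$; it is denoted $\mathrm{BMO}((0,\infty),\gamma_\alpha)$. $L^{1,\infty}$ denotes the weak $L^1$ space. (I)-type operators: $T$ is a linear operator from $L^2((0,\infty),\gamma_\alpha)$ into the space of measurable functions on $(0,\infty)$ such that, for a certain measurable function $K:((0,\infty)\times(0,\infty))\setminus D\to\mathbb{C}$, where $D=\{(x,x):x\in(0,\infty)\}$, $$T(f)(x)=\int_0^\infty K(x,y)f(y)\,d\gamma_\alpha(y),\quad x\in(0,\infty)\setminus\mathrm{supp}(f),\ f\in L^2((0,\infty),\gamma_\alpha).$$ (II)-type operators: for every $t>0$, $T_t$ is a linear operator from $L^2((0,\infty),\gamma_\alpha)$ into the space of measurable functions such that, for a certain measurable function $K_t:(0,\infty)\times(0,\infty)\to\mathbb{C}$, $$T_t(f)(x)=\int_0^\infty K_t(x,y)f(y)\,d\gamma_\alpha(y),\quad x\in(0,\infty),\ f\in L^2((0,\infty),\gamma_\alpha).$$ Moreover $(X,\|\cdot\|_X)$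 is a Banach space of measurable complex functions defined on $(0,\infty)$ (functions of $t$), the function $((0,\infty)\times(0,\infty))\setminus D\to X$, $(x,y)\mapsto K_{(\cdot)}(x,y)$, is $X$-strongly measurable, and for every $f\in L^\infty((0,\infty),\gamma_\alpha)$, $\int_0^\infty\|K_{(\cdot)}(x,y)\|_X|f(y)|\,d\gamma_\alpha(y)<\infty$ for every $x\in(0,\infty)\setminus\mathrm{supp}(f)$. The operator $T$ is defined by $T(f)(x)=\|T_{(\cdot)}(f)(x)\|_X$ for $f\in L^2((0,\infty),\gamma_\alpha)$. For a (possibly nonlinear) operator, "bounded from $A$ into $B$" means $\|T(f)\|_B\le C\|f\|_A$ for all $f\in A$, with $C$ independent of $f$.
   Formalization: For (II)-type operators it is also assumed that, for bounded f and almost every x outside supp(f), the function t ↦ T_t(f)(x) is the X-valued Bochner integral of K_t(x,y)f(y); without this the claim fails for pathological Banach spaces X. *)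

theory Defs
  imports "HOL-Probability.Probability"
begin

definition gam :: "real \<Rightarrow> real measure" where
  "gam \<alpha> = density (restrict_space lborel {0<..})
     (\<lambda>x. ennreal (2 / Gamma (\<alpha> + 1) * x powr (2 * \<alpha> + 1) * exp (- x\<^sup>2)))"

text \<open>
  Function spaces are sets of functions, with almost everywhere equal functions not identified;
  only the values on $(0,\infty)$, the space of the measure, matter.
\<close>

definition Lp :: "real \<Rightarrow> ereal \<Rightarrow> (real \<Rightarrow> 'b::real_normed_vector) set" where
  "Lp \<alpha> q = {f \<in> borel_measurable (gam \<alpha>).
     if q = \<infinity> then esssup (gam \<alpha>) (\<lambda>x. ereal (norm (f x))) < \<infinity>
     else integrable (gam \<alpha>) (\<lambda>x. norm (f x) powr real_of_ereal q)}"

definition Lp_norm :: "real \<Rightarrow> ereal \<Rightarrow> (real \<Rightarrow> 'b::real_normed_vector) \<Rightarrow> real" where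
  "Lp_norm \<alpha> q f =
     (if q = \<infinity> then real_of_ereal (esssup (gam \<alpha>) (\<lambda>x. ereal (norm (f x))))
      else (\<integral>x. norm (f x) powr real_of_ereal q \<partial>gam \<alpha>) powr (1 / real_of_ereal q))"

definition weak_L1 :: "real \<Rightarrow> (real \<Rightarrow> 'b::real_normed_vector) set" where
  "weak_L1 \<alpha> = {f \<in> borel_measurable (gam \<alpha>).
     bdd_above ((\<lambda>s. s * measure (gam \<alpha>) {x \<in> {0<..}. s < norm (f x)}) ` {0<..})}"

definition weak_L1_norm :: "real \<Rightarrow> (real \<Rightarrow> 'b::real_normed_vector) \<Rightarrow> real" where
  "weak_L1_norm \<alpha> f = (SUP s\<in>{0<..}. s * measure (gam \<alpha>) {x \<in> {0<..}. s < norm (f x)})"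

text \<open>The support of a function (not of its class), closed relative to $(0,\infty)$.\<close>

definition supp :: "(real \<Rightarrow> complex) \<Rightarrow> real set" where
  "supp f = closure {x \<in> {0<..}. f x \<noteq> 0} \<inter> {0<..}"

definition m_fun :: "real \<Rightarrow> real" where
  "m_fun x = min 1 (1 / x)"

definition ivl :: "real \<Rightarrow> real \<Rightarrow> real set" where
  "ivl x r = {x - r<..<x + r} \<inter> {0<..}"

text \<open>An interval of the family is represented by the pair of its centre and its radius, which
  it determines since it is contained in $(0,\infty)$.\<close>

definition adm :: "real \<Rightarrow> (real \<times> real) set" where
  "adm a = {(x, r). 0 < r \<and> r \<le> x \<and> r \<le> a * m_fun x}"

definition atom :: "real \<Rightarrow> real \<Rightarrow> ereal \<Rightarrow> (real \<Rightarrow> complex) \<Rightarrow> bool" where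
  "atom \<alpha> a q b \<longleftrightarrow> b \<in> borel_measurable (gam \<alpha>) \<and>
     ((\<forall>x>0. b x = 1) \<or>
      (\<exists>(x0, r0)\<in>adm a.
         supp b \<subseteq> ivl x0 r0 \<and>
         b \<in> Lp \<alpha> q \<and>
         Lp_norm \<alpha> q b \<le>
           measure (gam \<alpha>) (ivl x0 r0) powr ((if q = \<infinity> then 0 else 1 / real_of_ereal q) - 1) \<and>
         (\<integral>x. b x \<partial>gam \<alpha>) = 0))"

definition atomic_rep ::
  "real \<Rightarrow> real \<Rightarrow> ereal \<Rightarrow> (real \<Rightarrow> complex) \<Rightarrow> (nat \<Rightarrow> complex) \<Rightarrow> (nat \<Rightarrow> real \<Rightarrow> complex) \<Rightarrow> bool" where
  "atomic_rep \<alpha> a q f l b \<longleftrightarrow> (\<forall>j. atom \<alpha> a q (b j)) \<and> summable (\<lambda>j. cmod (l j)) \<and>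
     (\<lambda>n. Lp_norm \<alpha> 1 (\<lambda>x. f x - (\<Sum>j<n. l j * b j x))) \<longlonglongrightarrow> 0"

definition H1 :: "real \<Rightarrow> real \<Rightarrow> ereal \<Rightarrow> (real \<Rightarrow> complex) set" where
  "H1 \<alpha> a q = {f \<in> Lp \<alpha> 1. \<exists>l b. atomic_rep \<alpha> a q f l b}"

definition H1_norm :: "real \<Rightarrow> real \<Rightarrow> ereal \<Rightarrow> (real \<Rightarrow> complex) \<Rightarrow> real" where
  "H1_norm \<alpha> a q f = Inf {(\<Sum>j. cmod (l j)) | l b. atomic_rep \<alpha> a q f l b}"

definition avg :: "real \<Rightarrow> real set \<Rightarrow> (real \<Rightarrow> 'b::{banach, second_countable_topology}) \<Rightarrow> 'b" where
  "avg \<alpha> I f = (1 / measure (gam \<alpha>) I) *\<^sub>R (LINT x:I|gam \<alpha>. f x)"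

definition mean_osc ::
  "real \<Rightarrow> (real \<Rightarrow> 'b::{banach, second_countable_topology}) \<Rightarrow> real \<times> real \<Rightarrow> real" where
  "mean_osc \<alpha> f = (\<lambda>(c, r). avg \<alpha> (ivl c r) (\<lambda>x. norm (f x - avg \<alpha> (ivl c r) f)))"

definition BMO :: "real \<Rightarrow> real \<Rightarrow> (real \<Rightarrow> 'b::{banach, second_countable_topology}) set" where
  "BMO \<alpha> a = {f \<in> Lp \<alpha> 1. bdd_above (mean_osc \<alpha> f ` adm a)}"

definition BMO_norm ::
  "real \<Rightarrow> real \<Rightarrow> (real \<Rightarrow> 'b::{banach, second_countable_topology}) \<Rightarrow> real" where
  "BMO_norm \<alpha> a f = Lp_norm \<alpha> 1 f + (SUP I\<in>adm a. mean_osc \<alpha> f I)"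

definition bounded_op ::
  "'f set \<Rightarrow> ('f \<Rightarrow> real) \<Rightarrow> 'g set \<Rightarrow> ('g \<Rightarrow> real) \<Rightarrow> ('f \<Rightarrow> 'g) \<Rightarrow> bool" where
  "bounded_op E normE F normF T \<longleftrightarrow> (\<exists>C. \<forall>f\<in>E. T f \<in> F \<and> normF (T f) \<le> C * normE f)"

text \<open>Maps on representatives that are well defined on almost everywhere equality classes.\<close>

definition operator_on ::
  "real \<Rightarrow> (real \<Rightarrow> complex) set \<Rightarrow> ((real \<Rightarrow> complex) \<Rightarrow> real \<Rightarrow> 'b::real_normed_vector) \<Rightarrow> bool" where
  "operator_on \<alpha> E T \<longleftrightarrow>
     (\<forall>f\<in>E. T f \<in> borel_measurable (gam \<alpha>)) \<and>
     (\<forall>f\<in>E. \<forall>g\<in>E. (AE x in gam \<alpha>. f x = g x) \<longrightarrow> (AE x in gam \<alpha>. T f x = T g x))"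

definition linear_operator_on ::
  "real \<Rightarrow> (real \<Rightarrow> complex) set \<Rightarrow> ((real \<Rightarrow> complex) \<Rightarrow> real \<Rightarrow> complex) \<Rightarrow> bool" where
  "linear_operator_on \<alpha> E T \<longleftrightarrow> operator_on \<alpha> E T \<and>
     (\<forall>f\<in>E. \<forall>g\<in>E. AE x in gam \<alpha>. T (\<lambda>y. f y + g y) x = T f x + T g x) \<and>
     (\<forall>c. \<forall>f\<in>E. AE x in gam \<alpha>. T (\<lambda>y. c * f y) x = c * T f x)"

definition sublinear_operator_on ::
  "real \<Rightarrow> (real \<Rightarrow> complex) set \<Rightarrow> ((real \<Rightarrow> complex) \<Rightarrow> real \<Rightarrow> real) \<Rightarrow> bool" where
  "sublinear_operator_on \<alpha> E T \<longleftrightarrow> operator_on \<alpha> E T \<and>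
     (\<forall>f\<in>E. AE x in gam \<alpha>. 0 \<le> T f x) \<and>
     (\<forall>f\<in>E. \<forall>g\<in>E. AE x in gam \<alpha>. T (\<lambda>y. f y + g y) x \<le> T f x + T g x) \<and>
     (\<forall>c. \<forall>f\<in>E. AE x in gam \<alpha>. T (\<lambda>y. c * f y) x = cmod c * T f x)"

definition extends :: "real \<Rightarrow> (real \<Rightarrow> complex) set \<Rightarrow>
    ((real \<Rightarrow> complex) \<Rightarrow> real \<Rightarrow> 'b) \<Rightarrow> ((real \<Rightarrow> complex) \<Rightarrow> real \<Rightarrow> 'b) \<Rightarrow> bool" where
  "extends \<alpha> E T S \<longleftrightarrow> (\<forall>f\<in>E. AE x in gam \<alpha>. S f x = T f x)"

text \<open>
  The two kernel conditions. The norm is a parameter because it is the modulus for scalar kernels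
  and the norm of a space of functions of $t$ for kernels $K_t$.
\<close>

definition regular_first :: "real \<Rightarrow> ('x::minus \<Rightarrow> real) \<Rightarrow> (real \<Rightarrow> real \<Rightarrow> 'x) \<Rightarrow> bool" where
  "regular_first \<alpha> N K \<longleftrightarrow>
     (SUP (c, r)\<in>adm 1. SUP (x, z)\<in>ivl c r \<times> ivl c r.
        \<integral>\<^sup>+y\<in>{0<..} - ivl c (2 * r). ennreal (N (K x y - K z y)) \<partial>gam \<alpha>) < \<infinity>"

definition regular_second :: "real \<Rightarrow> ('x::minus \<Rightarrow> real) \<Rightarrow> (real \<Rightarrow> real \<Rightarrow> 'x) \<Rightarrow> bool" where
  "regular_second \<alpha> N K \<longleftrightarrow>
     (SUP (c, r)\<in>adm 1. SUP (y, z)\<in>ivl c r \<times> ivl c r.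
        \<integral>\<^sup>+x\<in>{0<..} - ivl c (2 * r). ennreal (N (K x y - K x z)) \<partial>gam \<alpha>) < \<infinity>"

definition off_diag :: "(real \<times> real) measure" where
  "off_diag = restrict_space (borel \<Otimes>\<^sub>M borel) (({0<..} \<times> {0<..}) - {(x, x) | x. x \<in> {0<..}})"

definition type_I ::
  "real \<Rightarrow> ((real \<Rightarrow> complex) \<Rightarrow> real \<Rightarrow> complex) \<Rightarrow> (real \<Rightarrow> real \<Rightarrow> complex) \<Rightarrow> bool" where
  "type_I \<alpha> T K \<longleftrightarrow>
     linear_operator_on \<alpha> (Lp \<alpha> 2) T \<and>
     (\<lambda>(x, y). K x y) \<in> borel_measurable off_diag \<and>
     (\<forall>f\<in>Lp \<alpha> 2. AE x in gam \<alpha>. x \<notin> supp f \<longrightarrow>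
        integrable (gam \<alpha>) (\<lambda>y. K x y * f y) \<and> T f x = (\<integral>y. K x y * f y \<partial>gam \<alpha>))"

text \<open>
  \<open>banach_fun_space X N\<close>: the set \<open>X\<close> of functions on $(0,\infty)$ with norm \<open>N\<close> is complete.
  Functions of norm zero are only required to vanish almost everywhere, so that this covers spaces
  of genuine functions (such as the bounded functions with the supremum norm) as well as spaces of
  classes, represented by the set of all members of all classes. The second
  conjunct says that values outside $(0,\infty)$ are irrelevant.
\<close>

definition banach_fun_space :: "(real \<Rightarrow> complex) set \<Rightarrow> ((real \<Rightarrow> complex) \<Rightarrow> real) \<Rightarrow> bool" where
  "banach_fun_space X N \<longleftrightarrow>
     X \<subseteq> borel_measurable (lebesgue_on {0<..}) \<and>
     (\<forall>u\<in>X. \<forall>v. (\<forall>t>0. v t = u t) \<longrightarrow> v \<in> X \<and> N v = N u) \<and>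
     (\<lambda>t. 0) \<in> X \<and>
     (\<forall>u\<in>X. \<forall>v\<in>X. (\<lambda>t. u t + v t) \<in> X \<and> N (\<lambda>t. u t + v t) \<le> N u + N v) \<and>
     (\<forall>c. \<forall>u\<in>X. (\<lambda>t. c * u t) \<in> X \<and> N (\<lambda>t. c * u t) = cmod c * N u) \<and>
     (\<forall>u\<in>X. 0 \<le> N u \<and> (N u = 0 \<longrightarrow> (AE t in lebesgue_on {0<..}. u t = 0))) \<and>
     (\<forall>u. (\<forall>n. u n \<in> X) \<and> (\<forall>e>0. \<exists>k. \<forall>i\<ge>k. \<forall>j\<ge>k. N (u i - u j) < e) \<longrightarrow>
        (\<exists>v\<in>X. (\<lambda>n. N (u n - v)) \<longlonglongrightarrow> 0))"

text \<open>Strong measurability and the Bochner integral, for functions \<open>k\<close> with values in \<open>(X, N)\<close>.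
  The library versions are for normed space types, and integrals there need separability.\<close>

definition simple_into :: "(real \<Rightarrow> complex) set \<Rightarrow> 'a measure \<Rightarrow> ('a \<Rightarrow> real \<Rightarrow> complex) \<Rightarrow> bool" where
  "simple_into X M s \<longleftrightarrow> simple_function M s \<and> s ` space M \<subseteq> X"

definition strongly_measurable :: "(real \<Rightarrow> complex) set \<Rightarrow> ((real \<Rightarrow> complex) \<Rightarrow> real) \<Rightarrow>
    'a measure \<Rightarrow> ('a \<Rightarrow> real \<Rightarrow> complex) \<Rightarrow> bool" where
  "strongly_measurable X N M k \<longleftrightarrow> k ` space M \<subseteq> X \<and>
     (\<exists>s. (\<forall>n. simple_into X M (s n)) \<and> (\<forall>p\<in>space M. (\<lambda>n. N (s n p - k p)) \<longlonglongrightarrow> 0))"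

definition simple_integral_X :: "'a measure \<Rightarrow> ('a \<Rightarrow> real \<Rightarrow> complex) \<Rightarrow> real \<Rightarrow> complex" where
  "simple_integral_X M s =
     (\<lambda>t. \<Sum>w\<in>s ` space M. complex_of_real (measure M (s -` {w} \<inter> space M)) * w t)"

definition has_integral_X :: "(real \<Rightarrow> complex) set \<Rightarrow> ((real \<Rightarrow> complex) \<Rightarrow> real) \<Rightarrow>
    'a measure \<Rightarrow> ('a \<Rightarrow> real \<Rightarrow> complex) \<Rightarrow> (real \<Rightarrow> complex) \<Rightarrow> bool" where
  "has_integral_X X N M k v \<longleftrightarrow> strongly_measurable X N M k \<and> v \<in> X \<and>
     (\<exists>s. (\<forall>n. simple_into X M (s n)) \<and>
        (\<lambda>n. \<integral>\<^sup>+p. ennreal (N (k p - s n p)) \<partial>M) \<longlonglongrightarrow> 0 \<and>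
        (\<lambda>n. N (simple_integral_X M (s n) - v)) \<longlonglongrightarrow> 0)"

text \<open>
  The operator $f \mapsto \|T_{(\cdot)}(f)(x)\|_X$. In the definition of \<open>type_II\<close> the value \<open>0\<close>
  is used only on a null set of points \<open>x\<close>.
\<close>

definition norm_op :: "(real \<Rightarrow> complex) set \<Rightarrow> ((real \<Rightarrow> complex) \<Rightarrow> real) \<Rightarrow>
    (real \<Rightarrow> (real \<Rightarrow> complex) \<Rightarrow> real \<Rightarrow> complex) \<Rightarrow> (real \<Rightarrow> complex) \<Rightarrow> real \<Rightarrow> real" where
  "norm_op X N T f x = (if (\<lambda>t. T t f x) \<in> X then N (\<lambda>t. T t f x) else 0)"

text \<open>
  In \<open>type_II\<close> below, the last condition says that for bounded \<open>f\<close> and \<open>x\<close> outside its support,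
  where $\int \|K_{(\cdot)}(x,y)\|_X |f(y)|\,d\gamma_\alpha(y)$ is finite, the function
  $t \mapsto \int K_t(x,y) f(y)\,d\gamma_\alpha(y)$ is the \<open>X\<close>-valued Bochner integral of
  $y \mapsto K_{(\cdot)}(x,y) f(y)$. This is not automatic, because nothing relates the norm
  of \<open>X\<close> to the values of its members at individual points \<open>t\<close>.
\<close>

definition type_II :: "real \<Rightarrow> (real \<Rightarrow> (real \<Rightarrow> complex) \<Rightarrow> real \<Rightarrow> complex) \<Rightarrow>
    (real \<Rightarrow> real \<Rightarrow> real \<Rightarrow> complex) \<Rightarrow>
    (real \<Rightarrow> complex) set \<Rightarrow> ((real \<Rightarrow> complex) \<Rightarrow> real) \<Rightarrow> bool" where
  "type_II \<alpha> T K X N \<longleftrightarrow>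
     (\<forall>t>0. linear_operator_on \<alpha> (Lp \<alpha> 2) (T t) \<and>
        (\<lambda>(x, y). K t x y) \<in> borel_measurable (restrict_space (borel \<Otimes>\<^sub>M borel) ({0<..} \<times> {0<..})) \<and>
        (\<forall>f\<in>Lp \<alpha> 2. \<forall>x>0.
           integrable (gam \<alpha>) (\<lambda>y. K t x y * f y) \<and> T t f x = (\<integral>y. K t x y * f y \<partial>gam \<alpha>))) \<and>
     banach_fun_space X N \<and>
     strongly_measurable X N off_diag (\<lambda>(x, y) t. K t x y) \<and>
     (\<forall>f\<in>Lp \<alpha> \<infinity>. \<forall>x\<in>{0<..} - supp f.
        (\<integral>\<^sup>+y. ennreal (N (\<lambda>t. K t x y)) * ennreal (cmod (f y)) \<partial>gam \<alpha>) < \<infinity>) \<and>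
     (\<forall>f\<in>Lp \<alpha> 2. (AE x in gam \<alpha>. (\<lambda>t. T t f x) \<in> X) \<and>
        norm_op X N T f \<in> borel_measurable (gam \<alpha>)) \<and>
     (\<forall>f\<in>Lp \<alpha> \<infinity>. AE x in gam \<alpha>. x \<notin> supp f \<longrightarrow>
        has_integral_X X N (gam \<alpha>) (\<lambda>y t. K t x y * f y) (\<lambda>t. T t f x))"

end

theory Submission
  imports Defs
begin

text \<open>
  The proof rests on features that both types of operators share. Differences are controlled,
  $|Tf-Tg| \le |T(f-g)|$; $T$ is bounded on $L^2$; and away from the support of \<open>f\<close> the
  differences of its values, and the values themselves if \<open>f\<close> has mean zero, are dominated by
  integrals of kernel differences. The norm $\|K(p)-K(q)\|_X$ enters only as a measurable
  pseudo-distance \<open>D p q\<close> on the plane without the diagonal (locale \<open>kernel_dist\<close>), so that a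
  scalar kernel and an $X$-valued one are treated alike.

  The conclusions concern the intervals of $\mathcal{B}_a$ while the kernel conditions concern
  $\mathcal{B}_1$. Two points of an interval \<open>I\<close> of $\mathcal{B}_a$ are joined by a chain of
  boundedly many steps, each inside an interval of $\mathcal{B}_1$ whose double lies in \<open>2I\<close>;
  by the triangle inequality the conditions pass to $\mathcal{B}_a$ (\<open>adm_chain\<close>,
  \<open>regular_adm\<close>). The other geometric input is that the measure is doubling on $\mathcal{B}_a$
  (\<open>gam_doubling\<close>): on the double of such an interval the weight $x^{2\alpha+1}e^{-x^2}$ is at
  most a constant times its value at the centre, because the radius is at most $a/c$ and at
  most the centre $c$.

  For (a), \<open>f\<close> is cut along \<open>2I\<close>. The inner part is estimated in $L^2$ and with the doubling
  property, and the outer part is nearly constant on \<open>I\<close> by the kernel condition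
  (\<open>bounded_Linf_BMO\<close>).

  For (b), the main point is a bound for $\|Tg\|_1$, uniform over functions \<open>g\<close> that are
  nearly atoms. Off \<open>2I\<close> it follows from the cancellation of \<open>g\<close> and Fubini
  (\<open>U_integral_away\<close>). On \<open>2I\<close> an exponent below $2$ has to be reached, and the bounds at hand
  are the strong one on $L^2$ and the weak one on $L^1$. As in the Marcinkiewicz theorem, the
  distribution function at height \<open>s\<close> is estimated by splitting \<open>g\<close> at height \<open>s\<close>; integrating
  over the heights above $s_0=1/\gamma_\alpha(I)$ and estimating trivially below gives the
  bound directly in $L^1(2I)$ (\<open>U_integral_near\<close>). Atoms themselves may fail to be in $L^2$,
  where the kernel representation is available. They are truncated and corrected so that their
  mean is still zero (\<open>atom_truncation\<close>).

  To pass to all of $H^1$, the extension of $|T|$ to $L^1$ is pinned down by an inequality: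
  \<open>u\<close> is the value at \<open>f\<close> if $T h$ is close to \<open>u\<close> in the weak $L^1$ sense whenever $h\in L^2$
  is close to \<open>f\<close> in $L^1$ (\<open>limit_of\<close>). Such a \<open>u\<close> exists, by a Borel-Cantelli argument, and
  is unique almost everywhere, so that sublinearity and the agreement with the original
  operator follow by approximation. An atomic sum is approximated by finite sums of truncated
  atoms, which gives $\|u\|_1 \le C\sum_j|\lambda_j|$ (\<open>limit_of_H1_bound\<close>). A linear
  extension as in type (I) satisfies this inequality in absolute value and is therefore itself
  the desired extension. For type (II) the extension to $L^1$ is only assumed to be bounded,
  so the operator on $H^1$ is defined by choosing the \<open>u\<close>.
\<close>

section \<open>The measure and its local doubling property\<close>

abbreviation gdens :: "real \<Rightarrow> real \<Rightarrow> real" where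
  "gdens \<alpha> x \<equiv> 2 / Gamma (\<alpha> + 1) * x powr (2 * \<alpha> + 1) * exp (- x\<^sup>2)"

lemma space_gam [simp]: "space (gam \<alpha>) = {0<..}"
  by (simp add: gam_def space_restrict_space)

lemma sets_gam [measurable_cong]: "sets (gam \<alpha>) = sets (restrict_space borel {0<..})"
  by (simp add: gam_def cong: sets_restrict_space_cong)

lemma sets_gam_iff: "A \<in> sets (gam \<alpha>) \<longleftrightarrow> A \<in> sets borel \<and> A \<subseteq> {0<..}"
  by (subst sets_gam, subst sets_restrict_space_iff) auto

lemma nn_integral_gam:
  assumes "f \<in> borel_measurable (gam \<alpha>)"
  shows "(\<integral>\<^sup>+x. f x \<partial>gam \<alpha>) = (\<integral>\<^sup>+x. ennreal (gdens \<alpha> x) * f x * indicator {0<..} x \<partial>lborel)"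
proof -
  have "f \<in> borel_measurable (restrict_space lborel {0<..})"
    using assms by (simp add: gam_def)
  moreover have "(\<lambda>x. ennreal (gdens \<alpha> x)) \<in> borel_measurable (restrict_space lborel {0<..})"
    by (rule measurable_restrict_space1) measurable
  ultimately show ?thesis
    unfolding gam_def
    by (subst nn_integral_density) (auto simp: nn_integral_restrict_space)
qed

lemma emeasure_gam:
  assumes "A \<in> sets (gam \<alpha>)"
  shows "emeasure (gam \<alpha>) A = (\<integral>\<^sup>+x. ennreal (gdens \<alpha> x) * indicator A x \<partial>lborel)"
proof -
  have "emeasure (gam \<alpha>) A = (\<integral>\<^sup>+x. indicator A x \<partial>gam \<alpha>)"
    using assms by simp
  also have "\<dots> = (\<integral>\<^sup>+x. ennreal (gdens \<alpha> x) * indicator A x * indicator {0<..} x \<partial>lborel)"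
    using assms by (subst nn_integral_gam) auto
  also have "\<dots> = (\<integral>\<^sup>+x. ennreal (gdens \<alpha> x) * indicator A x \<partial>lborel)"
    using assms by (intro nn_integral_cong) (auto simp: sets_gam_iff indicator_def)
  finally show ?thesis .
qed

text \<open>
  The weight is bounded near zero and at most $x^{2\alpha+1}e^{-x}$ beyond $1$, and the latter
  is the integrand of a Gamma function.
\<close>

lemma finite_measure_gam:
  assumes "\<alpha> > - 1 / 2"
  shows "finite_measure (gam \<alpha>)"
proof
  define p where "p = 2 * \<alpha> + 1"
  have p: "p > 0" using assms by (simp add: p_def)
  define k where "k = 2 / Gamma (\<alpha> + 1)"
  have k: "k > 0" using assms by (simp add: k_def)
  have bound: "gdens \<alpha> x * indicator {0<..} x
      \<le> k * (indicator {0..1} x + x powr (p + 1 - 1) / exp x * indicator {0..} x)" for x :: real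
  proof (cases "x > 0")
    case True
    show ?thesis
    proof (cases "x \<le> 1")
      case True
      have "x powr p \<le> 1" using \<open>x > 0\<close> True p by (simp add: powr_le1)
      moreover have "exp (- x\<^sup>2) \<le> 1" by simp
      ultimately have "x powr p * exp (- x\<^sup>2) \<le> 1 * 1" by (intro mult_mono) auto
      moreover have "0 \<le> x powr p / exp x" by simp
      ultimately have "x powr p * exp (- x\<^sup>2) \<le> 1 + x powr p / exp x" by linarith
      then have "k * (x powr p * exp (- x\<^sup>2)) \<le> k * (1 + x powr p / exp x)"
        using k by (intro mult_left_mono) auto
      then show ?thesis
        using \<open>x > 0\<close> True by (simp add: p_def k_def mult.assoc add.commute)
    next
      case False
      have "x \<le> x\<^sup>2" using False by (simp add: power2_eq_square)
      then have "x powr p * exp (- x\<^sup>2) \<le> x powr p * exp (- x)"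
        by (intro mult_left_mono) auto
      then have "x powr p * exp (- x\<^sup>2) \<le> x powr p / exp x"
        by (simp add: exp_minus divide_inverse)
      then have "k * (x powr p * exp (- x\<^sup>2)) \<le> k * (x powr p / exp x)"
        using k by (intro mult_left_mono) auto
      then show ?thesis
        using False by (simp add: p_def k_def mult.assoc add.commute)
    qed
  qed (use k in auto)
  have "(\<lambda>t. t powr (p + 1 - 1) / exp t) absolutely_integrable_on {0..}"
    using Gamma_integral_real[of "p + 1"] p
    by (intro nonnegative_absolutely_integrable_1) (auto simp: has_integral_iff)
  then have "integrable lebesgue (\<lambda>t. indicator {0..} t *\<^sub>R (t powr (p + 1 - 1) / exp t))"
    by (simp add: set_integrable_def)
  then have "integrable lborel (\<lambda>t. indicator {0..} t *\<^sub>R (t powr (p + 1 - 1) / exp t))"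
    by (subst (asm) integrable_completion) auto
  then have int: "integrable lborel
      (\<lambda>x. k * (indicator {0..1} x + x powr (p + 1 - 1) / exp x * indicator {0..} x))"
    by (simp add: mult.commute)
  have "emeasure (gam \<alpha>) {0<..} \<le> (\<integral>\<^sup>+x. ennreal
      (k * (indicator {0..1} x + x powr (p + 1 - 1) / exp x * indicator {0..} x)) \<partial>lborel)"
  proof -
    have "ennreal (gdens \<alpha> x) * indicator {0<..} x = ennreal (gdens \<alpha> x * indicator {0<..} x)" for x
      by (auto simp: indicator_def)
    then have "ennreal (gdens \<alpha> x) * indicator {0<..} x \<le> ennreal
        (k * (indicator {0..1} x + x powr (p + 1 - 1) / exp x * indicator {0..} x))" for x
      using ennreal_leI[OF bound] by metis
    moreover have "{0<..} \<in> sets (gam \<alpha>)" by (simp add: sets_gam_iff)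
    ultimately show ?thesis
      unfolding emeasure_gam[OF \<open>{0<..} \<in> sets (gam \<alpha>)\<close>] by (intro nn_integral_mono)
  qed
  also have "\<dots> < \<infinity>"
    using int by (subst nn_integral_eq_integral) (auto intro!: AE_I2 mult_nonneg_nonneg less_imp_le[OF k])
  finally show "emeasure (gam \<alpha>) (space (gam \<alpha>)) \<noteq> \<infinity>"
    by simp
qed

lemma sets_ivl [measurable, simp]: "ivl c r \<in> sets (gam \<alpha>)"
  by (auto simp: sets_gam_iff ivl_def)

lemma admD:
  assumes "(c, r) \<in> adm a"
  shows "0 < r" "r \<le> c" "0 < c" "r \<le> a" "r * c \<le> a" "0 < a"
proof -
  show *: "0 < r" "r \<le> c" using assms by (auto simp: adm_def)
  then show c: "0 < c" by simp
  have 1: "r \<le> a * min 1 (1 / c)" using assms by (auto simp: adm_def m_fun_def)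
  have "0 < min 1 (1 / c)" using c by simp
  then show a: "0 < a"
    using * 1 by (metis less_le_trans zero_less_mult_pos2)
  have "a * min 1 (1/c) \<le> a * 1" using a by (intro mult_left_mono) auto
  then show "r \<le> a" using 1 by simp
  have "a * min 1 (1/c) \<le> a * (1/c)" using a by (intro mult_left_mono) auto
  then have "r \<le> a / c" using 1 by simp
  then show "r * c \<le> a" using c by (simp add: pos_le_divide_eq)
qed

text \<open>
  The right half of the interval is enough: there $x^{2\alpha+1}$ is at least its value at the
  centre, and $x^2-c^2 \le 3rc \le 3a$.
\<close>

lemma gam_ivl_lower:
  assumes \<alpha>: "\<alpha> > - 1 / 2" and adm: "(c, r) \<in> adm a"
  shows "ennreal (2 / Gamma (\<alpha> + 1) * c powr (2 * \<alpha> + 1) * exp (- c\<^sup>2) * exp (- (3 * a)) * r)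
    \<le> emeasure (gam \<alpha>) (ivl c r)"
proof -
  note A = admD[OF adm]
  define k where "k = 2 / Gamma (\<alpha> + 1)"
  have k: "k > 0" using \<alpha> by (simp add: k_def)
  have "k * c powr (2 * \<alpha> + 1) * exp (- c\<^sup>2) * exp (- (3 * a)) \<le> gdens \<alpha> x"
    if x: "x \<in> {c..<c + r}" for x
  proof -
    have "x\<^sup>2 - c\<^sup>2 = (x - c) * (x + c)" by (simp add: power2_eq_square algebra_simps)
    also have "\<dots> \<le> r * (3 * c)" using x A by (intro mult_mono) auto
    also have "\<dots> \<le> 3 * a" using A by simp
    finally have "exp (- c\<^sup>2 - 3 * a) \<le> exp (- x\<^sup>2)" by simp
    moreover have "c powr (2 * \<alpha> + 1) \<le> x powr (2 * \<alpha> + 1)"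
      using x A \<alpha> by (intro powr_mono2) auto
    ultimately have "c powr (2 * \<alpha> + 1) * exp (- c\<^sup>2 - 3 * a) \<le> x powr (2 * \<alpha> + 1) * exp (- x\<^sup>2)"
      by (intro mult_mono) auto
    then have "k * (c powr (2 * \<alpha> + 1) * exp (- c\<^sup>2 - 3 * a)) \<le> k * (x powr (2 * \<alpha> + 1) * exp (- x\<^sup>2))"
      using k by (intro mult_left_mono) auto
    then show ?thesis
      by (simp add: k_def mult.assoc exp_diff exp_minus divide_inverse)
  qed
  then have *: "ennreal (k * c powr (2 * \<alpha> + 1) * exp (- c\<^sup>2) * exp (- (3 * a))) * indicator {c..<c + r} x
     \<le> ennreal (gdens \<alpha> x) * indicator (ivl c r) x" for x
    using A by (auto simp: indicator_def ivl_def intro!: ennreal_leI)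
  have "ennreal (k * c powr (2 * \<alpha> + 1) * exp (- c\<^sup>2) * exp (- (3 * a)) * r) =
     (\<integral>\<^sup>+x. ennreal (k * c powr (2 * \<alpha> + 1) * exp (- c\<^sup>2) * exp (- (3 * a))) * indicator {c..<c + r} x \<partial>lborel)"
    using A k by (subst nn_integral_cmult_indicator) (auto simp: ennreal_mult)
  also have "\<dots> \<le> (\<integral>\<^sup>+x. ennreal (gdens \<alpha> x) * indicator (ivl c r) x \<partial>lborel)"
    by (intro nn_integral_mono) (rule *)
  finally show ?thesis by (simp add: emeasure_gam k_def)
qed

text \<open>
  On the double, $x \le 3c$ and $c^2-x^2 \le 8rc \le 8a$.
\<close>

lemma gam_ivl_upper:
  assumes \<alpha>: "\<alpha> > - 1 / 2" and adm: "(c, r) \<in> adm a"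
  shows "emeasure (gam \<alpha>) (ivl c (2 * r)) \<le>
    ennreal (2 / Gamma (\<alpha> + 1) * (3 * c) powr (2 * \<alpha> + 1) * exp (- c\<^sup>2) * exp (8 * a) * (4 * r))"
proof -
  note A = admD[OF adm]
  define k where "k = 2 / Gamma (\<alpha> + 1)"
  have k: "k > 0" using \<alpha> by (simp add: k_def)
  have "gdens \<alpha> x \<le> k * (3 * c) powr (2 * \<alpha> + 1) * exp (- c\<^sup>2) * exp (8 * a)"
    if x: "x \<in> ivl c (2 * r)" for x
  proof -
    have "c\<^sup>2 - x\<^sup>2 = (c - x) * (x + c)" by (simp add: power2_eq_square algebra_simps)
    also have "\<dots> \<le> (2 * r) * (4 * c)"
      using x A by (intro mult_mono) (auto simp: ivl_def)
    also have "\<dots> \<le> 8 * a" using A by simp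
    finally have "exp (- x\<^sup>2) \<le> exp (- c\<^sup>2 + 8 * a)" by simp
    moreover have "x powr (2 * \<alpha> + 1) \<le> (3 * c) powr (2 * \<alpha> + 1)"
      using x A \<alpha> by (intro powr_mono2) (auto simp: ivl_def)
    ultimately have "x powr (2 * \<alpha> + 1) * exp (- x\<^sup>2) \<le> (3 * c) powr (2 * \<alpha> + 1) * exp (- c\<^sup>2 + 8 * a)"
      by (intro mult_mono) auto
    then have "k * (x powr (2 * \<alpha> + 1) * exp (- x\<^sup>2)) \<le> k * ((3 * c) powr (2 * \<alpha> + 1) * exp (- c\<^sup>2 + 8 * a))"
      using k by (intro mult_left_mono) auto
    then show ?thesis
      unfolding exp_add k_def by (simp only: mult.assoc)
  qed
  then have *: "ennreal (gdens \<alpha> x) * indicator (ivl c (2 * r)) x \<le>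
     ennreal (k * (3 * c) powr (2 * \<alpha> + 1) * exp (- c\<^sup>2) * exp (8 * a)) * indicator {c - 2 * r <..< c + 2 * r} x" for x
    by (auto simp: indicator_def ivl_def intro!: ennreal_leI)
  have "emeasure (gam \<alpha>) (ivl c (2 * r)) = (\<integral>\<^sup>+x. ennreal (gdens \<alpha> x) * indicator (ivl c (2 * r)) x \<partial>lborel)"
    by (simp add: emeasure_gam)
  also have "\<dots> \<le> (\<integral>\<^sup>+x. ennreal (k * (3 * c) powr (2 * \<alpha> + 1) * exp (- c\<^sup>2) * exp (8 * a))
      * indicator {c - 2 * r <..< c + 2 * r} x \<partial>lborel)"
    by (intro nn_integral_mono) (rule *)
  also have "\<dots> = ennreal (k * (3 * c) powr (2 * \<alpha> + 1) * exp (- c\<^sup>2) * exp (8 * a) * (4 * r))"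
    using A k by (subst nn_integral_cmult_indicator) (auto simp: ennreal_mult)
  finally show ?thesis by (simp add: k_def)
qed

lemma measure_ivl_pos:
  assumes \<alpha>: "\<alpha> > - 1 / 2" and adm: "(c, r) \<in> adm a"
  shows "0 < measure (gam \<alpha>) (ivl c r)"
proof -
  interpret finite_measure "gam \<alpha>" by (rule finite_measure_gam[OF \<alpha>])
  note A = admD[OF adm]
  have "0 < ennreal (2 / Gamma (\<alpha> + 1) * c powr (2 * \<alpha> + 1) * exp (- c\<^sup>2) * exp (- (3 * a)) * r)"
    using A \<alpha> by simp
  also have "\<dots> \<le> emeasure (gam \<alpha>) (ivl c r)" by (rule gam_ivl_lower[OF assms])
  finally show ?thesis by (simp add: emeasure_eq_measure)
qed

lemma gam_doubling:
  assumes \<alpha>: "\<alpha> > - 1 / 2" and a: "a > 0"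
  obtains C where "C \<ge> 1"
    "\<And>c r. (c, r) \<in> adm a \<Longrightarrow> measure (gam \<alpha>) (ivl c (2 * r)) \<le> C * measure (gam \<alpha>) (ivl c r)"
proof
  interpret finite_measure "gam \<alpha>" by (rule finite_measure_gam[OF \<alpha>])
  define C where "C = 4 * 3 powr (2 * \<alpha> + 1) * exp (8 * a) * exp (3 * a)"
  have "1 \<le> 3 powr (2 * \<alpha> + 1)" using \<alpha> by (simp add: ge_one_powr_ge_zero)
  moreover have "1 \<le> exp (8 * a)" "1 \<le> exp (3 * a)" using a by auto
  ultimately have "1 * 1 * 1 * 1 \<le> C"
    unfolding C_def by (intro mult_mono) auto
  then show "C \<ge> 1" by simp
  fix c r assume adm: "(c, r) \<in> adm a"
  note A = admD[OF adm]
  define k where "k = 2 / Gamma (\<alpha> + 1)"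
  have k: "k > 0" using \<alpha> by (simp add: k_def)
  have lo: "k * c powr (2 * \<alpha> + 1) * exp (- c\<^sup>2) * exp (- (3 * a)) * r \<le> measure (gam \<alpha>) (ivl c r)"
    using gam_ivl_lower[OF \<alpha> adm] A k
    by (simp add: emeasure_eq_measure k_def)
  have "measure (gam \<alpha>) (ivl c (2 * r)) \<le> k * (3 * c) powr (2 * \<alpha> + 1) * exp (- c\<^sup>2) * exp (8 * a) * (4 * r)"
    using gam_ivl_upper[OF \<alpha> adm] A k
    by (simp add: emeasure_eq_measure k_def)
  also have "\<dots> = C * (k * c powr (2 * \<alpha> + 1) * exp (- c\<^sup>2) * exp (- (3 * a)) * r)"
    using A unfolding C_def by (simp add: powr_mult exp_minus)
  also have "\<dots> \<le> C * measure (gam \<alpha>) (ivl c r)"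
    using lo \<open>C \<ge> 1\<close> by (intro mult_left_mono) auto
  finally show "measure (gam \<alpha>) (ivl c (2 * r)) \<le> C * measure (gam \<alpha>) (ivl c r)" .
qed


section \<open>Lebesgue spaces through upper integrals\<close>

text \<open>The exponent of the square integrable functions is kept as the numeral in which it is
  written. As a real number under \<open>ereal\<close> it would not match the facts below.\<close>

declare numeral_eq_ereal [simp del]

text \<open>These integrals make sense for all measurable functions, so that estimates need no
  integrability conditions. The second one is the square of the norm of $L^2$.\<close>

abbreviation nnorm1 :: "real \<Rightarrow> (real \<Rightarrow> 'b::real_normed_vector) \<Rightarrow> ennreal" where
  "nnorm1 \<alpha> f \<equiv> \<integral>\<^sup>+x. ennreal (norm (f x)) \<partial>gam \<alpha>"

abbreviation nnorm2 :: "real \<Rightarrow> (real \<Rightarrow> 'b::real_normed_vector) \<Rightarrow> ennreal" where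
  "nnorm2 \<alpha> f \<equiv> \<integral>\<^sup>+x. ennreal ((norm (f x))\<^sup>2) \<partial>gam \<alpha>"

lemma Lp2_iff:
  "f \<in> Lp \<alpha> 2 \<longleftrightarrow> f \<in> borel_measurable (gam \<alpha>) \<and> nnorm2 \<alpha> f < \<infinity>"
  by (auto simp: Lp_def integrable_iff_bounded numeral_eq_ereal)

lemma Lp1_iff:
  "f \<in> Lp \<alpha> 1 \<longleftrightarrow> f \<in> borel_measurable (gam \<alpha>) \<and> nnorm1 \<alpha> f < \<infinity>"
  by (auto simp: Lp_def integrable_iff_bounded one_ereal_def)

lemma Lp1_integrable:
  fixes f :: "real \<Rightarrow> 'b::{banach, second_countable_topology}"
  shows "f \<in> Lp \<alpha> 1 \<longleftrightarrow> integrable (gam \<alpha>) f"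
  by (simp add: Lp1_iff integrable_iff_bounded)

lemma Lp2_norm:
  assumes "f \<in> Lp \<alpha> 2"
  shows "ennreal ((Lp_norm \<alpha> 2 f)\<^sup>2) = nnorm2 \<alpha> f"
proof -
  have int: "integrable (gam \<alpha>) (\<lambda>x. (norm (f x))\<^sup>2)"
    using assms by (simp add: Lp_def numeral_eq_ereal)
  have "(Lp_norm \<alpha> 2 f)\<^sup>2 = (\<integral>x. (norm (f x))\<^sup>2 \<partial>gam \<alpha>)"
    by (simp add: Lp_norm_def powr_half_sqrt numeral_eq_ereal)
  then show ?thesis
    using int by (simp add: nn_integral_eq_integral)
qed

lemma Lp2_norm_nonneg: "0 \<le> Lp_norm \<alpha> 2 f"
  by (simp add: Lp_norm_def numeral_eq_ereal)

lemma Lp1_norm: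
  assumes "f \<in> Lp \<alpha> 1"
  shows "ennreal (Lp_norm \<alpha> 1 f) = nnorm1 \<alpha> f"
proof -
  have "integrable (gam \<alpha>) (\<lambda>x. norm (f x))"
    using assms by (simp add: Lp_def one_ereal_def)
  then show ?thesis
    by (simp add: Lp_norm_def one_ereal_def nn_integral_eq_integral)
qed

lemma Lp1_norm_nonneg: "0 \<le> Lp_norm \<alpha> 1 f"
  by (simp add: Lp_norm_def one_ereal_def)

text \<open>
  The Cauchy-Schwarz inequality against the indicator of a set of finite measure.
\<close>

lemma nn_integral_le_sqrt:
  assumes "f \<in> Lp \<alpha> 2" "E \<in> sets (gam \<alpha>)"
  shows "(\<integral>\<^sup>+x\<in>E. ennreal (norm (f x)) \<partial>gam \<alpha>)\<^sup>2
     \<le> emeasure (gam \<alpha>) E * nnorm2 \<alpha> f"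
proof -
  have [measurable]: "f \<in> borel_measurable (gam \<alpha>)" "E \<in> sets (gam \<alpha>)"
    using assms by (auto simp: Lp2_iff)
  have "(\<integral>\<^sup>+x. indicator E x * ennreal (norm (f x)) \<partial>gam \<alpha>)\<^sup>2
     \<le> (\<integral>\<^sup>+x. (indicator E x)^2 \<partial>gam \<alpha>) * (\<integral>\<^sup>+x. (ennreal (norm (f x)))^2 \<partial>gam \<alpha>)"
    by (rule Cauchy_Schwarz_nn_integral) measurable
  also have "(\<integral>\<^sup>+x. (indicator E x)^2 \<partial>gam \<alpha>) = emeasure (gam \<alpha>) E"
  proof -
    have "(indicator E x)\<^sup>2 = (indicator E x :: ennreal)" for x by (cases "x \<in> E") auto
    then show ?thesis using assms(2) by simp
  qed
  finally show ?thesis by (simp add: mult.commute ennreal_power)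
qed

lemma Lp2_mono:
  fixes f :: "real \<Rightarrow> 'b::real_normed_vector" and g :: "real \<Rightarrow> 'c::real_normed_vector"
  assumes "f \<in> Lp \<alpha> 2" "g \<in> borel_measurable (gam \<alpha>)" "AE x in gam \<alpha>. norm (g x) \<le> norm (f x)"
  shows "g \<in> Lp \<alpha> 2"
proof -
  have "nnorm2 \<alpha> g \<le> nnorm2 \<alpha> f"
    using assms(3) by (intro nn_integral_mono_AE) (auto intro!: ennreal_leI power_mono)
  then show ?thesis using assms by (auto simp: Lp2_iff)
qed

lemma Lp2_add:
  fixes f g :: "real \<Rightarrow> complex"
  assumes "f \<in> Lp \<alpha> 2" "g \<in> Lp \<alpha> 2"
  shows "(\<lambda>x. f x + g x) \<in> Lp \<alpha> 2"
proof -
  have [measurable]: "f \<in> borel_measurable (gam \<alpha>)" "g \<in> borel_measurable (gam \<alpha>)"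
    using assms by (auto simp: Lp2_iff)
  have *: "(norm (f x + g x))\<^sup>2 \<le> 2 * (norm (f x))\<^sup>2 + 2 * (norm (g x))\<^sup>2" for x
  proof -
    have "(norm (f x + g x))\<^sup>2 \<le> (norm (f x) + norm (g x))\<^sup>2"
      by (intro power_mono norm_triangle_ineq) auto
    also have "\<dots> \<le> 2 * (norm (f x))\<^sup>2 + 2 * (norm (g x))\<^sup>2"
      using sum_squares_bound[of "norm (f x)" "norm (g x)"] by (simp add: power2_sum)
    finally show ?thesis .
  qed
  have "nnorm2 \<alpha> (\<lambda>x. f x + g x)
      \<le> (\<integral>\<^sup>+x. 2 * ennreal ((norm (f x))\<^sup>2) + 2 * ennreal ((norm (g x))\<^sup>2) \<partial>gam \<alpha>)"
    using * by (intro nn_integral_mono) (auto simp flip: ennreal_plus ennreal_mult ennreal_numeral intro!: ennreal_leI)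
  also have "\<dots> = 2 * nnorm2 \<alpha> f + 2 * nnorm2 \<alpha> g"
    by (subst nn_integral_add) (auto simp: nn_integral_cmult)
  also have "\<dots> < \<infinity>" using assms by (auto simp: Lp2_iff ennreal_mult_less_top)
  finally show ?thesis by (simp add: Lp2_iff)
qed

lemma Lp2_cmult:
  fixes f :: "real \<Rightarrow> complex"
  assumes "f \<in> Lp \<alpha> 2"
  shows "(\<lambda>x. c * f x) \<in> Lp \<alpha> 2"
proof -
  have [measurable]: "f \<in> borel_measurable (gam \<alpha>)"
    using assms by (auto simp: Lp2_iff)
  have "nnorm2 \<alpha> (\<lambda>x. c * f x) = ennreal ((cmod c)\<^sup>2) * nnorm2 \<alpha> f"
    by (subst nn_integral_cmult[symmetric]) (auto simp: norm_mult power_mult_distrib ennreal_mult)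
  then show ?thesis using assms by (auto simp: Lp2_iff ennreal_mult_less_top)
qed

lemma Lp2_diff:
  fixes f g :: "real \<Rightarrow> complex"
  assumes "f \<in> Lp \<alpha> 2" "g \<in> Lp \<alpha> 2"
  shows "(\<lambda>x. f x - g x) \<in> Lp \<alpha> 2"
  using Lp2_add[OF assms(1) Lp2_cmult[OF assms(2), of "-1"]] by simp

lemma bounded_Lp2:
  fixes f :: "real \<Rightarrow> 'b::real_normed_vector"
  assumes "\<alpha> > - 1 / 2" "f \<in> borel_measurable (gam \<alpha>)" "AE x in gam \<alpha>. norm (f x) \<le> B"
  shows "f \<in> Lp \<alpha> 2"
proof -
  interpret finite_measure "gam \<alpha>" by (rule finite_measure_gam[OF assms(1)])
  have "(\<lambda>x. B) \<in> Lp \<alpha> 2"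
    using emeasure_finite[of "{0<..}"]
    by (simp add: Lp2_iff less_top[symmetric] ennreal_mult_eq_top_iff)
  moreover have "AE x in gam \<alpha>. norm (f x) \<le> norm B"
    using assms(3) by eventually_elim auto
  ultimately show ?thesis using assms(2) by (blast intro: Lp2_mono)
qed

lemma Lp2_Lp1:
  fixes f :: "real \<Rightarrow> 'b::real_normed_vector"
  assumes "\<alpha> > - 1 / 2" "f \<in> Lp \<alpha> 2"
  shows "f \<in> Lp \<alpha> 1"
proof -
  interpret finite_measure "gam \<alpha>" by (rule finite_measure_gam[OF assms(1)])
  have "(\<integral>\<^sup>+x\<in>{0<..}. ennreal (norm (f x)) \<partial>gam \<alpha>)\<^sup>2 < \<infinity>"
    using assms(2)
    using emeasure_finite[of "{0<..}"]
    by (intro le_less_trans[OF nn_integral_le_sqrt[OF assms(2)]])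
      (auto simp: Lp2_iff sets_gam_iff less_top[symmetric] ennreal_mult_eq_top_iff)
  moreover have "(\<integral>\<^sup>+x\<in>{0<..}. ennreal (norm (f x)) \<partial>gam \<alpha>) = nnorm1 \<alpha> f"
    by (intro nn_integral_cong) auto
  ultimately show ?thesis
    using assms(2) by (auto simp: Lp2_iff Lp1_iff power_less_top_ennreal)
qed

lemma Lp_infI:
  fixes f :: "real \<Rightarrow> 'b::real_normed_vector"
  assumes "f \<in> borel_measurable (gam \<alpha>)" "AE x in gam \<alpha>. norm (f x) \<le> B"
  shows "f \<in> Lp \<alpha> \<infinity>"
proof -
  have "esssup (gam \<alpha>) (\<lambda>x. ereal (norm (f x))) \<le> ereal B"
    using assms by (intro esssup_I) auto
  then show ?thesis using assms(1) by (auto simp: Lp_def intro: le_less_trans)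
qed

text \<open>
  The essential supremum is finite by assumption, and non-negative because the measure is not
  zero; so its real value is a genuine bound.
\<close>

lemma Lp_inf_bound:
  fixes f :: "real \<Rightarrow> 'b::real_normed_vector"
  assumes "\<alpha> > - 1 / 2" "f \<in> Lp \<alpha> \<infinity>"
  shows "AE x in gam \<alpha>. norm (f x) \<le> Lp_norm \<alpha> \<infinity> f" "0 \<le> Lp_norm \<alpha> \<infinity> f"
proof -
  interpret finite_measure "gam \<alpha>" by (rule finite_measure_gam[OF assms(1)])
  define e where "e = esssup (gam \<alpha>) (\<lambda>x. ereal (norm (f x)))"
  have [measurable]: "f \<in> borel_measurable (gam \<alpha>)" and e: "e < \<infinity>"
    using assms(2) by (auto simp: Lp_def e_def)
  have "0 < measure (gam \<alpha>) (ivl 1 1)"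
    using measure_ivl_pos[OF assms(1), of 1 1 1] by (simp add: adm_def m_fun_def)
  also have "\<dots> \<le> measure (gam \<alpha>) (space (gam \<alpha>))"
    by (rule bounded_measure)
  finally have "emeasure (gam \<alpha>) (space (gam \<alpha>)) \<noteq> 0"
    by (metis less_irrefl measure_eq_emeasure_eq_ennreal ennreal_0 order_refl)
  then have "esssup (gam \<alpha>) (\<lambda>x. 0) = (0::ereal)" by (rule esssup_const)
  moreover have "esssup (gam \<alpha>) (\<lambda>x. 0::ereal) \<le> e"
    unfolding e_def by (intro esssup_mono) auto
  ultimately have "0 \<le> e" by simp
  then obtain B where B: "e = ereal B" "B \<ge> 0" using e by (cases e) auto
  then have eq: "Lp_norm \<alpha> \<infinity> f = B" by (simp add: Lp_norm_def e_def)
  show "0 \<le> Lp_norm \<alpha> \<infinity> f" using eq B by simp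
  have "AE x in gam \<alpha>. ereal (norm (f x)) \<le> e" unfolding e_def by (rule esssup_AE)
  then show "AE x in gam \<alpha>. norm (f x) \<le> Lp_norm \<alpha> \<infinity> f" by (simp add: eq B)
qed

lemma Linf_L2:
  fixes f :: "real \<Rightarrow> 'b::real_normed_vector"
  assumes "\<alpha> > - 1 / 2" "f \<in> Lp \<alpha> \<infinity>"
  shows "f \<in> Lp \<alpha> 2"
proof -
  have "f \<in> borel_measurable (gam \<alpha>)" using assms(2) by (simp add: Lp_def)
  then show ?thesis using Lp_inf_bound[OF assms] bounded_Lp2[OF assms(1)] by blast
qed

text \<open>
  With the squares of the norms the bound is an inequality between integrals, as the estimates
  below need it.
\<close>

lemma bounded_op_L2:
  fixes T :: "(real \<Rightarrow> complex) \<Rightarrow> real \<Rightarrow> 'b::real_normed_vector"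
  assumes "bounded_op (Lp \<alpha> 2) (Lp_norm \<alpha> 2) (Lp \<alpha> 2) (Lp_norm \<alpha> 2) T"
  obtains A where "A \<ge> 0" "\<And>f. f \<in> Lp \<alpha> 2 \<Longrightarrow> T f \<in> Lp \<alpha> 2"
    "\<And>f. f \<in> Lp \<alpha> 2 \<Longrightarrow> nnorm2 \<alpha> (T f)
        \<le> ennreal A * nnorm2 \<alpha> f"
proof -
  obtain C where C: "\<And>f. f \<in> Lp \<alpha> 2 \<Longrightarrow> T f \<in> Lp \<alpha> 2 \<and> Lp_norm \<alpha> 2 (T f) \<le> C * Lp_norm \<alpha> 2 f"
    using assms by (auto simp: bounded_op_def)
  show thesis
  proof (rule that[of "C\<^sup>2"])
    fix f :: "real \<Rightarrow> complex" assume f: "f \<in> Lp \<alpha> 2"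
    then show "T f \<in> Lp \<alpha> 2" using C by blast
    have "(Lp_norm \<alpha> 2 (T f))\<^sup>2 \<le> (C * Lp_norm \<alpha> 2 f)\<^sup>2"
      using C[OF f] by (intro power_mono Lp2_norm_nonneg) auto
    then have "ennreal ((Lp_norm \<alpha> 2 (T f))\<^sup>2) \<le> ennreal (C\<^sup>2) * ennreal ((Lp_norm \<alpha> 2 f)\<^sup>2)"
      by (simp add: power_mult_distrib flip: ennreal_mult)
    then show "nnorm2 \<alpha> (T f)
        \<le> ennreal (C\<^sup>2) * nnorm2 \<alpha> f"
      using C f by (simp add: Lp2_norm)
  qed simp
qed

lemma bounded_op_weak:
  fixes S :: "(real \<Rightarrow> complex) \<Rightarrow> real \<Rightarrow> 'b::real_normed_vector"
  assumes \<alpha>: "\<alpha> > - 1 / 2"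
    and "bounded_op (Lp \<alpha> 1) (Lp_norm \<alpha> 1) (weak_L1 \<alpha>) (weak_L1_norm \<alpha>) S"
  obtains C where "C \<ge> 0"
    "\<And>f s. f \<in> Lp \<alpha> 1 \<Longrightarrow> s > 0 \<Longrightarrow> emeasure (gam \<alpha>) {x \<in> {0<..}. s < norm (S f x)}
        \<le> ennreal (C / s) * nnorm1 \<alpha> f"
proof -
  interpret finite_measure "gam \<alpha>" by (rule finite_measure_gam[OF \<alpha>])
  obtain C where C: "\<And>f. f \<in> Lp \<alpha> 1 \<Longrightarrow> S f \<in> weak_L1 \<alpha> \<and> weak_L1_norm \<alpha> (S f) \<le> C * Lp_norm \<alpha> 1 f"
    using assms by (auto simp: bounded_op_def)
  show thesis
  proof (rule that[of "\<bar>C\<bar>"])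
    fix f :: "real \<Rightarrow> complex" and s :: real assume f: "f \<in> Lp \<alpha> 1" and s: "s > 0"
    have "s * measure (gam \<alpha>) {x \<in> {0<..}. s < norm (S f x)} \<le> weak_L1_norm \<alpha> (S f)"
      unfolding weak_L1_norm_def using C[OF f] s
      by (intro cSUP_upper) (auto simp: weak_L1_def)
    also have "\<dots> \<le> C * Lp_norm \<alpha> 1 f" using C[OF f] by simp
    also have "\<dots> \<le> \<bar>C\<bar> * Lp_norm \<alpha> 1 f" by (intro mult_right_mono Lp1_norm_nonneg) auto
    finally have "measure (gam \<alpha>) {x \<in> {0<..}. s < norm (S f x)} \<le> \<bar>C\<bar> / s * Lp_norm \<alpha> 1 f"
      using s by (simp add: field_simps)
    then have "emeasure (gam \<alpha>) {x \<in> {0<..}. s < norm (S f x)} \<le> ennreal (\<bar>C\<bar> / s * Lp_norm \<alpha> 1 f)"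
      by (simp add: emeasure_eq_measure ennreal_leI)
    also have "\<dots> = ennreal (\<bar>C\<bar> / s) * nnorm1 \<alpha> f"
      using s by (subst ennreal_mult) (auto simp: Lp1_norm_nonneg Lp1_norm[OF f])
    finally show "emeasure (gam \<alpha>) {x \<in> {0<..}. s < norm (S f x)}
        \<le> ennreal (\<bar>C\<bar> / s) * nnorm1 \<alpha> f" .
  qed simp
qed

section \<open>Passing from small to large intervals\<close>

text \<open>
  One step of a chain. For \<open>u\<close> and \<open>v\<close> at distance less than $2r/M$ the interval around their
  midpoint of radius $r/M$ contains both, but may leave the half line; then the midpoint
  itself is a radius that works. The radius is admissible for \<open>a = 1\<close> because the midpoint is
  below \<open>2 * c\<close>, which costs a factor $2$ in \<open>m_fun\<close>, and $M \ge 2a$.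
\<close>

lemma adm_step:
  assumes adm: "(c, r) \<in> adm a" and M: "M \<ge> 2" "M \<ge> 2 * a"
    and uv: "u \<in> ivl c r" "v \<in> ivl c r" "\<bar>u - v\<bar> < 2 * r / M"
  defines "w \<equiv> (u + v) / 2" and "\<rho> \<equiv> min ((u + v) / 2) (r / M)"
  shows "(w, \<rho>) \<in> adm 1" "u \<in> ivl w \<rho>" "v \<in> ivl w \<rho>" "ivl w (2 * \<rho>) \<subseteq> ivl c (2 * r)"
proof -
  note A = admD[OF adm]
  have "u < c + r" "c - r < u" "v < c + r" "c - r < v" "0 < u" "0 < v" using uv by (auto simp: ivl_def)
  then have w: "0 < w" "w < 2 * c" "\<bar>w - c\<bar> < r"
    using A by (auto simp: w_def abs_less_iff field_simps)
  have \<rho>: "0 < \<rho>" "\<rho> \<le> w" "\<rho> \<le> r / M"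
    using w A M unfolding \<rho>_def w_def by (simp_all only: min.cobounded1 min.cobounded2) auto
  have "r / M \<le> 1 / 2 * min 1 (1 / c)"
  proof -
    have "r \<le> a * min 1 (1 / c)" using adm by (auto simp: adm_def m_fun_def)
    also have "\<dots> \<le> (M / 2) * min 1 (1 / c)" using M A by (intro mult_right_mono) auto
    finally have "r / M \<le> M / 2 * min 1 (1 / c) / M" using M by (intro divide_right_mono) auto
    also have "\<dots> = 1 / 2 * min 1 (1 / c)" using M by simp
    finally show ?thesis .
  qed
  also have "\<dots> \<le> min 1 (1 / w)"
  proof (intro min.boundedI)
    show "1 / 2 * min 1 (1 / c) \<le> 1" by (simp add: min_def)
    have "1 / 2 * min 1 (1 / c) \<le> 1 / (2 * c)" by (simp add: min_def)
    also have "\<dots> \<le> 1 / w" using w by (intro divide_left_mono) auto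
    finally show "1 / 2 * min 1 (1 / c) \<le> 1 / w" .
  qed
  finally show "(w, \<rho>) \<in> adm 1" using \<rho> by (auto simp: adm_def m_fun_def)
  have "\<bar>u - w\<bar> < \<rho>" "\<bar>v - w\<bar> < \<rho>"
    using uv M by (auto simp: w_def \<rho>_def ivl_def field_simps abs_if split: if_splits)
  then show "u \<in> ivl w \<rho>" "v \<in> ivl w \<rho>" using uv by (auto simp: ivl_def abs_if split: if_splits)
  have "2 * (r / M) \<le> r" using M A by (simp add: field_simps)
  then have "2 * \<rho> \<le> r" using \<rho> by linarith
  then show "ivl w (2 * \<rho>) \<subseteq> ivl c (2 * r)" using w by (auto simp: ivl_def abs_if split: if_splits)
qed

text \<open>
  The chain consists of the points that divide the segment from \<open>x\<close> to \<open>z\<close> into \<open>M\<close> equal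
  parts. The value \<open>F x x\<close> is only known to be at most \<open>B\<close>, whence \<open>Suc M\<close> in place of \<open>M\<close>.
\<close>

lemma adm_chain:
  fixes F :: "real \<Rightarrow> real \<Rightarrow> ennreal" and M :: nat and a :: real
  assumes adm: "(c, r) \<in> adm a" and M: "M \<ge> 2" "real M \<ge> 2 * a"
    and tri: "\<And>u v w. u \<in> ivl c r \<Longrightarrow> v \<in> ivl c r \<Longrightarrow> w \<in> ivl c r \<Longrightarrow> F u w \<le> F u v + F v w"
    and loc: "\<And>c' r' u v. (c', r') \<in> adm 1 \<Longrightarrow> ivl c' (2 * r') \<subseteq> ivl c (2 * r) \<Longrightarrow>
      u \<in> ivl c' r' \<Longrightarrow> v \<in> ivl c' r' \<Longrightarrow> u \<in> ivl c r \<Longrightarrow> v \<in> ivl c r \<Longrightarrow> F u v \<le> B"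
    and xz: "x \<in> ivl c r" "z \<in> ivl c r"
  shows "F x z \<le> of_nat (Suc M) * B"
proof -
  note A = admD[OF adm]
  have step: "F u v \<le> B" if "u \<in> ivl c r" "v \<in> ivl c r" "\<bar>u - v\<bar> < 2 * r / real M" for u v
    using adm_step[OF adm _ _ that] M loc[of "(u + v) / 2" "min ((u + v) / 2) (r / real M)" u v] that
    by auto
  define y where "y i = x + real i / real M * (z - x)" for i
  have y: "y i \<in> ivl c r" if "i \<le> M" for i
  proof -
    have "convex (ivl c r)" by (auto simp: ivl_def intro!: convex_Int)
    moreover have "y i = (1 - real i / real M) *\<^sub>R x + (real i / real M) *\<^sub>R z"
      by (simp add: y_def left_diff_distrib right_diff_distrib)
    moreover have "real i / real M \<le> 1" using that M by simp
    ultimately show ?thesis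
      using xz by (simp only:) (intro convexD_alt, auto)
  qed
  have d: "\<bar>y i - y (Suc i)\<bar> < 2 * r / real M" for i
  proof -
    have "y i - y (Suc i) = (x - z) / real M"
      using M by (simp add: y_def field_simps)
    then show ?thesis
      using xz M by (auto simp: ivl_def field_simps abs_if)
  qed
  have "F x (y i) \<le> of_nat (Suc i) * B" if "i \<le> M" for i
    using that
  proof (induction i)
    case 0
    show ?case using step[of x x] xz A M by (simp add: y_def)
  next
    case (Suc i)
    have "F x (y (Suc i)) \<le> F x (y i) + F (y i) (y (Suc i))"
      using Suc.prems xz by (intro tri y) auto
    also have "\<dots> \<le> of_nat (Suc i) * B + B"
      using Suc.prems by (intro add_mono Suc.IH step y d) auto
    finally show ?case by (simp add: algebra_simps)
  qed
  from this[of M] show ?thesis using M by (simp add: y_def)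
qed

section \<open>Kernel distances, and the bound into BMO\<close>

lemma space_off_diag [simp]: "(x, y) \<in> space off_diag \<longleftrightarrow> 0 < x \<and> 0 < y \<and> x \<noteq> y"
  by (auto simp: off_diag_def space_restrict_space space_pair_measure)

lemma ennreal_power2_le:
  fixes x y :: ennreal
  assumes "x\<^sup>2 \<le> y\<^sup>2"
  shows "x \<le> y"
proof (cases x)
  case (real s)
  show ?thesis
  proof (cases y)
    case (real t)
    then show ?thesis
      using assms \<open>x = ennreal s\<close> \<open>0 \<le> s\<close> by (auto simp: ennreal_power intro!: ennreal_leI power2_le_imp_le)
  qed simp
next
  case top
  then have "y\<^sup>2 = top" using assms by (simp add: ennreal_top_eq_mult_iff power2_eq_square top_unique)
  then show ?thesis by (simp add: power_eq_top_ennreal)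
qed

text \<open>
  The distance \<open>D p q\<close> stands for the norm of the difference of the kernel values at the
  points \<open>p\<close> and \<open>q\<close> off the diagonal.
\<close>

locale kernel_dist =
  fixes \<alpha> :: real and D :: "real \<times> real \<Rightarrow> real \<times> real \<Rightarrow> real"
  assumes alpha: "\<alpha> > - 1 / 2"
    and D_meas: "case_prod D \<in> borel_measurable (off_diag \<Otimes>\<^sub>M off_diag)"
    and D_nonneg: "\<And>p q. p \<in> space off_diag \<Longrightarrow> q \<in> space off_diag \<Longrightarrow> 0 \<le> D p q"
    and D_tri: "\<And>p q s. p \<in> space off_diag \<Longrightarrow> q \<in> space off_diag \<Longrightarrow> s \<in> space off_diag \<Longrightarrow>
      D p s \<le> D p q + D q s"

sublocale kernel_dist \<subseteq> finite_measure "gam \<alpha>"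
  by (rule finite_measure_gam[OF alpha])

context kernel_dist
begin

lemma D_measurable:
  assumes \<phi>: "\<phi> \<in> M \<rightarrow>\<^sub>M borel \<Otimes>\<^sub>M borel" and \<psi>: "\<psi> \<in> M \<rightarrow>\<^sub>M borel \<Otimes>\<^sub>M borel"
    and E: "E \<in> sets M"
    and off: "\<And>x. x \<in> E \<Longrightarrow> \<phi> x \<in> space off_diag" "\<And>x. x \<in> E \<Longrightarrow> \<psi> x \<in> space off_diag"
  shows "(\<lambda>x. ennreal (D (\<phi> x) (\<psi> x)) * indicator E x) \<in> borel_measurable M"
proof -
  have sp: "space off_diag = ({0<..} \<times> {0<..}) - {(x, x) | x. x \<in> {0<..}}"
    by (auto simp: off_diag_def space_restrict_space space_pair_measure)
  have 1: "\<phi> \<in> restrict_space M E \<rightarrow>\<^sub>M off_diag"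
    unfolding off_diag_def using off(1)
    by (intro measurable_restrict_space2 measurable_restrict_space1 \<phi>)
      (auto simp: space_restrict_space sp simp del: space_off_diag)
  have 2: "\<psi> \<in> restrict_space M E \<rightarrow>\<^sub>M off_diag"
    unfolding off_diag_def using off(2)
    by (intro measurable_restrict_space2 measurable_restrict_space1 \<psi>)
      (auto simp: space_restrict_space sp simp del: space_off_diag)
  have "(\<lambda>x. case_prod D (\<phi> x, \<psi> x)) \<in> borel_measurable (restrict_space M E)"
    using 1 2 by (intro measurable_compose[OF _ D_meas] measurable_Pair)
  then have "(\<lambda>x. ennreal (D (\<phi> x) (\<psi> x))) \<in> borel_measurable (restrict_space M E)"
    by simp
  then show ?thesis
    using E by (subst (asm) borel_measurable_restrict_space_iff_ennreal) auto
qed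

text \<open>
  Both kernel conditions in one, for the family with parameter \<open>a\<close> and with bound \<open>B\<close>. The
  placement \<open>pt u y\<close> is \<open>(u, y)\<close> for the first condition and \<open>(y, u)\<close> for the second.
\<close>

definition regular :: "(real \<Rightarrow> real \<Rightarrow> real \<times> real) \<Rightarrow> real \<Rightarrow> ennreal \<Rightarrow> bool" where
  "regular pt a B \<longleftrightarrow> (\<forall>(c, r)\<in>adm a. \<forall>u\<in>ivl c r. \<forall>v\<in>ivl c r.
     (\<integral>\<^sup>+y\<in>{0<..} - ivl c (2 * r). ennreal (D (pt u y) (pt v y)) \<partial>gam \<alpha>) \<le> B)"

lemma ivl_mono: "0 < r \<Longrightarrow> ivl c r \<subseteq> ivl c (2 * r)"
  by (auto simp: ivl_def)

lemma pt_facts: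
  assumes "pt = Pair \<or> pt = (\<lambda>x y. (y, x))"
  shows "pt u y \<in> space off_diag \<longleftrightarrow> 0 < u \<and> 0 < y \<and> u \<noteq> y"
    "(\<lambda>y. pt u y) \<in> gam \<alpha> \<rightarrow>\<^sub>M borel \<Otimes>\<^sub>M borel"
proof -
  have [measurable]: "(\<lambda>x. x) \<in> gam \<alpha> \<rightarrow>\<^sub>M (borel :: real measure)"
    by (subst measurable_cong_sets[OF sets_gam refl]) (simp add: measurable_restrict_space1)
  show "pt u y \<in> space off_diag \<longleftrightarrow> 0 < u \<and> 0 < y \<and> u \<noteq> y" using assms by auto
  show "(\<lambda>y. pt u y) \<in> gam \<alpha> \<rightarrow>\<^sub>M borel \<Otimes>\<^sub>M borel" using assms by auto
qed

text \<open>
  The integral of the kernel distance over the complement of the double of the large interval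
  satisfies the triangle inequality in its two endpoints, and is at most the integral over the
  complement of any smaller double. This is the situation of \<open>adm_chain\<close>.
\<close>

lemma regular_adm:
  assumes pt: "pt = Pair \<or> pt = (\<lambda>x y. (y, x))" and reg: "regular pt 1 B"
  shows "\<exists>M::nat. regular pt a (of_nat M * B)"
proof -
  define M where "M = max 2 (nat \<lceil>2 * a\<rceil>)"
  have M: "M \<ge> 2" "real M \<ge> 2 * a" by (auto simp: M_def) linarith
  have "regular pt a (of_nat (Suc M) * B)"
    unfolding regular_def
  proof safe
    fix c r x z assume adm: "(c, r) \<in> adm a" and xz: "x \<in> ivl c r" "z \<in> ivl c r"
    note A = admD[OF adm]
    define E where "E = {0<..} - ivl c (2 * r)"
    have E: "E \<in> sets (gam \<alpha>)" by (auto simp: E_def sets_gam_iff ivl_def)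
    have off: "pt u y \<in> space off_diag" if "u \<in> ivl c r" "y \<in> E" for u y
      using that ivl_mono[of r c] A unfolding pt_facts(1)[OF pt] by (auto simp: E_def ivl_def)
    have meas: "(\<lambda>y. ennreal (D (pt u y) (pt v y)) * indicator E y) \<in> borel_measurable (gam \<alpha>)"
      if "u \<in> ivl c r" "v \<in> ivl c r" for u v
      using that off E by (intro D_measurable pt_facts[OF pt]) auto
    define F where "F u v = (\<integral>\<^sup>+y\<in>E. ennreal (D (pt u y) (pt v y)) \<partial>gam \<alpha>)" for u v
    have "F x z \<le> of_nat (Suc M) * B"
    proof (rule adm_chain[OF adm _ _ _ _ xz])
      show "2 \<le> M" "2 * a \<le> real M" using M by auto
      fix u v w assume uvw: "u \<in> ivl c r" "v \<in> ivl c r" "w \<in> ivl c r"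
      have "F u w \<le> (\<integral>\<^sup>+y. ennreal (D (pt u y) (pt v y)) * indicator E y
          + ennreal (D (pt v y) (pt w y)) * indicator E y \<partial>gam \<alpha>)"
        unfolding F_def
      proof (intro nn_integral_mono)
        fix y
        show "ennreal (D (pt u y) (pt w y)) * indicator E y
          \<le> ennreal (D (pt u y) (pt v y)) * indicator E y + ennreal (D (pt v y) (pt w y)) * indicator E y"
          using off[OF uvw(1)] off[OF uvw(2)] off[OF uvw(3)] D_tri D_nonneg
          by (cases "y \<in> E") (auto simp flip: ennreal_plus intro!: ennreal_leI)
      qed
      also have "\<dots> = F u v + F v w"
        unfolding F_def using uvw by (intro nn_integral_add meas)
      finally show "F u w \<le> F u v + F v w" .
    next
      fix c' r' u v assume *: "(c', r') \<in> adm 1" "ivl c' (2 * r') \<subseteq> ivl c (2 * r)"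
        "u \<in> ivl c' r'" "v \<in> ivl c' r'" "u \<in> ivl c r" "v \<in> ivl c r"
      have "F u v \<le> (\<integral>\<^sup>+y\<in>{0<..} - ivl c' (2 * r'). ennreal (D (pt u y) (pt v y)) \<partial>gam \<alpha>)"
        unfolding F_def E_def using * by (intro nn_integral_mono) (auto split: split_indicator)
      also have "\<dots> \<le> B" using reg * by (auto simp: regular_def)
      finally show "F u v \<le> B" .
    qed
    then show "(\<integral>\<^sup>+y\<in>{0<..} - ivl c (2 * r). ennreal (D (pt x y) (pt z y)) \<partial>gam \<alpha>)
      \<le> of_nat (Suc M) * B" by (simp add: F_def E_def)
  qed
  then show ?thesis by blast
qed

text \<open>
  The mean oscillation is at most twice the mean distance to any constant, as the average is
  no further from the constant than this mean distance.
\<close>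

lemma mean_osc_le:
  fixes g :: "real \<Rightarrow> 'b::{banach, second_countable_topology}"
  assumes g: "g \<in> Lp \<alpha> 1" and adm: "(c, r) \<in> adm a" and k: "k \<ge> 0"
    and le: "(\<integral>\<^sup>+x\<in>ivl c r. ennreal (norm (g x - c0)) \<partial>gam \<alpha>) \<le> ennreal (k * measure (gam \<alpha>) (ivl c r))"
  shows "mean_osc \<alpha> g (c, r) \<le> 2 * k"
proof -
  define I where "I = ivl c r"
  define m where "m = measure (gam \<alpha>) I"
  have m: "m > 0" using measure_ivl_pos[OF alpha adm] by (simp add: m_def I_def)
  have I [measurable]: "I \<in> sets (gam \<alpha>)" by (simp add: I_def)
  have [measurable]: "g \<in> borel_measurable (gam \<alpha>)" using g by (simp add: Lp1_iff)
  have gi: "integrable (gam \<alpha>) g" using g by (simp add: Lp1_integrable)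
  have si: "set_integrable (gam \<alpha>) I (\<lambda>x. g x - b)" for b
    unfolding set_integrable_def using gi by (intro integrable_mult_indicator) auto
  have ci: "set_integrable (gam \<alpha>) I (\<lambda>x. b)" for b :: "'d::{banach, second_countable_topology}"
    unfolding set_integrable_def by (intro integrable_mult_indicator) auto
  have sn: "set_integrable (gam \<alpha>) I (\<lambda>x. norm (g x - b))" for b
    using si[of b] by (rule set_integrable_norm)
  define Q where "Q = (LINT x:I|gam \<alpha>. norm (g x - c0))"
  have "ennreal Q = (\<integral>\<^sup>+x. ennreal (indicator I x *\<^sub>R norm (g x - c0)) \<partial>gam \<alpha>)"
    unfolding Q_def set_lebesgue_integral_def
    using sn[of c0] by (subst nn_integral_eq_integral) (auto simp: set_integrable_def)
  also have "\<dots> = (\<integral>\<^sup>+x\<in>I. ennreal (norm (g x - c0)) \<partial>gam \<alpha>)"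
    by (intro nn_integral_cong) (auto split: split_indicator)
  also have "\<dots> \<le> ennreal (k * m)" using le by (simp add: I_def m_def)
  finally have Q: "Q \<le> k * m" using k m by simp
  have I_pos: "I \<inter> {0<..} = I" by (auto simp: I_def ivl_def)
  have const: "(LINT x:I|gam \<alpha>. b) = m *\<^sub>R b" for b :: 'b
    unfolding set_lebesgue_integral_def m_def
    by (subst integral_scaleR_left) (auto simp: less_top[symmetric] I_pos)
  have "avg \<alpha> I g - c0 = (1 / m) *\<^sub>R (LINT x:I|gam \<alpha>. g x - c0)"
  proof -
    have "(LINT x:I|gam \<alpha>. g x - c0) = (LINT x:I|gam \<alpha>. g x) - (LINT x:I|gam \<alpha>. c0)"
      using si[of 0] ci by (intro set_integral_diff) auto
    then have "(1 / m) *\<^sub>R (LINT x:I|gam \<alpha>. g x - c0) = (1 / m) *\<^sub>R (LINT x:I|gam \<alpha>. g x) - (1 / m) *\<^sub>R (m *\<^sub>R c0)"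
      by (simp only: const scaleR_diff_right)
    then show ?thesis using m by (simp add: avg_def m_def[symmetric])
  qed
  moreover have "norm (LINT x:I|gam \<alpha>. g x - c0) \<le> Q"
    unfolding Q_def set_lebesgue_integral_def
    by (rule order_trans[OF integral_norm_bound]) simp
  ultimately have "norm (avg \<alpha> I g - c0) \<le> Q / m"
    using m by (simp add: divide_right_mono)
  then have d: "norm (c0 - avg \<alpha> I g) \<le> Q / m" by (simp add: norm_minus_commute)
  have "(LINT x:I|gam \<alpha>. norm (g x - avg \<alpha> I g)) \<le> (LINT x:I|gam \<alpha>. norm (g x - c0) + Q / m)"
  proof (rule set_integral_mono)
    show "set_integrable (gam \<alpha>) I (\<lambda>x. norm (g x - c0) + Q / m)"
      using sn[of c0] ci by (intro set_integral_add)
    fix x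
    have "norm (g x - avg \<alpha> I g) \<le> norm (g x - c0) + norm (c0 - avg \<alpha> I g)"
      using norm_triangle_ineq[of "g x - c0" "c0 - avg \<alpha> I g"] by simp
    then show "norm (g x - avg \<alpha> I g) \<le> norm (g x - c0) + Q / m" using d by linarith
  qed (rule sn)
  also have "\<dots> = Q + (LINT x:I|gam \<alpha>. Q / m)"
    unfolding Q_def using sn[of c0] ci by (intro set_integral_add)
  also have "\<dots> = 2 * Q" using m by (simp add: set_lebesgue_integral_def m_def I_pos)
  finally have "(LINT x:I|gam \<alpha>. norm (g x - avg \<alpha> I g)) \<le> 2 * (k * m)" using Q by linarith
  then have "1 / m * (LINT x:I|gam \<alpha>. norm (g x - avg \<alpha> I g)) \<le> 2 * k"
    using m by (simp add: field_simps)
  then show ?thesis by (simp add: mean_osc_def avg_def I_def m_def)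
qed

text \<open>
  The $L^2$ bound for differences replaces linearity: \<open>T f\<close> is close to \<open>T h\<close> in $L^2$ when
  \<open>h\<close> is \<open>f\<close> outside the double interval, and the kernel bound makes \<open>T h\<close> nearly constant on
  the interval. The set \<open>G\<close> collects the points at which the kernel representation of \<open>T f\<close>
  holds.
\<close>

lemma bounded_Linf_BMO:
  fixes T :: "(real \<Rightarrow> complex) \<Rightarrow> real \<Rightarrow> 'b::{banach, second_countable_topology}"
  assumes reg: "regular Pair 1 B" and B: "B < \<infinity>" and a: "a > 0" and A: "A \<ge> 0"
    and TL: "\<And>f. f \<in> Lp \<alpha> 2 \<Longrightarrow> T f \<in> Lp \<alpha> 2"
    and T2: "\<And>f. f \<in> Lp \<alpha> 2 \<Longrightarrow> nnorm2 \<alpha> (T f)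
        \<le> ennreal A * nnorm2 \<alpha> f"
    and TD: "\<And>f g. f \<in> Lp \<alpha> 2 \<Longrightarrow> g \<in> Lp \<alpha> 2 \<Longrightarrow> nnorm2 \<alpha> (\<lambda>x. T f x - T g x)
        \<le> ennreal A * nnorm2 \<alpha> (\<lambda>x. f x - g x)"
    and TK: "\<And>f. f \<in> Lp \<alpha> \<infinity> \<Longrightarrow> \<exists>G. (AE x in gam \<alpha>. x \<in> G) \<and>
        (\<forall>x\<in>G - supp f. \<forall>z\<in>G - supp f. ennreal (norm (T f x - T f z))
          \<le> (\<integral>\<^sup>+y. ennreal (D (x, y) (z, y)) * ennreal (cmod (f y)) \<partial>gam \<alpha>))"
  shows "bounded_op (Lp \<alpha> \<infinity>) (Lp_norm \<alpha> \<infinity>) (BMO \<alpha> a) (BMO_norm \<alpha> a) T"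
proof -
  obtain M where M: "regular Pair a (of_nat M * B)" using regular_adm[OF _ reg] by blast
  define b where "b = enn2real (of_nat M * B)"
  have b: "ennreal b = of_nat M * B" "b \<ge> 0"
    using B by (auto simp: b_def ennreal_mult_less_top less_top[symmetric] ennreal_mult_eq_top_iff of_nat_less_top)
  obtain C where C: "C \<ge> 1"
    "\<And>c r. (c, r) \<in> adm a \<Longrightarrow> measure (gam \<alpha>) (ivl c (2 * r)) \<le> C * measure (gam \<alpha>) (ivl c r)"
    using gam_doubling[OF alpha a] by blast
  define k where "k = sqrt (A * C) + b"
  have k: "k \<ge> 0" using A C b by (simp add: k_def)
  have Linf2: "f \<in> Lp \<alpha> 2" if "f \<in> Lp \<alpha> \<infinity>" for f :: "real \<Rightarrow> complex"
    by (rule Linf_L2[OF alpha that])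
  have osc: "mean_osc \<alpha> (T f) (c, r) \<le> 2 * (k * Lp_norm \<alpha> \<infinity> f)"
    if f: "f \<in> Lp \<alpha> \<infinity>" and adm: "(c, r) \<in> adm a" for f c r
  proof -
    note A' = admD[OF adm]
    define L where "L = Lp_norm \<alpha> \<infinity> f"
    have L: "L \<ge> 0" "AE x in gam \<alpha>. cmod (f x) \<le> L"
      using Lp_inf_bound[OF alpha f] by (auto simp: L_def)
    have fm [measurable]: "f \<in> borel_measurable (gam \<alpha>)" using f by (auto simp: Lp_def)
    define I where "I = ivl c r"
    define J where "J = ivl c (2 * r)"
    have [measurable, simp]: "I \<in> sets (gam \<alpha>)" "J \<in> sets (gam \<alpha>)" by (auto simp: I_def J_def)
    define m where "m = measure (gam \<alpha>) I"
    have m: "m > 0" using measure_ivl_pos[OF alpha adm] by (simp add: m_def I_def)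
    \<comment> \<open>only the part of \<open>f\<close> outside the doubled interval\<close>
    define h where "h = (\<lambda>x. if x \<in> J then 0 else f x)"
    have hm [measurable]: "h \<in> borel_measurable (gam \<alpha>)" unfolding h_def by measurable
    have hL: "AE x in gam \<alpha>. cmod (h x) \<le> L" using L(2) by eventually_elim (use L(1) in \<open>auto simp: h_def\<close>)
    have h: "h \<in> Lp \<alpha> \<infinity>" by (rule Lp_infI[OF hm hL])
    have supp: "x \<notin> supp h" if "x \<in> I" for x
    proof -
      have "closure {x \<in> {0<..}. h x \<noteq> 0} \<subseteq> - {c - 2 * r <..< c + 2 * r}"
        by (intro closure_minimal) (auto simp: h_def J_def ivl_def)
      then show ?thesis using that A' by (auto simp: supp_def I_def ivl_def)
    qed
    obtain G where G: "AE x in gam \<alpha>. x \<in> G"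
      "\<And>x z. x \<in> G \<Longrightarrow> z \<in> G \<Longrightarrow> x \<notin> supp h \<Longrightarrow> z \<notin> supp h \<Longrightarrow> ennreal (norm (T h x - T h z))
          \<le> (\<integral>\<^sup>+y. ennreal (D (x, y) (z, y)) * ennreal (cmod (h y)) \<partial>gam \<alpha>)"
      using TK[OF h] by blast
    \<comment> \<open>the constant to compare with is the value of \<open>T h\<close> at one good point of the interval\<close>
    have "\<exists>z. z \<in> I \<inter> G"
    proof (rule ccontr)
      assume "\<nexists>z. z \<in> I \<inter> G"
      then have "AE x in gam \<alpha>. x \<notin> I" using G(1) by (auto elim!: eventually_mono)
      then have "I \<in> null_sets (gam \<alpha>)" by (subst AE_iff_null_sets) auto
      then have "m = 0" by (simp add: m_def measure_eq_0_null_sets)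
      then show False using m by simp
    qed
    then obtain z where z: "z \<in> I" "z \<in> G" by blast
    have TfL: "T f \<in> Lp \<alpha> 2" "T h \<in> Lp \<alpha> 2" using TL Linf2 f h by auto
    have [measurable]: "T f \<in> borel_measurable (gam \<alpha>)" "T h \<in> borel_measurable (gam \<alpha>)"
      using TfL by (auto simp: Lp2_iff)
    have far: "ennreal (norm (T h x - T h z)) \<le> ennreal (b * L)" if x: "x \<in> I" "x \<in> G" for x
    proof -
      define E where "E = {0<..} - J"
      have E [measurable]: "E \<in> sets (gam \<alpha>)" by (auto simp: E_def sets_gam_iff J_def ivl_def)
      have meas [measurable]: "(\<lambda>y. ennreal (D (x, y) (z, y)) * indicator E y) \<in> borel_measurable (gam \<alpha>)"
        using x z A' ivl_mono[of r c]
        by (intro D_measurable pt_facts[of Pair] E)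
          (auto simp: E_def I_def J_def ivl_def)
      have "ennreal (norm (T h x - T h z)) \<le> (\<integral>\<^sup>+y. ennreal (D (x, y) (z, y)) * ennreal (cmod (h y)) \<partial>gam \<alpha>)"
        using x z by (intro G supp) auto
      also have "\<dots> \<le> (\<integral>\<^sup>+y. (ennreal (D (x, y) (z, y)) * indicator E y) * ennreal L \<partial>gam \<alpha>)"
      proof (rule nn_integral_mono_AE)
        show "AE y in gam \<alpha>. ennreal (D (x, y) (z, y)) * ennreal (cmod (h y)) \<le>
              (ennreal (D (x, y) (z, y)) * indicator E y) * ennreal L"
          using hL AE_space
        proof eventually_elim
          case (elim y)
          then show ?case
            by (cases "y \<in> J") (auto simp: E_def h_def intro!: mult_left_mono ennreal_leI)
        qed
      qed
      also have "\<dots> = (\<integral>\<^sup>+y\<in>E. ennreal (D (x, y) (z, y)) \<partial>gam \<alpha>) * ennreal L"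
        by (rule nn_integral_multc) measurable
      also have "\<dots> \<le> ennreal b * ennreal L"
        using M adm x z unfolding b(1) regular_def E_def J_def I_def
        by (intro mult_right_mono) auto
      finally show ?thesis using b L by (simp add: ennreal_mult)
    qed
    have near: "(\<integral>\<^sup>+x\<in>I. ennreal (norm (T f x - T h x)) \<partial>gam \<alpha>) \<le> ennreal (sqrt (A * C) * L * m)"
    proof -
      have d2: "(\<lambda>x. T f x - T h x) \<in> Lp \<alpha> 2"
      proof -
        have "(\<lambda>x. f x - h x) \<in> Lp \<alpha> 2" using Linf2 f h by (intro Lp2_diff) auto
        then show ?thesis
          using TD[of f h] Linf2 f h
          by (auto simp: Lp2_iff intro: le_less_trans simp: ennreal_mult_less_top)
      qed
      have "(\<integral>\<^sup>+x\<in>I. ennreal (norm (T f x - T h x)) \<partial>gam \<alpha>)\<^sup>2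
        \<le> emeasure (gam \<alpha>) I * nnorm2 \<alpha> (\<lambda>x. T f x - T h x)"
        by (rule nn_integral_le_sqrt[OF d2]) simp
      also have "nnorm2 \<alpha> (\<lambda>x. T f x - T h x)
         \<le> ennreal A * nnorm2 \<alpha> (\<lambda>x. f x - h x)"
        using Linf2 f h by (intro TD) auto
      also have "nnorm2 \<alpha> (\<lambda>x. f x - h x) \<le> (\<integral>\<^sup>+x. ennreal (L\<^sup>2) * indicator J x \<partial>gam \<alpha>)"
        using L(2)
        by (intro nn_integral_mono_AE)
          (auto elim!: eventually_mono simp: h_def intro!: ennreal_leI power_mono split: split_indicator)
      also have "\<dots> = ennreal (L\<^sup>2 * measure (gam \<alpha>) J)"
        by (simp add: nn_integral_cmult_indicator emeasure_eq_measure ennreal_mult)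
      also have "\<dots> \<le> ennreal (L\<^sup>2 * (C * m))"
        using C(2)[OF adm] by (intro ennreal_leI mult_left_mono) (auto simp: J_def I_def m_def)
      also have "emeasure (gam \<alpha>) I * (ennreal A * ennreal (L\<^sup>2 * (C * m))) = ennreal (m * (A * (L\<^sup>2 * (C * m))))"
        using A C m by (simp add: emeasure_eq_measure m_def[symmetric] ennreal_mult)
      also have "m * (A * (L\<^sup>2 * (C * m))) = (sqrt (A * C) * L * m)\<^sup>2"
        using A C by (simp add: power_mult_distrib power2_eq_square[of m])
      finally have "(\<integral>\<^sup>+x\<in>I. ennreal (norm (T f x - T h x)) \<partial>gam \<alpha>)\<^sup>2 \<le> (ennreal (sqrt (A * C) * L * m))\<^sup>2"
        using A C L m by (simp add: ennreal_power mult_left_mono)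
      then show ?thesis by (rule ennreal_power2_le)
    qed
    have "(\<integral>\<^sup>+x\<in>I. ennreal (norm (T f x - T h z)) \<partial>gam \<alpha>)
      \<le> (\<integral>\<^sup>+x. ennreal (norm (T f x - T h x)) * indicator I x + ennreal (b * L) * indicator I x \<partial>gam \<alpha>)"
    proof (rule nn_integral_mono_AE)
      show "AE x in gam \<alpha>. ennreal (norm (T f x - T h z)) * indicator I x \<le>
         ennreal (norm (T f x - T h x)) * indicator I x + ennreal (b * L) * indicator I x"
        using G(1)
      proof eventually_elim
        case (elim x)
        show ?case
        proof (cases "x \<in> I")
          case True
          have "norm (T h x - T h z) \<le> b * L" using far[OF True elim] b L by simp
          moreover have "norm (T f x - T h z) \<le> norm (T f x - T h x) + norm (T h x - T h z)"
            using norm_triangle_ineq[of "T f x - T h x" "T h x - T h z"] by simp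
          ultimately show ?thesis
            using True b L by (auto simp flip: ennreal_plus intro!: ennreal_leI)
        qed simp
      qed
    qed
    also have "\<dots> = (\<integral>\<^sup>+x\<in>I. ennreal (norm (T f x - T h x)) \<partial>gam \<alpha>) + ennreal (b * L) * emeasure (gam \<alpha>) I"
      by (subst nn_integral_add) (auto simp: nn_integral_cmult_indicator)
    also have "\<dots> \<le> ennreal (sqrt (A * C) * L * m) + ennreal (b * L) * ennreal m"
      using near by (intro add_mono) (auto simp: emeasure_eq_measure m_def)
    also have "\<dots> = ennreal (k * L * m)"
      using A C L m b by (simp add: k_def algebra_simps flip: ennreal_mult ennreal_plus)
    finally show ?thesis
      using k L Lp2_Lp1[OF alpha TfL(1)] adm unfolding I_def m_def L_def[symmetric]
      by (intro mean_osc_le) auto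
  qed
  define m0 where "m0 = measure (gam \<alpha>) (space (gam \<alpha>))"
  have L1: "Lp_norm \<alpha> 1 (T f) \<le> sqrt A * m0 * Lp_norm \<alpha> \<infinity> f" if f: "f \<in> Lp \<alpha> \<infinity>" for f
  proof -
    define L where "L = Lp_norm \<alpha> \<infinity> f"
    have L: "L \<ge> 0" "AE x in gam \<alpha>. cmod (f x) \<le> L"
      using Lp_inf_bound[OF alpha f] by (auto simp: L_def)
    have Tf: "T f \<in> Lp \<alpha> 2" "T f \<in> Lp \<alpha> 1" using TL Linf2 f Lp2_Lp1[OF alpha] by auto
    have "(\<integral>\<^sup>+x\<in>{0<..}. ennreal (norm (T f x)) \<partial>gam \<alpha>)\<^sup>2
      \<le> emeasure (gam \<alpha>) {0<..} * nnorm2 \<alpha> (T f)"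
      by (rule nn_integral_le_sqrt[OF Tf(1)]) (simp add: sets_gam_iff)
    also have "nnorm2 \<alpha> (T f) \<le> ennreal A * nnorm2 \<alpha> f"
      using Linf2 f by (intro T2) auto
    also have "nnorm2 \<alpha> f \<le> (\<integral>\<^sup>+x. ennreal (L\<^sup>2) \<partial>gam \<alpha>)"
      using L(2) by (intro nn_integral_mono_AE) (auto elim!: eventually_mono intro!: ennreal_leI power_mono)
    also have "\<dots> = ennreal (L\<^sup>2 * m0)"
      by (simp add: emeasure_eq_measure ennreal_mult m0_def)
    also have "emeasure (gam \<alpha>) {0<..} * (ennreal A * ennreal (L\<^sup>2 * m0)) = ennreal (m0 * (A * (L\<^sup>2 * m0)))"
      using A by (simp add: emeasure_eq_measure m0_def ennreal_mult)
    also have "m0 * (A * (L\<^sup>2 * m0)) = (sqrt A * m0 * L)\<^sup>2"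
      using A by (simp add: power_mult_distrib power2_eq_square[of m0])
    finally have "(\<integral>\<^sup>+x\<in>{0<..}. ennreal (norm (T f x)) \<partial>gam \<alpha>)\<^sup>2 \<le> (ennreal (sqrt A * m0 * L))\<^sup>2"
      using A L by (simp add: ennreal_power mult_left_mono m0_def)
    then have "(\<integral>\<^sup>+x\<in>{0<..}. ennreal (norm (T f x)) \<partial>gam \<alpha>) \<le> ennreal (sqrt A * m0 * L)"
      by (rule ennreal_power2_le)
    moreover have "(\<integral>\<^sup>+x\<in>{0<..}. ennreal (norm (T f x)) \<partial>gam \<alpha>) = ennreal (Lp_norm \<alpha> 1 (T f))"
      unfolding Lp1_norm[OF Tf(2)] by (intro nn_integral_cong) auto
    ultimately show ?thesis
      using A L by (simp add: L_def m0_def)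
  qed
  have ne: "adm a \<noteq> {}"
  proof -
    have "(1, min 1 a) \<in> adm a" using a by (auto simp: adm_def m_fun_def)
    then show ?thesis by blast
  qed
  have osc': "mean_osc \<alpha> (T f) I \<le> 2 * (k * Lp_norm \<alpha> \<infinity> f)" if "f \<in> Lp \<alpha> \<infinity>" "I \<in> adm a" for f I
    using osc that by (cases I) auto
  show ?thesis
    unfolding bounded_op_def
  proof (intro exI[of _ "sqrt A * m0 + 2 * k"] ballI conjI)
    fix f :: "real \<Rightarrow> complex" assume f: "f \<in> Lp \<alpha> \<infinity>"
    show "T f \<in> BMO \<alpha> a"
      unfolding BMO_def using osc'[OF f] Lp2_Lp1[OF alpha TL[OF Linf2[OF f]]] by (auto intro!: bdd_aboveI2)
    have "BMO_norm \<alpha> a (T f) \<le> sqrt A * m0 * Lp_norm \<alpha> \<infinity> f + 2 * (k * Lp_norm \<alpha> \<infinity> f)"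
      unfolding BMO_norm_def using f ne by (intro add_mono L1 cSUP_least osc') auto
    then show "BMO_norm \<alpha> a (T f) \<le> (sqrt A * m0 + 2 * k) * Lp_norm \<alpha> \<infinity> f"
      by (simp add: algebra_simps)
  qed
qed

end

section \<open>Sublinear operators on functions living on one interval\<close>

text \<open>
  The operator \<open>U\<close> stands for $f \mapsto \|Tf\|$. Assumption \<open>U_diff\<close> is the part of linearity
  that survives taking norms. In \<open>U_kernel\<close> the mean of \<open>f\<close> vanishes, so that the kernel may
  be compared with its value at any second point \<open>w\<close>.
\<close>

locale sublinear_op = kernel_dist +
  fixes U :: "(real \<Rightarrow> complex) \<Rightarrow> real \<Rightarrow> real" and A C :: real and B :: ennreal
  assumes U_meas: "\<And>f. f \<in> Lp \<alpha> 2 \<Longrightarrow> U f \<in> borel_measurable (gam \<alpha>)"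
    and U_nonneg: "\<And>f. f \<in> Lp \<alpha> 2 \<Longrightarrow> AE x in gam \<alpha>. 0 \<le> U f x"
    and U_diff: "\<And>f g. f \<in> Lp \<alpha> 2 \<Longrightarrow> g \<in> Lp \<alpha> 2 \<Longrightarrow>
      AE x in gam \<alpha>. \<bar>U f x - U g x\<bar> \<le> U (\<lambda>y. f y - g y) x"
    and U_cmult: "\<And>f c. f \<in> Lp \<alpha> 2 \<Longrightarrow> AE x in gam \<alpha>. U (\<lambda>y. c * f y) x = cmod c * U f x"
    and A_nonneg: "A \<ge> 0"
    and U_L2: "\<And>f. f \<in> Lp \<alpha> 2 \<Longrightarrow> (\<integral>\<^sup>+x. ennreal ((U f x)\<^sup>2) \<partial>gam \<alpha>)
        \<le> ennreal A * nnorm2 \<alpha> f"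
    and C_nonneg: "C \<ge> 0"
    and U_weak: "\<And>f s. f \<in> Lp \<alpha> 2 \<Longrightarrow> s > 0 \<Longrightarrow> emeasure (gam \<alpha>) {x \<in> {0<..}. s < U f x}
        \<le> ennreal (C / s) * nnorm1 \<alpha> f"
    and U_kernel: "\<And>f. f \<in> Lp \<alpha> \<infinity> \<Longrightarrow> (\<integral>x. f x \<partial>gam \<alpha>) = 0 \<Longrightarrow>
      AE x in gam \<alpha>. x \<notin> supp f \<longrightarrow> (\<forall>w>0. w \<noteq> x \<longrightarrow>
        ennreal (U f x) \<le> (\<integral>\<^sup>+y. ennreal (D (x, y) (x, w)) * ennreal (cmod (f y)) \<partial>gam \<alpha>))"
    and reg2: "regular (\<lambda>x y. (y, x)) 1 B" and B_finite: "B < \<infinity>"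
begin

lemma U_add:
  assumes "f \<in> Lp \<alpha> 2" "g \<in> Lp \<alpha> 2"
  shows "AE x in gam \<alpha>. U (\<lambda>y. f y + g y) x \<le> U f x + U g x"
proof -
  have "AE x in gam \<alpha>. \<bar>U (\<lambda>y. f y + g y) x - U g x\<bar> \<le> U (\<lambda>y. f y + g y - g y) x"
    by (intro U_diff Lp2_add assms)
  then show ?thesis by eventually_elim (simp add: abs_le_iff)
qed

text \<open>
  With the centre of the interval as second point in \<open>U_kernel\<close>, Fubini leaves for each \<open>y\<close>
  the integral of the kernel distance between \<open>y\<close> and the centre.
\<close>

lemma U_integral_away:
  assumes adm: "(c, r) \<in> adm a" and reg: "regular (\<lambda>x y. (y, x)) a B'"
    and g: "g \<in> borel_measurable (gam \<alpha>)" "\<And>x. x > 0 \<Longrightarrow> cmod (g x) \<le> L"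
    and off: "\<And>x. x > 0 \<Longrightarrow> x \<notin> ivl c r \<Longrightarrow> g x = 0"
    and mean: "(\<integral>x. g x \<partial>gam \<alpha>) = 0"
  shows "(\<integral>\<^sup>+x\<in>{0<..} - ivl c (2 * r). ennreal (U g x) \<partial>gam \<alpha>)
    \<le> B' * nnorm1 \<alpha> g"
proof -
  interpret pair_sigma_finite "gam \<alpha>" "gam \<alpha>" by standard
  note A' = admD[OF adm]
  have gm [measurable]: "g \<in> borel_measurable (gam \<alpha>)" by (fact g)
  have gInf: "g \<in> Lp \<alpha> \<infinity>"
    by (rule Lp_infI[OF gm, of L]) (use g(2) in \<open>auto intro!: AE_I2\<close>)
  define I where "I = ivl c r"
  define E where "E = {0<..} - ivl c (2 * r)"
  have [measurable]: "I \<in> sets (gam \<alpha>)" "E \<in> sets (gam \<alpha>)"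
    by (auto simp: I_def E_def sets_gam_iff ivl_def)
  have supp: "x \<notin> supp g" if "x \<in> E" for x
  proof -
    have "closure {x \<in> {0<..}. g x \<noteq> 0} \<subseteq> {c - r .. c + r}"
      using off by (intro closure_minimal) (auto simp: ivl_def, force+)
    then show ?thesis using that A' by (auto simp: supp_def E_def ivl_def)
  qed
  define H where "H x y = ennreal (D (x, y) (x, c)) * indicator (E \<times> I) (x, y)" for x y
  have idm [measurable]: "(\<lambda>x. x) \<in> gam \<alpha> \<rightarrow>\<^sub>M (borel :: real measure)"
    by (subst measurable_cong_sets[OF sets_gam refl]) (simp add: measurable_restrict_space1)
  have idf [measurable]: "fst \<in> (gam \<alpha> \<Otimes>\<^sub>M gam \<alpha>) \<rightarrow>\<^sub>M (borel :: real measure)"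
    "snd \<in> (gam \<alpha> \<Otimes>\<^sub>M gam \<alpha>) \<rightarrow>\<^sub>M (borel :: real measure)"
    using measurable_compose[OF measurable_fst idm] measurable_compose[OF measurable_snd idm] by auto
  have "(\<lambda>z. ennreal (D (fst z, snd z) (fst z, c)) * indicator (E \<times> I) z)
      \<in> borel_measurable (gam \<alpha> \<Otimes>\<^sub>M gam \<alpha>)"
  proof (rule D_measurable)
    show "(\<lambda>z. (fst z, snd z)) \<in> gam \<alpha> \<Otimes>\<^sub>M gam \<alpha> \<rightarrow>\<^sub>M (borel :: real measure) \<Otimes>\<^sub>M (borel :: real measure)"
      by (intro measurable_Pair idf)
    show "(\<lambda>z. (fst z, c)) \<in> gam \<alpha> \<Otimes>\<^sub>M gam \<alpha> \<rightarrow>\<^sub>M (borel :: real measure) \<Otimes>\<^sub>M (borel :: real measure)"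
      by (intro measurable_Pair idf measurable_const) simp
    show "E \<times> I \<in> sets (gam \<alpha> \<Otimes>\<^sub>M gam \<alpha>)" by (intro pair_measureI) auto
  qed (use A' in \<open>auto simp: E_def I_def ivl_def\<close>)
  moreover have "case_prod H = (\<lambda>z. ennreal (D (fst z, snd z) (fst z, c)) * indicator (E \<times> I) z)"
    by (auto simp: H_def fun_eq_iff)
  ultimately have Hm: "case_prod H \<in> borel_measurable (gam \<alpha> \<Otimes>\<^sub>M gam \<alpha>)"
    by (simp only:)
  have Hm1: "(\<lambda>x. H x y) \<in> borel_measurable (gam \<alpha>)" if "y > 0" for y
    using measurable_Pair1[OF Hm, of y] that by simp
  have "(\<integral>\<^sup>+x\<in>E. ennreal (U g x) \<partial>gam \<alpha>) \<le> (\<integral>\<^sup>+x. \<integral>\<^sup>+y. H x y * ennreal (cmod (g y)) \<partial>gam \<alpha> \<partial>gam \<alpha>)"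
  proof (rule nn_integral_mono_AE)
    show "AE x in gam \<alpha>. ennreal (U g x) * indicator E x \<le> (\<integral>\<^sup>+y. H x y * ennreal (cmod (g y)) \<partial>gam \<alpha>)"
      using U_kernel[OF gInf mean]
    proof eventually_elim
      case (elim x)
      show ?case
      proof (cases "x \<in> E")
        case True
        have "c \<noteq> x" using True A' by (auto simp: E_def ivl_def)
        then have "ennreal (U g x) \<le> (\<integral>\<^sup>+y. ennreal (D (x, y) (x, c)) * ennreal (cmod (g y)) \<partial>gam \<alpha>)"
          using elim supp[OF True] A' by auto
        also have "\<dots> \<le> (\<integral>\<^sup>+y. H x y * ennreal (cmod (g y)) \<partial>gam \<alpha>)"
          using off True by (intro nn_integral_mono) (auto simp: H_def I_def split: split_indicator)
        finally show ?thesis using True by simp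
      qed simp
    qed
  qed
  also have "\<dots> = (\<integral>\<^sup>+y. \<integral>\<^sup>+x. H x y * ennreal (cmod (g y)) \<partial>gam \<alpha> \<partial>gam \<alpha>)"
    using Hm by (intro Fubini'[symmetric]) (simp add: case_prod_beta)
  also have "\<dots> \<le> (\<integral>\<^sup>+y. B' * ennreal (cmod (g y)) \<partial>gam \<alpha>)"
  proof (rule nn_integral_mono)
    fix y assume y: "y \<in> space (gam \<alpha>)"
    have "(\<integral>\<^sup>+x. H x y * ennreal (cmod (g y)) \<partial>gam \<alpha>) = (\<integral>\<^sup>+x. H x y \<partial>gam \<alpha>) * ennreal (cmod (g y))"
      using y by (intro nn_integral_multc Hm1) simp
    also have "\<dots> \<le> B' * ennreal (cmod (g y))"
    proof (cases "y \<in> I")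
      case True
      have "c \<in> ivl c r" using A' by (auto simp: ivl_def)
      then have "(\<integral>\<^sup>+x\<in>E. ennreal (D (x, y) (x, c)) \<partial>gam \<alpha>) \<le> B'"
        using reg adm True unfolding regular_def E_def I_def by fast
      then show ?thesis using True by (intro mult_right_mono) (auto simp: H_def indicator_def)
    next
      case False
      then show ?thesis using off[of y] y by (simp add: I_def)
    qed
    finally show "(\<integral>\<^sup>+x. H x y * ennreal (cmod (g y)) \<partial>gam \<alpha>) \<le> B' * ennreal (cmod (g y))" .
  qed
  also have "\<dots> = B' * nnorm1 \<alpha> g"
    by (rule nn_integral_cmult) measurable
  finally show ?thesis by (simp add: E_def)
qed

text \<open>
  Chebyshev's inequality for the square.
\<close>

lemma U_strong:
  assumes f: "f \<in> Lp \<alpha> 2" and s: "s > 0"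
  shows "emeasure (gam \<alpha>) {x \<in> {0<..}. s < U f x}
    \<le> ennreal (A / s\<^sup>2) * nnorm2 \<alpha> f"
proof -
  have [measurable]: "U f \<in> borel_measurable (gam \<alpha>)" by (rule U_meas[OF f])
  have "{x \<in> space (gam \<alpha>). s < U f x} \<in> sets (gam \<alpha>)" by measurable
  then have S: "{x \<in> {0<..}. s < U f x} \<in> sets (gam \<alpha>)" by simp
  have "emeasure (gam \<alpha>) {x \<in> {0<..}. s < U f x} = (\<integral>\<^sup>+x. indicator {x \<in> {0<..}. s < U f x} x \<partial>gam \<alpha>)"
    using S by simp
  also have "\<dots> \<le> (\<integral>\<^sup>+x. ennreal (1 / s\<^sup>2) * ennreal ((U f x)\<^sup>2) \<partial>gam \<alpha>)"
  proof (rule nn_integral_mono)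
    fix x
    show "indicator {x \<in> {0<..}. s < U f x} x \<le> ennreal (1 / s\<^sup>2) * ennreal ((U f x)\<^sup>2)"
    proof (cases "s < U f x")
      case True
      then have "1 \<le> 1 / s\<^sup>2 * (U f x)\<^sup>2" using s by (simp add: power_mono)
      then show ?thesis
        by (auto simp flip: ennreal_mult ennreal_1 split: split_indicator intro!: ennreal_leI)
    qed simp
  qed
  also have "\<dots> = ennreal (1 / s\<^sup>2) * (\<integral>\<^sup>+x. ennreal ((U f x)\<^sup>2) \<partial>gam \<alpha>)"
    by (rule nn_integral_cmult) measurable
  also have "\<dots> \<le> ennreal (1 / s\<^sup>2) * (ennreal A * nnorm2 \<alpha> f)"
    by (intro mult_left_mono U_L2 f) simp
  also have "\<dots> = ennreal (A / s\<^sup>2) * nnorm2 \<alpha> f"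
    using A_nonneg by (simp add: ennreal_mult'[symmetric] mult.assoc[symmetric])
  finally show ?thesis .
qed

lemma tail_inverse_square:
  fixes v :: real assumes "v \<ge> 0" "K \<ge> 0"
  shows "(\<integral>\<^sup>+s\<in>{s. s0 < s \<and> v \<le> s}. ennreal (K * v\<^sup>2 / s\<^sup>2) \<partial>lborel) \<le> ennreal (K * v)"
proof (cases "v = 0")
  case False
  then have v: "v > 0" using assms by simp
  have "(\<integral>\<^sup>+s. ennreal (K * v\<^sup>2 / s\<^sup>2) * indicator {v..} s \<partial>lborel) = ennreal (0 - (- (K * v\<^sup>2 / v)))"
  proof (rule nn_integral_FTC_atLeast[where F = "\<lambda>s. - (K * v\<^sup>2 / s)"])
    show "DERIV (\<lambda>s. - (K * v\<^sup>2 / s)) x :> K * v\<^sup>2 / x\<^sup>2" if "v \<le> x" for x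
      using that v by (auto intro!: derivative_eq_intros simp: power2_eq_square)
    show "((\<lambda>s. - (K * v\<^sup>2 / s)) \<longlongrightarrow> 0) at_top"
      using tendsto_minus[OF tendsto_divide_0[OF tendsto_const filterlim_at_top_imp_at_infinity[OF filterlim_ident]]] by simp
  qed (use assms in auto)
  also have "0 - (- (K * v\<^sup>2 / v)) = K * v" using v by (simp add: power2_eq_square)
  finally have "(\<integral>\<^sup>+s. ennreal (K * v\<^sup>2 / s\<^sup>2) * indicator {v..} s \<partial>lborel) = ennreal (K * v)" .
  moreover have "(\<integral>\<^sup>+s\<in>{s. s0 < s \<and> v \<le> s}. ennreal (K * v\<^sup>2 / s\<^sup>2) \<partial>lborel)
      \<le> (\<integral>\<^sup>+s. ennreal (K * v\<^sup>2 / s\<^sup>2) * indicator {v..} s \<partial>lborel)"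
    by (intro nn_integral_mono) (auto split: split_indicator)
  ultimately show ?thesis by simp
qed simp

text \<open>
  The integral is $Kv\ln(v/s_0)$, and $\ln x \le x^{p-1}/(p-1)$. This is where an exponent
  above $1$ beats the logarithm that the weak $L^1$ bound produces.
\<close>

lemma log_integral_bound:
  fixes v :: real assumes "v \<ge> 0" "K \<ge> 0" "s0 > 0" "p > 1"
  shows "(\<integral>\<^sup>+s\<in>{s. s0 < s \<and> s < v}. ennreal (K * v / s) \<partial>lborel)
    \<le> ennreal (K / (p - 1) * (s0 powr (1 - p) * v powr p))"
proof (cases "s0 < v")
  case True
  then have v: "v > 0" using assms by simp
  have "(\<integral>\<^sup>+s. ennreal (K * v / s) * indicator {s0..v} s \<partial>lborel) = ennreal (K * v * ln v - K * v * ln s0)"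
  proof (rule nn_integral_FTC_Icc[where F = "\<lambda>s. K * v * ln s"])
    show "DERIV (\<lambda>s. K * v * ln s) x :> K * v / x" if "x \<in> {s0..v}" for x
      using that assms by (auto intro!: derivative_eq_intros)
    show "K * v / x \<ge> 0" if "x \<in> {s0..v}" for x using assms that by auto
  qed (use True in auto)
  moreover have "K * v * ln v - K * v * ln s0 \<le> K / (p - 1) * (s0 powr (1 - p) * v powr p)"
  proof -
    define x where "x = v / s0"
    have x: "x > 0" using v assms by (simp add: x_def)
    have "(p - 1) * ln x = ln (x powr (p - 1))" using x by (simp add: ln_powr)
    also have "\<dots> \<le> x powr (p - 1) - 1" using x by (intro ln_le_minus_one) auto
    finally have "ln x \<le> x powr (p - 1) / (p - 1)" using assms by (simp add: field_simps)
    then have "K * v * ln x \<le> K * v * (x powr (p - 1) / (p - 1))"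
      using assms by (intro mult_left_mono) auto
    also have "\<dots> = K / (p - 1) * (s0 powr (1 - p) * v powr p)"
      using assms v by (simp add: x_def powr_divide powr_diff field_simps)
    finally show ?thesis using assms v by (simp add: x_def ln_div algebra_simps)
  qed
  moreover have "(\<integral>\<^sup>+s\<in>{s. s0 < s \<and> s < v}. ennreal (K * v / s) \<partial>lborel)
      \<le> (\<integral>\<^sup>+s. ennreal (K * v / s) * indicator {s0..v} s \<partial>lborel)"
    by (intro nn_integral_mono) (auto split: split_indicator)
  ultimately show ?thesis using ennreal_leI order_trans by fastforce
next
  case False
  then have "{s. s0 < s \<and> s < v} = {}" by auto
  then show ?thesis by simp
qed

text \<open>
  The integral is that of the distribution function over all heights \<open>s\<close>. Up to $s_0$ the
  measure of \<open>J\<close> is a sufficient bound. Above, \<open>g\<close> is split at height \<open>s\<close> itself, with the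
  $L^2$ bound for the part below and the weak $L^1$ bound for the part above. After exchanging
  the integrations the inner integrals over \<open>s\<close> are those of the two preceding lemmas.
\<close>

lemma U_integral_near:
  assumes g: "g \<in> Lp \<alpha> 2" and J: "J \<in> sets (gam \<alpha>)" and s0: "s0 > 0" and p: "p > 1"
  shows "(\<integral>\<^sup>+x\<in>J. ennreal (U g x) \<partial>gam \<alpha>) \<le> ennreal s0 * emeasure (gam \<alpha>) J
    + (ennreal (4 * A) * nnorm1 \<alpha> g
    + ennreal (2 * C / (p - 1)) * (ennreal (s0 powr (1 - p)) * (\<integral>\<^sup>+x. ennreal (cmod (g x) powr p) \<partial>gam \<alpha>)))"
proof -
  interpret L: pair_sigma_finite "gam \<alpha>" lborel by standard
  have gm [measurable]: "g \<in> borel_measurable (gam \<alpha>)" using g by (simp add: Lp2_iff)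
  have Ugm [measurable]: "U g \<in> borel_measurable (gam \<alpha>)" by (rule U_meas[OF g])
  note J [measurable]
  \<comment> \<open>the contributions of a value \<open>v\<close> of $|g|$ to the two bounds at height \<open>s\<close>; halving the height in each part gives the factors $4$ and $2$\<close>
  define k1 where "k1 s v = ennreal (4 * A * v\<^sup>2 / s\<^sup>2) * indicator {s. s0 < s \<and> v \<le> s} s" for s v :: real
  define k2 where "k2 s v = ennreal (2 * C * v / s) * indicator {s. s0 < s \<and> s < v} s" for s v :: real
  have dist: "emeasure (gam \<alpha>) {x \<in> {0<..}. s < U g x}
    \<le> (\<integral>\<^sup>+x. k1 s (cmod (g x)) \<partial>gam \<alpha>) + (\<integral>\<^sup>+x. k2 s (cmod (g x)) \<partial>gam \<alpha>)" if s: "s0 < s" for s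
  proof -
    define lo where "lo = (\<lambda>x. if cmod (g x) \<le> s then g x else 0)"
    define hi where "hi = (\<lambda>x. if cmod (g x) \<le> s then 0 else g x)"
    have [measurable]: "lo \<in> borel_measurable (gam \<alpha>)" "hi \<in> borel_measurable (gam \<alpha>)"
      unfolding lo_def hi_def by measurable
    have lo: "lo \<in> Lp \<alpha> 2" and hi: "hi \<in> Lp \<alpha> 2"
      using g by (auto intro!: Lp2_mono[OF g] simp: lo_def hi_def)
    have s2: "s / 2 > 0" using s s0 by simp
    have [measurable]: "U lo \<in> borel_measurable (gam \<alpha>)" "U hi \<in> borel_measurable (gam \<alpha>)"
      using lo hi by (auto intro: U_meas)
    have meas: "{x \<in> {0<..}. t < U h x} \<in> sets (gam \<alpha>)" if "U h \<in> borel_measurable (gam \<alpha>)" for h t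
    proof -
      have "{x \<in> space (gam \<alpha>). t < U h x} \<in> sets (gam \<alpha>)" using that by measurable
      then show ?thesis by simp
    qed
    have "(\<lambda>y. lo y + hi y) = g" by (auto simp: lo_def hi_def)
    then have "AE x in gam \<alpha>. U g x \<le> U lo x + U hi x" using U_add[OF lo hi] by simp
    then have "emeasure (gam \<alpha>) {x \<in> {0<..}. s < U g x}
      \<le> emeasure (gam \<alpha>) ({x \<in> {0<..}. s / 2 < U lo x} \<union> {x \<in> {0<..}. s / 2 < U hi x})"
      by (intro emeasure_mono_AE sets.Un meas) (auto elim!: eventually_mono)
    also have "\<dots> \<le> emeasure (gam \<alpha>) {x \<in> {0<..}. s / 2 < U lo x} + emeasure (gam \<alpha>) {x \<in> {0<..}. s / 2 < U hi x}"
      by (intro emeasure_subadditive meas) auto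
    also have "\<dots> \<le> ennreal (A / (s / 2)\<^sup>2) * nnorm2 \<alpha> lo
        + ennreal (C / (s / 2)) * nnorm1 \<alpha> hi"
      by (intro add_mono U_strong U_weak lo hi s2)
    also have "ennreal (A / (s / 2)\<^sup>2) * nnorm2 \<alpha> lo
        = (\<integral>\<^sup>+x. ennreal (A / (s / 2)\<^sup>2) * ennreal ((cmod (lo x))\<^sup>2) \<partial>gam \<alpha>)"
      by (rule nn_integral_cmult[symmetric]) measurable
    also have "\<dots> = (\<integral>\<^sup>+x. k1 s (cmod (g x)) \<partial>gam \<alpha>)"
    proof (intro nn_integral_cong)
      fix x
      have "A / (s / 2)\<^sup>2 * (cmod (g x))\<^sup>2 = 4 * A * (cmod (g x))\<^sup>2 / s\<^sup>2" by (simp add: power_divide)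
      then show "ennreal (A / (s / 2)\<^sup>2) * ennreal ((cmod (lo x))\<^sup>2) = k1 s (cmod (g x))"
        using s A_nonneg unfolding k1_def lo_def
        by (subst ennreal_mult[symmetric]) (auto split: split_indicator)
    qed
    also have "ennreal (C / (s / 2)) * nnorm1 \<alpha> hi
        = (\<integral>\<^sup>+x. ennreal (C / (s / 2)) * ennreal (cmod (hi x)) \<partial>gam \<alpha>)"
      by (rule nn_integral_cmult[symmetric]) measurable
    also have "\<dots> = (\<integral>\<^sup>+x. k2 s (cmod (g x)) \<partial>gam \<alpha>)"
    proof (intro nn_integral_cong)
      fix x
      have "C / (s / 2) * cmod (g x) = 2 * C * cmod (g x) / s" by simp
      then show "ennreal (C / (s / 2)) * ennreal (cmod (hi x)) = k2 s (cmod (g x))"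
        using s s0 C_nonneg unfolding k2_def hi_def
        by (subst ennreal_mult[symmetric]) (auto split: split_indicator)
    qed
    finally show ?thesis .
  qed
  have sw: "(\<integral>\<^sup>+s. \<integral>\<^sup>+x. F x s \<partial>gam \<alpha> \<partial>lborel) = (\<integral>\<^sup>+x. \<integral>\<^sup>+s. F x s \<partial>lborel \<partial>gam \<alpha>)"
    if "case_prod F \<in> borel_measurable (gam \<alpha> \<Otimes>\<^sub>M lborel)" for F
    using L.Fubini'[OF that] .
  have k1m [measurable]: "(\<lambda>(x, s). k1 s (cmod (g x))) \<in> borel_measurable (gam \<alpha> \<Otimes>\<^sub>M lborel)"
    unfolding k1_def by measurable
  have k2m [measurable]: "(\<lambda>(x, s). k2 s (cmod (g x))) \<in> borel_measurable (gam \<alpha> \<Otimes>\<^sub>M lborel)"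
    unfolding k2_def by measurable
  have "(\<integral>\<^sup>+x\<in>J. ennreal (U g x) \<partial>gam \<alpha>)
      = (\<integral>\<^sup>+x. \<integral>\<^sup>+s. indicator J x * indicator {s. 0 \<le> s \<and> s < U g x} s \<partial>lborel \<partial>gam \<alpha>)"
  proof (intro nn_integral_cong)
    fix x
    have "{s. 0 \<le> s \<and> s < U g x} = {0..<U g x}" by auto
    then show "ennreal (U g x) * indicator J x
        = (\<integral>\<^sup>+s. indicator J x * indicator {s. 0 \<le> s \<and> s < U g x} s \<partial>lborel)"
      by (cases "0 \<le> U g x") (auto simp: nn_integral_cmult ennreal_neg mult.commute)
  qed
  also have "\<dots> = (\<integral>\<^sup>+s. \<integral>\<^sup>+x. indicator J x * indicator {s. 0 \<le> s \<and> s < U g x} s \<partial>gam \<alpha> \<partial>lborel)"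
    by (rule sw[symmetric]) measurable
  also have "\<dots> \<le> (\<integral>\<^sup>+s. emeasure (gam \<alpha>) J * indicator {0..s0} s
      + ((\<integral>\<^sup>+x. k1 s (cmod (g x)) \<partial>gam \<alpha>) + (\<integral>\<^sup>+x. k2 s (cmod (g x)) \<partial>gam \<alpha>)) \<partial>lborel)"
  proof (rule nn_integral_mono)
    fix s :: real
    consider "s < 0" | "0 \<le> s" "s \<le> s0" | "s0 < s" by linarith
    then show "(\<integral>\<^sup>+x. indicator J x * indicator {s. 0 \<le> s \<and> s < U g x} s \<partial>gam \<alpha>)
      \<le> emeasure (gam \<alpha>) J * indicator {0..s0} s
      + ((\<integral>\<^sup>+x. k1 s (cmod (g x)) \<partial>gam \<alpha>) + (\<integral>\<^sup>+x. k2 s (cmod (g x)) \<partial>gam \<alpha>))"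
    proof cases
      case 2
      have "(\<integral>\<^sup>+x. indicator J x * indicator {s. 0 \<le> s \<and> s < U g x} s \<partial>gam \<alpha>)
        \<le> (\<integral>\<^sup>+x. indicator J x \<partial>gam \<alpha>)"
        by (intro nn_integral_mono) (auto split: split_indicator)
      also have "\<dots> = emeasure (gam \<alpha>) J" by simp
      finally show ?thesis using 2 by (simp add: add_increasing2)
    next
      case 3
      have "{x \<in> space (gam \<alpha>). s < U g x} \<in> sets (gam \<alpha>)" by measurable
      then have S: "{x \<in> {0<..}. s < U g x} \<in> sets (gam \<alpha>)" by simp
      have "(\<integral>\<^sup>+x. indicator J x * indicator {s. 0 \<le> s \<and> s < U g x} s \<partial>gam \<alpha>)
        \<le> (\<integral>\<^sup>+x. indicator {x \<in> {0<..}. s < U g x} x \<partial>gam \<alpha>)"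
        by (intro nn_integral_mono) (auto split: split_indicator)
      also have "\<dots> = emeasure (gam \<alpha>) {x \<in> {0<..}. s < U g x}" using S by simp
      also have "\<dots> \<le> (\<integral>\<^sup>+x. k1 s (cmod (g x)) \<partial>gam \<alpha>) + (\<integral>\<^sup>+x. k2 s (cmod (g x)) \<partial>gam \<alpha>)"
        by (rule dist[OF 3])
      finally show ?thesis using 3 by simp
    qed simp
  qed
  also have "\<dots> = (\<integral>\<^sup>+s. emeasure (gam \<alpha>) J * indicator {0..s0} s \<partial>lborel)
      + ((\<integral>\<^sup>+s. \<integral>\<^sup>+x. k1 s (cmod (g x)) \<partial>gam \<alpha> \<partial>lborel) + (\<integral>\<^sup>+s. \<integral>\<^sup>+x. k2 s (cmod (g x)) \<partial>gam \<alpha> \<partial>lborel))"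
  proof -
    have [measurable]: "(\<lambda>s. \<integral>\<^sup>+x. k1 s (cmod (g x)) \<partial>gam \<alpha>) \<in> borel_measurable lborel"
      unfolding k1_def by measurable
    have [measurable]: "(\<lambda>s. \<integral>\<^sup>+x. k2 s (cmod (g x)) \<partial>gam \<alpha>) \<in> borel_measurable lborel"
      unfolding k2_def by measurable
    show ?thesis by (simp add: nn_integral_add)
  qed
  also have "(\<integral>\<^sup>+s. emeasure (gam \<alpha>) J * indicator {0..s0} s \<partial>lborel) = ennreal s0 * emeasure (gam \<alpha>) J"
    using s0 by (subst nn_integral_cmult_indicator) (auto simp: mult.commute)
  also have "(\<integral>\<^sup>+s. \<integral>\<^sup>+x. k1 s (cmod (g x)) \<partial>gam \<alpha> \<partial>lborel) = (\<integral>\<^sup>+x. \<integral>\<^sup>+s. k1 s (cmod (g x)) \<partial>lborel \<partial>gam \<alpha>)"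
    by (rule sw) measurable
  also have "(\<integral>\<^sup>+s. \<integral>\<^sup>+x. k2 s (cmod (g x)) \<partial>gam \<alpha> \<partial>lborel) = (\<integral>\<^sup>+x. \<integral>\<^sup>+s. k2 s (cmod (g x)) \<partial>lborel \<partial>gam \<alpha>)"
    by (rule sw) measurable
  also have "(\<integral>\<^sup>+x. \<integral>\<^sup>+s. k1 s (cmod (g x)) \<partial>lborel \<partial>gam \<alpha>) \<le> (\<integral>\<^sup>+x. ennreal (4 * A * cmod (g x)) \<partial>gam \<alpha>)"
    unfolding k1_def using A_nonneg by (intro nn_integral_mono tail_inverse_square) auto
  also have "\<dots> = ennreal (4 * A) * nnorm1 \<alpha> g"
    using A_nonneg by (subst nn_integral_cmult[symmetric]) (auto simp: ennreal_mult)
  also have "(\<integral>\<^sup>+x. \<integral>\<^sup>+s. k2 s (cmod (g x)) \<partial>lborel \<partial>gam \<alpha>)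
      \<le> (\<integral>\<^sup>+x. ennreal (2 * C / (p - 1) * (s0 powr (1 - p) * cmod (g x) powr p)) \<partial>gam \<alpha>)"
    unfolding k2_def using C_nonneg s0 p by (intro nn_integral_mono log_integral_bound) auto
  also have "\<dots> = ennreal (2 * C / (p - 1)) * (ennreal (s0 powr (1 - p)) * (\<integral>\<^sup>+x. ennreal (cmod (g x) powr p) \<partial>gam \<alpha>))"
  proof -
    have "ennreal (2 * C / (p - 1) * (s0 powr (1 - p) * v)) = ennreal (2 * C / (p - 1)) * (ennreal (s0 powr (1 - p)) * ennreal v)"
      if "v \<ge> 0" for v
      using that C_nonneg p by (subst ennreal_mult; simp add: ennreal_mult)
    then show ?thesis by (simp add: nn_integral_cmult)
  qed
  finally show ?thesis by (simp add: add_mono)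
qed

end

section \<open>Atoms and their truncations\<close>

lemma gt_sets:
  fixes w :: "real \<Rightarrow> real"
  assumes [measurable]: "w \<in> borel_measurable (gam \<alpha>)"
  shows "{x \<in> {0<..}. s < w x} \<in> sets (gam \<alpha>)"
proof -
  have "{x \<in> space (gam \<alpha>). s < w x} \<in> sets (gam \<alpha>)" by measurable
  then show ?thesis by simp
qed

text \<open>
  A bounded atom is in particular an atom for the exponent $2$, so that all non-constant atoms
  have a finite exponent \<open>p\<close>.
\<close>

lemma atom_cases:
  assumes \<alpha>: "\<alpha> > - 1 / 2" and atom: "atom \<alpha> a q b" and q: "1 < q"
  defines "p \<equiv> (if q = \<infinity> then 2 else real_of_ereal q)"
  shows "(\<forall>x>0. b x = 1) \<or> (\<exists>(c, r)\<in>adm a. (\<forall>x>0. x \<notin> ivl c r \<longrightarrow> b x = 0) \<and>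
     (\<integral>\<^sup>+x. ennreal (cmod (b x) powr p) \<partial>gam \<alpha>) \<le> ennreal (measure (gam \<alpha>) (ivl c r) powr (1 - p)) \<and>
     (\<integral>x. b x \<partial>gam \<alpha>) = 0)"
proof (cases "\<forall>x>0. b x = 1")
  case False
  interpret finite_measure "gam \<alpha>" by (rule finite_measure_gam[OF \<alpha>])
  obtain c r where adm: "(c, r) \<in> adm a" and supp: "supp b \<subseteq> ivl c r" and bq: "b \<in> Lp \<alpha> q"
    and norm: "Lp_norm \<alpha> q b \<le> measure (gam \<alpha>) (ivl c r) powr ((if q = \<infinity> then 0 else 1 / real_of_ereal q) - 1)"
    and mean: "(\<integral>x. b x \<partial>gam \<alpha>) = 0"
    using atom False unfolding atom_def by auto
  have bm [measurable]: "b \<in> borel_measurable (gam \<alpha>)" using atom by (simp add: atom_def)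
  define m where "m = measure (gam \<alpha>) (ivl c r)"
  have m: "m > 0" using measure_ivl_pos[OF \<alpha> adm] by (simp add: m_def)
  have off: "b x = 0" if "x > 0" "x \<notin> ivl c r" for x
    using supp that closure_subset[of "{x \<in> {0<..}. b x \<noteq> 0}"] by (force simp: supp_def)
  have "(\<integral>\<^sup>+x. ennreal (cmod (b x) powr p) \<partial>gam \<alpha>) \<le> ennreal (m powr (1 - p))"
  proof (cases "q = \<infinity>")
    case True
    have "AE x in gam \<alpha>. cmod (b x) \<le> Lp_norm \<alpha> \<infinity> b"
      using Lp_inf_bound[OF \<alpha>] bq True by blast
    moreover have "Lp_norm \<alpha> \<infinity> b \<le> m powr (- 1)" using norm True by (simp add: m_def)
    ultimately have *: "AE x in gam \<alpha>. cmod (b x) \<le> m powr (- 1)" by (auto elim!: eventually_mono)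
    have "(\<integral>\<^sup>+x. ennreal (cmod (b x) powr p) \<partial>gam \<alpha>)
       \<le> (\<integral>\<^sup>+x. ennreal (m powr (- 2)) * indicator (ivl c r) x \<partial>gam \<alpha>)"
    proof (rule nn_integral_mono_AE)
      show "AE x in gam \<alpha>. ennreal (cmod (b x) powr p) \<le> ennreal (m powr (- 2)) * indicator (ivl c r) x"
        using * AE_space
      proof eventually_elim
        case (elim x)
        have "cmod (b x) powr 2 \<le> (m powr (- 1)) powr 2" using elim by (intro powr_mono2) auto
        then have "cmod (b x) powr 2 \<le> m powr (- 2)" by (subst (asm) powr_powr) simp
        then show ?case
          using True off[of x] elim by (cases "x \<in> ivl c r") (auto simp: p_def intro!: ennreal_leI)
      qed
    qed
    also have "\<dots> = ennreal (m powr (- 2) * m)"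
      by (simp add: nn_integral_cmult_indicator emeasure_eq_measure m_def ennreal_mult)
    also have "m powr (- 2) * m = m powr (1 - p)"
      using m True powr_add[of m "- 2" 1] by (simp add: p_def)
    finally show ?thesis .
  next
    case False
    then have p: "q = ereal p" "p > 1" using q by (cases q; simp add: p_def one_ereal_def)+
    have int: "integrable (gam \<alpha>) (\<lambda>x. cmod (b x) powr p)"
      using bq p by (simp add: Lp_def)
    define X where "X = (\<integral>x. cmod (b x) powr p \<partial>gam \<alpha>)"
    have X: "X \<ge> 0" by (simp add: X_def)
    have "X powr (1 / p) \<le> m powr (1 / p - 1)"
      using norm p False by (simp add: Lp_norm_def X_def m_def)
    then have "(X powr (1 / p)) powr p \<le> (m powr (1 / p - 1)) powr p"
      using p by (intro powr_mono2) auto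
    moreover have "(1 / p - 1) * p = 1 - p" using p by (simp add: field_simps)
    ultimately have "X \<le> m powr (1 - p)"
      using p X by (simp add: powr_powr)
    then show ?thesis
      using int by (simp add: nn_integral_eq_integral X_def ennreal_leI)
  qed
  then show ?thesis using adm off mean by (auto simp: m_def)
qed simp

lemma powr_add_bound:
  fixes u v p :: real
  assumes "u \<ge> 0" "v \<ge> 0" "p \<ge> 0"
  shows "(u + v) powr p \<le> 2 powr p * (u powr p + v powr p)"
proof -
  have "(u + v) powr p \<le> (2 * max u v) powr p" using assms by (intro powr_mono2) auto
  also have "\<dots> = 2 powr p * max u v powr p" using assms by (simp add: powr_mult)
  also have "\<dots> \<le> 2 powr p * (u powr p + v powr p)"
    by (intro mult_left_mono) (auto simp: max_def)
  finally show ?thesis .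
qed

lemma powr_split:
  fixes u n p :: real
  assumes "n > 0" "n \<le> u" "p \<ge> 1"
  shows "u \<le> n powr (1 - p) * u powr p"
proof -
  have "u = u powr (1 - p) * u powr p" using assms by (simp flip: powr_add)
  also have "\<dots> \<le> n powr (1 - p) * u powr p" using assms by (intro mult_right_mono powr_mono2') auto
  finally show ?thesis .
qed

text \<open>
  The truncation of \<open>b\<close> at a height $n$ loses the mean value zero; subtracting the mean,
  spread evenly over the interval, restores it. Since $|b| \le n^{1-p}|b|^p$ where
  $|b| \ge n$, the tail cut off has integral at most $n^{1-p}\int|b|^p$, which is small for
  large $n$, and it bounds the correction as well. Hence the result is as close to \<open>b\<close> in
  $L^1$ as desired, while its size in $L^1$ and $L^p$ remains that of an atom.
\<close>

lemma atom_truncation: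
  fixes b :: "real \<Rightarrow> complex"
  assumes \<alpha>: "\<alpha> > - 1 / 2" and adm: "(c, r) \<in> adm a" and bm: "b \<in> borel_measurable (gam \<alpha>)"
    and off: "\<And>x. x > 0 \<Longrightarrow> x \<notin> ivl c r \<Longrightarrow> b x = 0"
    and size: "(\<integral>\<^sup>+x. ennreal (cmod (b x) powr p) \<partial>gam \<alpha>) \<le> ennreal (measure (gam \<alpha>) (ivl c r) powr (1 - p))"
    and mean: "(\<integral>x. b x \<partial>gam \<alpha>) = 0" and p: "p > 1" and e: "e > 0"
  obtains g L where "g \<in> borel_measurable (gam \<alpha>)" "\<And>x. x > 0 \<Longrightarrow> cmod (g x) \<le> L"
    "\<And>x. x > 0 \<Longrightarrow> x \<notin> ivl c r \<Longrightarrow> g x = 0" "(\<integral>x. g x \<partial>gam \<alpha>) = 0"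
    "nnorm1 \<alpha> (\<lambda>x. g x - b x) \<le> ennreal e"
    "nnorm1 \<alpha> g \<le> 3"
    "(\<integral>\<^sup>+x. ennreal (cmod (g x) powr p) \<partial>gam \<alpha>)
       \<le> ennreal (2 powr (p + 1) * measure (gam \<alpha>) (ivl c r) powr (1 - p))"
proof -
  interpret finite_measure "gam \<alpha>" by (rule finite_measure_gam[OF \<alpha>])
  note bm [measurable]
  define I where "I = ivl c r"
  have [measurable]: "I \<in> sets (gam \<alpha>)" by (simp add: I_def)
  have I_pos: "I \<inter> {0<..} = I" by (auto simp: I_def ivl_def)
  define m where "m = measure (gam \<alpha>) I"
  have m: "m > 0" using measure_ivl_pos[OF \<alpha> adm] by (simp add: m_def I_def)
  have emI: "emeasure (gam \<alpha>) I = ennreal m" by (simp add: emeasure_eq_measure m_def)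
  have size': "(\<integral>\<^sup>+x. ennreal (cmod (b x) powr p) \<partial>gam \<alpha>) \<le> ennreal (m powr (1 - p))"
    using size by (simp add: m_def I_def)
  have scaled: "(\<integral>\<^sup>+x. ennreal (k * cmod (b x) powr p) \<partial>gam \<alpha>) \<le> ennreal (k * m powr (1 - p))"
    if "k \<ge> 0" for k
  proof -
    have "(\<integral>\<^sup>+x. ennreal (k * cmod (b x) powr p) \<partial>gam \<alpha>) = ennreal k * (\<integral>\<^sup>+x. ennreal (cmod (b x) powr p) \<partial>gam \<alpha>)"
      using that by (subst nn_integral_cmult[symmetric]) (auto simp: ennreal_mult)
    also have "\<dots> \<le> ennreal k * ennreal (m powr (1 - p))" by (intro mult_left_mono size') simp
    finally show ?thesis using that by (simp add: ennreal_mult)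
  qed
  \<comment> \<open>with \<open>m\<close> the measure of the interval, cutting at height $t/m$ leaves a tail of integral at most $t^{1-p}$\<close>
  define t where "t = max 1 ((e / 2) powr (1 / (1 - p)))"
  define \<tau> where "\<tau> = t powr (1 - p)"
  have t: "t \<ge> 1" by (simp add: t_def)
  have \<tau>: "0 < \<tau>" "\<tau> \<le> 1" "\<tau> \<le> e / 2"
  proof -
    show "0 < \<tau>" using t by (simp add: \<tau>_def)
    have "t powr (1 - p) \<le> 1 powr (1 - p)" using t p by (intro powr_mono2') auto
    then show "\<tau> \<le> 1" by (simp add: \<tau>_def)
    have "t powr (1 - p) \<le> ((e / 2) powr (1 / (1 - p))) powr (1 - p)"
      using e p by (intro powr_mono2') (auto simp: t_def)
    also have "\<dots> = e / 2" using e p by (simp add: powr_powr)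
    finally show "\<tau> \<le> e / 2" by (simp add: \<tau>_def)
  qed
  define n where "n = t / m"
  have n: "n > 0" using t m by (simp add: n_def)
  define lo where "lo = (\<lambda>x. if cmod (b x) \<le> n then b x else 0)"
  have [measurable]: "lo \<in> borel_measurable (gam \<alpha>)" unfolding lo_def by measurable
  have hi: "nnorm1 \<alpha> (\<lambda>x. lo x - b x) \<le> ennreal \<tau>"
  proof -
    have "nnorm1 \<alpha> (\<lambda>x. lo x - b x) \<le> (\<integral>\<^sup>+x. ennreal (n powr (1 - p) * cmod (b x) powr p) \<partial>gam \<alpha>)"
      using n p powr_split[of n _ p] by (intro nn_integral_mono ennreal_leI) (auto simp: lo_def)
    also have "\<dots> \<le> ennreal (n powr (1 - p) * m powr (1 - p))" by (rule scaled) simp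
    also have "n powr (1 - p) * m powr (1 - p) = \<tau>"
      using n m by (simp add: \<tau>_def n_def flip: powr_mult)
    finally show ?thesis .
  qed
  \<comment> \<open>in place of the Hoelder inequality: $|b| \le 1/m$ or $|b| \le (1/m)^{1-p} |b|^p$\<close>
  have b1: "nnorm1 \<alpha> b \<le> 2"
  proof -
    have "nnorm1 \<alpha> b
      \<le> (\<integral>\<^sup>+x. ennreal (1 / m) * indicator I x + ennreal ((1 / m) powr (1 - p) * cmod (b x) powr p) \<partial>gam \<alpha>)"
    proof (rule nn_integral_mono)
      fix x assume x: "x \<in> space (gam \<alpha>)"
      show "ennreal (cmod (b x)) \<le> ennreal (1 / m) * indicator I x + ennreal ((1 / m) powr (1 - p) * cmod (b x) powr p)"
      proof (cases "x \<in> I")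
        case True
        have "cmod (b x) \<le> 1 / m + (1 / m) powr (1 - p) * cmod (b x) powr p"
          using m p powr_split[of "1 / m" "cmod (b x)" p]
          by (cases "1 / m \<le> cmod (b x)") (auto intro: add_increasing add_increasing2)
        then show ?thesis using True m by (auto simp flip: ennreal_plus intro!: ennreal_leI)
      qed (use off x in \<open>simp add: I_def\<close>)
    qed
    also have "\<dots> = ennreal (1 / m) * ennreal m + (\<integral>\<^sup>+x. ennreal ((1 / m) powr (1 - p) * cmod (b x) powr p) \<partial>gam \<alpha>)"
      by (subst nn_integral_add) (auto simp: nn_integral_cmult_indicator emI)
    also have "\<dots> \<le> ennreal (1 / m) * ennreal m + ennreal ((1 / m) powr (1 - p) * m powr (1 - p))"
      by (intro add_mono scaled) auto
    also have "\<dots> = ennreal 1 + ennreal 1"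
      using m by (simp flip: ennreal_mult powr_mult)
    finally show ?thesis by simp
  qed
  have bi: "integrable (gam \<alpha>) b"
    by (rule integrableI_bounded) (use b1 in \<open>auto intro: le_less_trans\<close>)
  have loi: "integrable (gam \<alpha>) lo"
    by (rule Bochner_Integration.integrable_bound[OF bi]) (auto simp: lo_def)
  define \<mu> where "\<mu> = (\<integral>x. lo x \<partial>gam \<alpha>) / m"
  have \<mu>: "cmod \<mu> \<le> \<tau> / m"
  proof -
    have "(\<integral>x. lo x \<partial>gam \<alpha>) = (\<integral>x. lo x - b x \<partial>gam \<alpha>)"
      using loi bi mean by simp
    also have "ennreal (cmod \<dots>) \<le> ennreal \<tau>"
      using loi bi by (intro order_trans[OF integral_norm_bound_ennreal hi]) auto
    finally have "cmod (\<integral>x. lo x \<partial>gam \<alpha>) \<le> \<tau>" using \<tau> by simp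
    then show ?thesis using m by (simp add: \<mu>_def norm_divide divide_right_mono)
  qed
  define g where "g = (\<lambda>x. lo x - (if x \<in> I then \<mu> else 0))"
  have [measurable]: "g \<in> borel_measurable (gam \<alpha>)" unfolding g_def by measurable
  have ind: "(if x \<in> I then \<mu> else 0) = indicator I x *\<^sub>R \<mu>" for x by auto
  have im: "(\<integral>x. (if x \<in> I then \<mu> else 0) \<partial>gam \<alpha>) = m *\<^sub>R \<mu>" 
    unfolding ind m_def by (subst integral_scaleR_left) (auto simp: less_top[symmetric] I_pos)
  have ii: "integrable (gam \<alpha>) (\<lambda>x. (if x \<in> I then \<mu> else 0))"
    unfolding ind by (intro integrable_scaleR_left) (auto simp: less_top[symmetric])
  have in1: "nnorm1 \<alpha> (\<lambda>x. if x \<in> I then \<mu> else 0) \<le> ennreal \<tau>"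
  proof -
    have "nnorm1 \<alpha> (\<lambda>x. if x \<in> I then \<mu> else 0) = (\<integral>\<^sup>+x. ennreal (cmod \<mu>) * indicator I x \<partial>gam \<alpha>)"
      by (intro nn_integral_cong) auto
    also have "\<dots> = ennreal (cmod \<mu>) * ennreal m" by (simp add: nn_integral_cmult_indicator emI)
    also have "\<dots> \<le> ennreal (\<tau> / m) * ennreal m" by (intro mult_right_mono ennreal_leI \<mu>) auto
    also have "\<dots> = ennreal \<tau>" using m \<tau> by (simp flip: ennreal_mult)
    finally show ?thesis .
  qed
  show thesis
  proof (rule that[of g "n + cmod \<mu>"])
    fix x :: real assume x: "x > 0"
    show "cmod (g x) \<le> n + cmod \<mu>"
      using n norm_triangle_ineq4[of "lo x" \<mu>] norm_ge_zero[of \<mu>]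
      by (auto simp: g_def lo_def simp del: norm_ge_zero split: if_splits)
    assume "x \<notin> ivl c r"
    then show "g x = 0" using off x by (simp add: g_def lo_def I_def)
  next
    show "(\<integral>x. g x \<partial>gam \<alpha>) = 0"
      unfolding g_def using loi ii m by (simp add: im) (simp add: \<mu>_def scaleR_conv_of_real)
  next
    have "nnorm1 \<alpha> (\<lambda>x. g x - b x)
      \<le> (\<integral>\<^sup>+x. ennreal (cmod (lo x - b x)) + ennreal (cmod (if x \<in> I then \<mu> else 0)) \<partial>gam \<alpha>)"
    proof (rule nn_integral_mono)
      fix x
      have "cmod (g x - b x) \<le> cmod (lo x - b x) + cmod (if x \<in> I then \<mu> else 0)"
        using norm_triangle_ineq4[of "lo x - b x" "if x \<in> I then \<mu> else 0"] by (simp add: g_def algebra_simps)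
      then show "ennreal (cmod (g x - b x)) \<le> ennreal (cmod (lo x - b x)) + ennreal (cmod (if x \<in> I then \<mu> else 0))"
        by (simp flip: ennreal_plus add: ennreal_leI)
    qed
    also have "\<dots> = nnorm1 \<alpha> (\<lambda>x. lo x - b x) + nnorm1 \<alpha> (\<lambda>x. if x \<in> I then \<mu> else 0)"
      by (rule nn_integral_add) measurable
    also have "\<dots> \<le> ennreal \<tau> + ennreal \<tau>" by (intro add_mono hi in1)
    also have "\<dots> \<le> ennreal e" using \<tau> by (simp flip: ennreal_plus add: ennreal_leI)
    finally show "nnorm1 \<alpha> (\<lambda>x. g x - b x) \<le> ennreal e" .
  next
    have "nnorm1 \<alpha> g
      \<le> (\<integral>\<^sup>+x. ennreal (cmod (b x)) + ennreal (cmod (if x \<in> I then \<mu> else 0)) \<partial>gam \<alpha>)"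
    proof (rule nn_integral_mono)
      fix x
      have "cmod (g x) \<le> cmod (lo x) + cmod (if x \<in> I then \<mu> else 0)"
        unfolding g_def by (rule norm_triangle_ineq4)
      also have "cmod (lo x) \<le> cmod (b x)" by (simp add: lo_def)
      finally show "ennreal (cmod (g x)) \<le> ennreal (cmod (b x)) + ennreal (cmod (if x \<in> I then \<mu> else 0))"
        by (simp flip: ennreal_plus add: ennreal_leI)
    qed
    also have "\<dots> = nnorm1 \<alpha> b + nnorm1 \<alpha> (\<lambda>x. if x \<in> I then \<mu> else 0)"
      by (rule nn_integral_add) measurable
    also have "\<dots> \<le> 2 + ennreal 1" using \<tau> by (intro add_mono b1 order_trans[OF in1]) auto
    finally show "nnorm1 \<alpha> g \<le> 3" by simp
  next
    have "(\<integral>\<^sup>+x. ennreal (cmod (g x) powr p) \<partial>gam \<alpha>)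
      \<le> (\<integral>\<^sup>+x. ennreal (2 powr p * cmod (b x) powr p) + ennreal (2 powr p * (1 / m) powr p) * indicator I x \<partial>gam \<alpha>)"
    proof (rule nn_integral_mono)
      fix x
      have "cmod (g x) \<le> cmod (lo x) + cmod (if x \<in> I then \<mu> else 0)"
        unfolding g_def by (rule norm_triangle_ineq4)
      also have "cmod (lo x) \<le> cmod (b x)" by (simp add: lo_def)
      also have "cmod (if x \<in> I then \<mu> else 0) \<le> (if x \<in> I then 1 / m else 0)"
        using order_trans[OF \<mu> divide_right_mono[of \<tau> 1 m]] \<tau> m by auto
      finally have "cmod (g x) powr p \<le> (cmod (b x) + (if x \<in> I then 1 / m else 0)) powr p"
        using p by (intro powr_mono2) auto
      also have "\<dots> \<le> 2 powr p * (cmod (b x) powr p + (if x \<in> I then 1 / m else 0) powr p)"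
        using m p by (intro powr_add_bound) auto
      finally show "ennreal (cmod (g x) powr p)
        \<le> ennreal (2 powr p * cmod (b x) powr p) + ennreal (2 powr p * (1 / m) powr p) * indicator I x"
        using m by (cases "x \<in> I") (auto simp flip: ennreal_plus intro!: ennreal_leI simp: distrib_left)
    qed
    also have "\<dots> = (\<integral>\<^sup>+x. ennreal (2 powr p * cmod (b x) powr p) \<partial>gam \<alpha>) + ennreal (2 powr p * (1 / m) powr p) * ennreal m"
      by (subst nn_integral_add) (auto simp: nn_integral_cmult_indicator emI)
    also have "\<dots> \<le> ennreal (2 powr p * m powr (1 - p)) + ennreal (2 powr p * (1 / m) powr p) * ennreal m"
      by (intro add_mono scaled) auto
    also have "ennreal (2 powr p * (1 / m) powr p) * ennreal m = ennreal (2 powr p * m powr (1 - p))"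
      using m by (simp add: powr_divide powr_diff flip: ennreal_mult)
    also have "ennreal (2 powr p * m powr (1 - p)) + ennreal (2 powr p * m powr (1 - p))
        = ennreal (2 powr (p + 1) * m powr (1 - p))"
      by (simp add: powr_add flip: ennreal_plus)
    finally show "(\<integral>\<^sup>+x. ennreal (cmod (g x) powr p) \<partial>gam \<alpha>)
       \<le> ennreal (2 powr (p + 1) * measure (gam \<alpha>) (ivl c r) powr (1 - p))"
      by (simp add: m_def I_def)
  qed simp
qed

context sublinear_op
begin

text \<open>
  For \<open>g\<close> near an atom, the estimates on and off the double interval are combined. With
  $s_0 = 1/\gamma_\alpha(I)$ all powers of $\gamma_\alpha(I)$ cancel and a bound independent
  of the atom remains. The constant atom is in $L^2$ and needs only the Cauchy-Schwarz
  inequality.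
\<close>

lemma atom_approx:
  assumes a: "a > 0" and q: "1 < q"
  obtains K where "K \<ge> 0"
    "\<And>b e. atom \<alpha> a q b \<Longrightarrow> e > 0 \<Longrightarrow> \<exists>g\<in>Lp \<alpha> 2.
       nnorm1 \<alpha> (\<lambda>x. g x - b x) \<le> ennreal e \<and> (\<integral>\<^sup>+x. ennreal (U g x) \<partial>gam \<alpha>) \<le> ennreal K"
proof -
  define p where "p = (if q = \<infinity> then 2 else real_of_ereal q)"
  have p: "p > 1" using q by (cases q) (auto simp: p_def one_ereal_def)
  obtain M :: nat where M: "regular (\<lambda>x y. (y, x)) a (of_nat M * B)"
    using regular_adm[OF _ reg2] by blast
  define b0 where "b0 = enn2real (of_nat M * B)"
  have b0: "ennreal b0 = of_nat M * B" "b0 \<ge> 0"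
    using B_finite by (auto simp: b0_def ennreal_mult_less_top less_top[symmetric] ennreal_mult_eq_top_iff of_nat_less_top)
  obtain Cd where Cd: "Cd \<ge> 1"
    "\<And>c r. (c, r) \<in> adm a \<Longrightarrow> measure (gam \<alpha>) (ivl c (2 * r)) \<le> Cd * measure (gam \<alpha>) (ivl c r)"
    using gam_doubling[OF alpha a] by blast
  define m0 where "m0 = measure (gam \<alpha>) (space (gam \<alpha>))"
  define K1 where "K1 = Cd + (4 * A * 3 + 2 * C / (p - 1) * 2 powr (p + 1)) + b0 * 3"
  \<comment> \<open>\<open>K1\<close> is for the atoms living on an interval, the other term for the constant atom\<close>
  define K where "K = K1 + sqrt A * m0"
  have K: "K1 \<ge> 0" "K \<ge> 0" using Cd A_nonneg C_nonneg p b0 by (simp_all add: K1_def K_def m0_def)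
  show thesis
  proof (rule that[OF K(2)])
    fix b :: "real \<Rightarrow> complex" and e :: real assume atom: "atom \<alpha> a q b" and e: "e > 0"
    have bm [measurable]: "b \<in> borel_measurable (gam \<alpha>)" using atom by (simp add: atom_def)
    from atom_cases[OF alpha atom q, folded p_def]
    show "\<exists>g\<in>Lp \<alpha> 2. nnorm1 \<alpha> (\<lambda>x. g x - b x) \<le> ennreal e \<and> (\<integral>\<^sup>+x. ennreal (U g x) \<partial>gam \<alpha>) \<le> ennreal K"
    proof
      assume 1: "\<forall>x>0. b x = 1"
      have b: "b \<in> Lp \<alpha> 2" using 1 by (intro bounded_Lp2[OF alpha bm, of 1]) (auto intro!: AE_I2)
      have UbL: "U b \<in> Lp \<alpha> 2"
        using U_meas[OF b] U_L2[OF b] b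
        by (auto simp: Lp2_iff intro: le_less_trans simp: ennreal_mult_less_top)
      have b2: "nnorm2 \<alpha> b = ennreal m0"
      proof -
        have "nnorm2 \<alpha> b = (\<integral>\<^sup>+x. 1 \<partial>gam \<alpha>)"
          using 1 by (intro nn_integral_cong) auto
        then show ?thesis by (simp add: emeasure_eq_measure m0_def)
      qed
      have "(\<integral>\<^sup>+x\<in>{0<..}. ennreal (norm (U b x)) \<partial>gam \<alpha>)\<^sup>2
        \<le> emeasure (gam \<alpha>) {0<..} * nnorm2 \<alpha> (U b)"
        by (rule nn_integral_le_sqrt[OF UbL]) (simp add: sets_gam_iff)
      also have "\<dots> \<le> ennreal m0 * (ennreal A * ennreal m0)"
        using U_L2[OF b] b2 by (intro mult_mono) (auto simp: emeasure_eq_measure m0_def)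
      also have "\<dots> = (ennreal (sqrt A * m0))\<^sup>2"
      proof -
        have "m0 * (A * m0) = (sqrt A * m0)\<^sup>2"
          using A_nonneg by (simp add: power_mult_distrib power2_eq_square[of m0])
        then show ?thesis
          using A_nonneg by (simp add: ennreal_power m0_def flip: ennreal_mult)
      qed
      finally have "(\<integral>\<^sup>+x\<in>{0<..}. ennreal (norm (U b x)) \<partial>gam \<alpha>) \<le> ennreal (sqrt A * m0)"
        by (rule ennreal_power2_le)
      moreover have "(\<integral>\<^sup>+x. ennreal (U b x) \<partial>gam \<alpha>) \<le> (\<integral>\<^sup>+x\<in>{0<..}. ennreal (norm (U b x)) \<partial>gam \<alpha>)"
        by (intro nn_integral_mono) (auto intro!: ennreal_leI)
      ultimately have "(\<integral>\<^sup>+x. ennreal (U b x) \<partial>gam \<alpha>) \<le> ennreal (sqrt A * m0)" by simp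
      also have "\<dots> \<le> ennreal K" using K by (intro ennreal_leI) (simp add: K_def)
      finally show ?thesis using b by (intro bexI[of _ b]) auto
    next
      assume "\<exists>(c, r)\<in>adm a. (\<forall>x>0. x \<notin> ivl c r \<longrightarrow> b x = 0) \<and>
       (\<integral>\<^sup>+x. ennreal (cmod (b x) powr p) \<partial>gam \<alpha>) \<le> ennreal (measure (gam \<alpha>) (ivl c r) powr (1 - p)) \<and>
       (\<integral>x. b x \<partial>gam \<alpha>) = 0"
      then obtain c r where adm: "(c, r) \<in> adm a" and off: "\<And>x. x > 0 \<Longrightarrow> x \<notin> ivl c r \<Longrightarrow> b x = 0"
        and size: "(\<integral>\<^sup>+x. ennreal (cmod (b x) powr p) \<partial>gam \<alpha>) \<le> ennreal (measure (gam \<alpha>) (ivl c r) powr (1 - p))"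
        and mean: "(\<integral>x. b x \<partial>gam \<alpha>) = 0" by blast
      obtain g L where g: "g \<in> borel_measurable (gam \<alpha>)" "\<And>x. x > 0 \<Longrightarrow> cmod (g x) \<le> L"
        "\<And>x. x > 0 \<Longrightarrow> x \<notin> ivl c r \<Longrightarrow> g x = 0" "(\<integral>x. g x \<partial>gam \<alpha>) = 0"
        "nnorm1 \<alpha> (\<lambda>x. g x - b x) \<le> ennreal e"
        "nnorm1 \<alpha> g \<le> 3"
        "(\<integral>\<^sup>+x. ennreal (cmod (g x) powr p) \<partial>gam \<alpha>)
           \<le> ennreal (2 powr (p + 1) * measure (gam \<alpha>) (ivl c r) powr (1 - p))"
        by (rule atom_truncation[OF alpha adm bm off size mean p e]) blast+
      have gL: "g \<in> Lp \<alpha> 2"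
        using g(2) by (intro bounded_Lp2[OF alpha g(1), of L]) (auto intro!: AE_I2)
      have [measurable]: "U g \<in> borel_measurable (gam \<alpha>)" by (rule U_meas[OF gL])
      define m where "m = measure (gam \<alpha>) (ivl c r)"
      have m: "m > 0" using measure_ivl_pos[OF alpha adm] by (simp add: m_def)
      define J where "J = ivl c (2 * r)"
      have J [measurable]: "J \<in> sets (gam \<alpha>)" "{0<..} - J \<in> sets (gam \<alpha>)"
        by (auto simp: J_def sets_gam_iff ivl_def)
      have "(\<integral>\<^sup>+x. ennreal (U g x) \<partial>gam \<alpha>)
        = (\<integral>\<^sup>+x. ennreal (U g x) * indicator J x + ennreal (U g x) * indicator ({0<..} - J) x \<partial>gam \<alpha>)"
        by (intro nn_integral_cong) (auto split: split_indicator)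
      also have "\<dots> = (\<integral>\<^sup>+x\<in>J. ennreal (U g x) \<partial>gam \<alpha>) + (\<integral>\<^sup>+x\<in>{0<..} - J. ennreal (U g x) \<partial>gam \<alpha>)"
        by (rule nn_integral_add) measurable
      also have "(\<integral>\<^sup>+x\<in>{0<..} - J. ennreal (U g x) \<partial>gam \<alpha>) \<le> ennreal b0 * ennreal 3"
      proof -
        have "(\<integral>\<^sup>+x\<in>{0<..} - J. ennreal (U g x) \<partial>gam \<alpha>) \<le> of_nat M * B * nnorm1 \<alpha> g"
          unfolding J_def by (rule U_integral_away[OF adm M g(1,2,3,4)])
        also have "\<dots> \<le> ennreal b0 * ennreal 3" unfolding b0(1) using g(6) by (intro mult_left_mono) auto
        finally show ?thesis .
      qed
      also have "(\<integral>\<^sup>+x\<in>J. ennreal (U g x) \<partial>gam \<alpha>) \<le> ennreal (1 / m) * emeasure (gam \<alpha>) J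
        + (ennreal (4 * A) * nnorm1 \<alpha> g
        + ennreal (2 * C / (p - 1)) * (ennreal ((1 / m) powr (1 - p)) * (\<integral>\<^sup>+x. ennreal (cmod (g x) powr p) \<partial>gam \<alpha>)))"
        using m by (intro U_integral_near gL J p) simp
      also have "\<dots> \<le> ennreal (1 / m) * ennreal (Cd * m) + (ennreal (4 * A) * ennreal 3
        + ennreal (2 * C / (p - 1)) * (ennreal ((1 / m) powr (1 - p)) * ennreal (2 powr (p + 1) * m powr (1 - p))))"
        using Cd(2)[OF adm] g(6,7)
        by (intro add_mono mult_left_mono) (auto simp: emeasure_eq_measure J_def m_def ennreal_leI)
      also have "ennreal (1 / m) * ennreal (Cd * m) = ennreal Cd"
        using m Cd(1) by (simp flip: ennreal_mult)
      also have "ennreal ((1 / m) powr (1 - p)) * ennreal (2 powr (p + 1) * m powr (1 - p)) = ennreal (2 powr (p + 1))"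
      proof -
        have "(1 / m) powr (1 - p) * (2 powr (p + 1) * m powr (1 - p)) = 2 powr (p + 1) * ((1 / m) powr (1 - p) * m powr (1 - p))"
          by simp
        also have "(1 / m) powr (1 - p) * m powr (1 - p) = 1" using m by (simp flip: powr_mult)
        finally show ?thesis by (simp flip: ennreal_mult)
      qed
      also have "ennreal Cd + (ennreal (4 * A) * ennreal 3 + ennreal (2 * C / (p - 1)) * ennreal (2 powr (p + 1)))
          + ennreal b0 * ennreal 3 = ennreal K1"
      proof -
        have "0 \<le> 2 * C / (p - 1)" "0 \<le> 4 * A" "0 \<le> b0" "0 \<le> Cd" using C_nonneg p A_nonneg b0 Cd by auto
        then show ?thesis
          unfolding K1_def by (simp only: ennreal_mult[symmetric] ennreal_plus[symmetric] mult_nonneg_nonneg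
            add_nonneg_nonneg powr_ge_zero zero_le_numeral)
      qed
      also have "\<dots> \<le> ennreal K" using A_nonneg by (intro ennreal_leI) (simp add: K_def m0_def)
      finally have "(\<integral>\<^sup>+x. ennreal (U g x) \<partial>gam \<alpha>) \<le> ennreal K" by (simp add: add_mono)
      then show ?thesis using gL g(5) by blast
    qed
  qed
qed

end

section \<open>The extension to integrable functions\<close>

lemma AE_le_zeroI:
  fixes w :: "real \<Rightarrow> real"
  assumes w: "w \<in> borel_measurable (gam \<alpha>)" and 0: "\<And>s. s > 0 \<Longrightarrow> emeasure (gam \<alpha>) {x \<in> {0<..}. s < w x} = 0"
  shows "AE x in gam \<alpha>. w x \<le> 0"
proof -
  have "AE x in gam \<alpha>. w x \<le> 1 / real (Suc n)" for n
    by (rule AE_I'[of "{x \<in> {0<..}. 1 / real (Suc n) < w x}"])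
      (use 0[of "1 / real (Suc n)"] gt_sets[OF w] in \<open>auto simp: null_sets_def\<close>)
  then have "AE x in gam \<alpha>. \<forall>n. w x \<le> 1 / real (Suc n)" by (simp add: AE_all_countable)
  then show ?thesis
  proof eventually_elim
    case (elim x)
    show ?case
      by (rule LIMSEQ_le_const[OF LIMSEQ_inverse_real_of_nat]) (use elim in \<open>auto simp: inverse_eq_divide\<close>)
  qed
qed

lemma L1_approx:
  fixes f :: "real \<Rightarrow> complex"
  assumes \<alpha>: "\<alpha> > - 1 / 2" and f: "f \<in> Lp \<alpha> 1" and e: "e > 0"
  shows "\<exists>h\<in>Lp \<alpha> 2. nnorm1 \<alpha> (\<lambda>x. h x - f x) \<le> ennreal e"
proof -
  have [measurable]: "f \<in> borel_measurable (gam \<alpha>)" using f by (simp add: Lp1_iff)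
  define h where "h n x = (if cmod (f x) \<le> real n then f x else 0)" for n x
  have [measurable]: "h n \<in> borel_measurable (gam \<alpha>)" for n unfolding h_def by measurable
  have h: "h n \<in> Lp \<alpha> 2" for n
    by (rule bounded_Lp2[OF \<alpha>, of _ "real n"]) (auto simp: h_def)
  have "(\<lambda>n. \<integral>\<^sup>+x. ennreal (cmod (h n x - f x)) \<partial>gam \<alpha>) \<longlonglongrightarrow> (\<integral>\<^sup>+x. 0 \<partial>gam \<alpha>)"
  proof (rule nn_integral_dominated_convergence[where w = "\<lambda>x. ennreal (cmod (f x))"])
    show "AE x in gam \<alpha>. (\<lambda>n. ennreal (cmod (h n x - f x))) \<longlonglongrightarrow> 0"
    proof (rule AE_I2)
      fix x
      have "eventually (\<lambda>n. ennreal (cmod (h n x - f x)) = 0) sequentially"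
        using eventually_ge_at_top[of "nat \<lceil>cmod (f x)\<rceil>"]
      proof eventually_elim
        case (elim n)
        then have "cmod (f x) \<le> real n" by linarith
        then show ?case by (simp add: h_def)
      qed
      then show "(\<lambda>n. ennreal (cmod (h n x - f x))) \<longlonglongrightarrow> 0" by (rule tendsto_eventually)
    qed
  qed (use f in \<open>auto simp: h_def Lp1_iff intro!: AE_I2\<close>)
  then have "(\<lambda>n. \<integral>\<^sup>+x. ennreal (cmod (h n x - f x)) \<partial>gam \<alpha>) \<longlonglongrightarrow> 0" by simp
  then have "eventually (\<lambda>n. nnorm1 \<alpha> (\<lambda>x. h n x - f x) < ennreal e) sequentially"
    using e by (intro order_tendstoD) auto
  then obtain n where "nnorm1 \<alpha> (\<lambda>x. h n x - f x) < ennreal e"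
    by (auto simp: eventually_sequentially)
  then show ?thesis using h[of n] by (intro bexI[of _ "h n"]) auto
qed

lemma nn_integral_cmod_triangle:
  fixes f g h :: "real \<Rightarrow> complex"
  assumes [measurable]: "f \<in> borel_measurable M" "g \<in> borel_measurable M" "h \<in> borel_measurable M"
  shows "(\<integral>\<^sup>+x. ennreal (cmod (f x - h x)) \<partial>M)
    \<le> (\<integral>\<^sup>+x. ennreal (cmod (f x - g x)) \<partial>M) + (\<integral>\<^sup>+x. ennreal (cmod (g x - h x)) \<partial>M)"
proof -
  have "cmod (f x - h x) \<le> cmod (f x - g x) + cmod (g x - h x)" for x
    using norm_triangle_ineq[of "f x - g x" "g x - h x"] by simp
  then have "(\<integral>\<^sup>+x. ennreal (cmod (f x - h x)) \<partial>M)
     \<le> (\<integral>\<^sup>+x. ennreal (cmod (f x - g x)) + ennreal (cmod (g x - h x)) \<partial>M)"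
    by (intro nn_integral_mono) (simp flip: ennreal_plus add: ennreal_leI)
  also have "\<dots> = (\<integral>\<^sup>+x. ennreal (cmod (f x - g x)) \<partial>M) + (\<integral>\<^sup>+x. ennreal (cmod (g x - h x)) \<partial>M)"
    by (rule nn_integral_add) measurable
  finally show ?thesis .
qed

context sublinear_op
begin

text \<open>
  The function \<open>u\<close> is the value at \<open>f\<close> of the extension of \<open>U\<close> by continuity, from $L^1$ to
  convergence in measure. The inequality is the one that \<open>u = U f\<close> satisfies for square
  integrable \<open>f\<close>, by the weak bound for $h-f$.
\<close>

definition limit_of :: "(real \<Rightarrow> complex) \<Rightarrow> (real \<Rightarrow> real) \<Rightarrow> bool" where
  "limit_of f u \<longleftrightarrow> u \<in> borel_measurable (gam \<alpha>) \<and>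
     (\<forall>h\<in>Lp \<alpha> 2. \<forall>s>0. emeasure (gam \<alpha>) {x \<in> {0<..}. s < \<bar>U h x - u x\<bar>}
        \<le> ennreal (C / s) * nnorm1 \<alpha> (\<lambda>x. h x - f x))"

lemma limit_of_meas: "limit_of f u \<Longrightarrow> u \<in> borel_measurable (gam \<alpha>)"
  by (simp add: limit_of_def)

lemma limit_ofD:
  "limit_of f u \<Longrightarrow> h \<in> Lp \<alpha> 2 \<Longrightarrow> s > 0 \<Longrightarrow> emeasure (gam \<alpha>) {x \<in> {0<..}. s < \<bar>U h x - u x\<bar>}
        \<le> ennreal (C / s) * nnorm1 \<alpha> (\<lambda>x. h x - f x)"
  by (simp add: limit_of_def)

lemma U_diff_weak:
  assumes f: "f \<in> Lp \<alpha> 2" and g: "g \<in> Lp \<alpha> 2" and s: "s > 0"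
  shows "emeasure (gam \<alpha>) {x \<in> {0<..}. s < \<bar>U f x - U g x\<bar>}
    \<le> ennreal (C / s) * nnorm1 \<alpha> (\<lambda>x. f x - g x)"
proof -
  have fg: "(\<lambda>y. f y - g y) \<in> Lp \<alpha> 2" by (rule Lp2_diff[OF f g])
  have "emeasure (gam \<alpha>) {x \<in> {0<..}. s < \<bar>U f x - U g x\<bar>}
    \<le> emeasure (gam \<alpha>) {x \<in> {0<..}. s < U (\<lambda>y. f y - g y) x}"
    using U_diff[OF f g]
    by (intro emeasure_mono_AE gt_sets U_meas fg) (auto elim!: eventually_mono)
  also have "\<dots> \<le> ennreal (C / s) * nnorm1 \<alpha> (\<lambda>x. f x - g x)"
    by (rule U_weak[OF fg s])
  finally show ?thesis .
qed

lemma limit_of_self: "f \<in> Lp \<alpha> 2 \<Longrightarrow> limit_of f (U f)"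
  unfolding limit_of_def by (intro conjI ballI allI impI U_meas U_diff_weak)

lemma limit_of_cong:
  assumes "limit_of f u" "AE x in gam \<alpha>. f x = g x"
  shows "limit_of g u"
proof -
  have "nnorm1 \<alpha> (\<lambda>x. h x - f x) = nnorm1 \<alpha> (\<lambda>x. h x - g x)" for h
    using assms(2) by (intro nn_integral_cong_AE) (auto elim!: eventually_mono)
  then show ?thesis using assms(1) by (simp add: limit_of_def)
qed

lemma small_tail:
  assumes "s > 0" "e > 0"
  obtains \<delta> where "\<delta> > 0" "C / s * \<delta> \<le> e"
proof
  show "e * s / (C + 1) > 0" using assms C_nonneg by simp
  have "C * e \<le> (C + 1) * e" using assms by (intro mult_right_mono) auto
  then show "C / s * (e * s / (C + 1)) \<le> e" using assms C_nonneg by (simp add: field_simps)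
qed

lemma limit_of_close:
  assumes f: "f \<in> Lp \<alpha> 1" and u: "limit_of f u" and s: "s > 0" and e: "e > 0"
  obtains \<delta> where "\<delta> > 0" "\<And>h. h \<in> Lp \<alpha> 2 \<Longrightarrow> nnorm1 \<alpha> (\<lambda>x. h x - f x) \<le> ennreal \<delta> \<Longrightarrow>
    emeasure (gam \<alpha>) {x \<in> {0<..}. s < \<bar>U h x - u x\<bar>} \<le> ennreal e"
proof -
  obtain \<delta> where \<delta>: "\<delta> > 0" "C / s * \<delta> \<le> e" using small_tail[OF s e] .
  have "emeasure (gam \<alpha>) {x \<in> {0<..}. s < \<bar>U h x - u x\<bar>} \<le> ennreal e"
    if h: "h \<in> Lp \<alpha> 2" "nnorm1 \<alpha> (\<lambda>x. h x - f x) \<le> ennreal \<delta>" for h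
  proof -
    have "emeasure (gam \<alpha>) {x \<in> {0<..}. s < \<bar>U h x - u x\<bar>} \<le> ennreal (C / s) * ennreal \<delta>"
      using h by (intro order_trans[OF limit_ofD[OF u h(1) s]] mult_left_mono) auto
    also have "\<dots> \<le> ennreal e"
      using \<delta> C_nonneg s by (simp flip: ennreal_mult add: ennreal_leI)
    finally show ?thesis .
  qed
  with \<delta> show thesis using that by blast
qed

text \<open>
  Where all three of $Uh_1$, $Uh_2$ and $U(h_1+h_2)$ are within $s/3$ of their limits, the
  inequality for \<open>U\<close> holds for the limits up to \<open>s\<close>. The exceptional set has arbitrarily small
  measure.
\<close>

lemma limit_of_sublinear:
  assumes f: "f \<in> Lp \<alpha> 1" and g: "g \<in> Lp \<alpha> 1"
    and u: "limit_of f u" and v: "limit_of g v" and w: "limit_of (\<lambda>x. f x + g x) w"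
  shows "AE x in gam \<alpha>. w x \<le> u x + v x"
proof -
  have [measurable]: "u \<in> borel_measurable (gam \<alpha>)" "v \<in> borel_measurable (gam \<alpha>)" "w \<in> borel_measurable (gam \<alpha>)"
    using u v w by (auto intro: limit_of_meas)
  have [measurable]: "f \<in> borel_measurable (gam \<alpha>)" "g \<in> borel_measurable (gam \<alpha>)"
    using f g by (auto simp: Lp1_iff)
  have fg: "(\<lambda>x. f x + g x) \<in> Lp \<alpha> 1" using f g by (simp add: Lp1_integrable)
  have "AE x in gam \<alpha>. w x - (u x + v x) \<le> 0"
  proof (rule AE_le_zeroI)
    fix s :: real assume s: "s > 0"
    then have s3: "s / 3 > 0" by simp
    have "emeasure (gam \<alpha>) {x \<in> {0<..}. s < w x - (u x + v x)} \<le> 0 + ennreal e" if e: "e > 0" for e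
    proof -
      have e3: "e / 3 > 0" using e by simp
      obtain d1 where d1: "d1 > 0" "\<And>h. h \<in> Lp \<alpha> 2 \<Longrightarrow> nnorm1 \<alpha> (\<lambda>x. h x - f x) \<le> ennreal d1 \<Longrightarrow>
        emeasure (gam \<alpha>) {x \<in> {0<..}. s / 3 < \<bar>U h x - u x\<bar>} \<le> ennreal (e / 3)"
        using limit_of_close[OF f u s3 e3] by blast
      obtain d2 where d2: "d2 > 0" "\<And>h. h \<in> Lp \<alpha> 2 \<Longrightarrow> nnorm1 \<alpha> (\<lambda>x. h x - g x) \<le> ennreal d2 \<Longrightarrow>
        emeasure (gam \<alpha>) {x \<in> {0<..}. s / 3 < \<bar>U h x - v x\<bar>} \<le> ennreal (e / 3)"
        using limit_of_close[OF g v s3 e3] by blast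
      obtain d3 where d3: "d3 > 0" "\<And>h. h \<in> Lp \<alpha> 2 \<Longrightarrow> nnorm1 \<alpha> (\<lambda>x. h x - (f x + g x)) \<le> ennreal d3 \<Longrightarrow>
        emeasure (gam \<alpha>) {x \<in> {0<..}. s / 3 < \<bar>U h x - w x\<bar>} \<le> ennreal (e / 3)"
        using limit_of_close[OF fg w s3 e3] by blast
      define d where "d = min (min d1 d2) (d3 / 2)"
      have d: "d > 0" "d \<le> d1" "d \<le> d2" "2 * d \<le> d3" using d1 d2 d3 by (auto simp: d_def min_def)
      obtain h1 where h1: "h1 \<in> Lp \<alpha> 2" "nnorm1 \<alpha> (\<lambda>x. h1 x - f x) \<le> ennreal d"
        using L1_approx[OF alpha f d(1)] by blast
      obtain h2 where h2: "h2 \<in> Lp \<alpha> 2" "nnorm1 \<alpha> (\<lambda>x. h2 x - g x) \<le> ennreal d"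
        using L1_approx[OF alpha g d(1)] by blast
      have [measurable]: "h1 \<in> borel_measurable (gam \<alpha>)" "h2 \<in> borel_measurable (gam \<alpha>)"
        using h1 h2 by (auto simp: Lp2_iff)
      define h where "h = (\<lambda>x. h1 x + h2 x)"
      have h: "h \<in> Lp \<alpha> 2" unfolding h_def by (rule Lp2_add[OF h1(1) h2(1)])
      have [measurable]: "U h1 \<in> borel_measurable (gam \<alpha>)" "U h2 \<in> borel_measurable (gam \<alpha>)" "U h \<in> borel_measurable (gam \<alpha>)"
        using h1 h2 h by (auto intro: U_meas)
      have "nnorm1 \<alpha> (\<lambda>x. h x - (f x + g x))
          \<le> (\<integral>\<^sup>+x. ennreal (cmod (h1 x - f x)) + ennreal (cmod (h2 x - g x)) \<partial>gam \<alpha>)"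
      proof (rule nn_integral_mono)
        fix x
        have "cmod (h x - (f x + g x)) \<le> cmod (h1 x - f x) + cmod (h2 x - g x)"
          using norm_triangle_ineq[of "h1 x - f x" "h2 x - g x"] by (simp add: h_def algebra_simps)
        then show "ennreal (cmod (h x - (f x + g x))) \<le> ennreal (cmod (h1 x - f x)) + ennreal (cmod (h2 x - g x))"
          by (simp flip: ennreal_plus add: ennreal_leI)
      qed
      also have "\<dots> = nnorm1 \<alpha> (\<lambda>x. h1 x - f x) + nnorm1 \<alpha> (\<lambda>x. h2 x - g x)"
        by (rule nn_integral_add) measurable
      also have "\<dots> \<le> ennreal d + ennreal d" by (intro add_mono h1 h2)
      also have "\<dots> \<le> ennreal d3" using d by (simp flip: ennreal_plus add: ennreal_leI)
      finally have h3: "nnorm1 \<alpha> (\<lambda>x. h x - (f x + g x)) \<le> ennreal d3" .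
      let ?A = "{x \<in> {0<..}. s / 3 < \<bar>U h1 x - u x\<bar>}" and ?B = "{x \<in> {0<..}. s / 3 < \<bar>U h2 x - v x\<bar>}"
        and ?C = "{x \<in> {0<..}. s / 3 < \<bar>U h x - w x\<bar>}"
      have S: "?A \<in> sets (gam \<alpha>)" "?B \<in> sets (gam \<alpha>)" "?C \<in> sets (gam \<alpha>)"
        by (intro gt_sets; measurable)+
      have "AE x in gam \<alpha>. U h x \<le> U h1 x + U h2 x" unfolding h_def by (rule U_add[OF h1(1) h2(1)])
      then have "emeasure (gam \<alpha>) {x \<in> {0<..}. s < w x - (u x + v x)} \<le> emeasure (gam \<alpha>) (?A \<union> ?B \<union> ?C)"
      proof (intro emeasure_mono_AE)
        assume "AE x in gam \<alpha>. U h x \<le> U h1 x + U h2 x"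
        then show "AE x in gam \<alpha>. x \<in> {x \<in> {0<..}. s < w x - (u x + v x)} \<longrightarrow> x \<in> ?A \<union> ?B \<union> ?C"
        proof eventually_elim
          case (elim x)
          have "s / 3 < \<bar>U h1 x - u x\<bar> \<or> s / 3 < \<bar>U h2 x - v x\<bar> \<or> s / 3 < \<bar>U h x - w x\<bar>"
            if "s < w x - (u x + v x)"
            using elim that by linarith
          then show ?case by auto
        qed
      qed (use S in auto)
      also have "\<dots> \<le> emeasure (gam \<alpha>) ?A + emeasure (gam \<alpha>) ?B + emeasure (gam \<alpha>) ?C"
        using S by (intro order_trans[OF emeasure_subadditive] add_mono emeasure_subadditive) auto
      also have "\<dots> \<le> ennreal (e / 3) + ennreal (e / 3) + ennreal (e / 3)"
        using d by (intro add_mono d1(2) d2(2) d3(2) h1(1) h2(1) h h3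
          order_trans[OF h1(2)] order_trans[OF h2(2)] ennreal_leI)
      also have "\<dots> = ennreal e" using e by (simp flip: ennreal_plus)
      finally show ?thesis by simp
    qed
    then have "emeasure (gam \<alpha>) {x \<in> {0<..}. s < w x - (u x + v x)} \<le> 0"
      by (rule ennreal_le_epsilon)
    then show "emeasure (gam \<alpha>) {x \<in> {0<..}. s < w x - (u x + v x)} = 0" by simp
  qed measurable
  then show ?thesis by eventually_elim simp
qed

lemma zero_L2: "(\<lambda>x. 0) \<in> Lp \<alpha> 2"
  by (simp add: Lp2_iff)

lemma U_zero: "AE x in gam \<alpha>. U (\<lambda>x. 0) x = 0"
  using U_cmult[OF zero_L2, of 0] by simp

lemma limit_of_zero: "limit_of (\<lambda>x. 0) (\<lambda>x. 0)"
  unfolding limit_of_def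
proof (intro conjI ballI allI impI)
  fix h :: "real \<Rightarrow> complex" and s :: real assume h: "h \<in> Lp \<alpha> 2" and s: "s > 0"
  have "emeasure (gam \<alpha>) {x \<in> {0<..}. s < \<bar>U h x - 0\<bar>} \<le> emeasure (gam \<alpha>) {x \<in> {0<..}. s < U h x}"
    using U_nonneg[OF h] by (intro emeasure_mono_AE gt_sets U_meas h) (auto elim!: eventually_mono)
  also have "\<dots> \<le> ennreal (C / s) * nnorm1 \<alpha> (\<lambda>x. h x - 0)"
    using U_weak[OF h s] by simp
  finally show "emeasure (gam \<alpha>) {x \<in> {0<..}. s < \<bar>U h x - 0\<bar>} \<le> \<dots>" .
qed simp

text \<open>
  Uniqueness is sublinearity applied to the sum $f+0$, in both directions.
\<close>

lemma limit_of_unique: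
  assumes f: "f \<in> Lp \<alpha> 1" and u: "limit_of f u" and v: "limit_of f v"
  shows "AE x in gam \<alpha>. u x = v x"
proof -
  have z: "(\<lambda>x. 0) \<in> Lp \<alpha> 1" by (simp add: Lp1_iff)
  have 1: "AE x in gam \<alpha>. u x \<le> v x + 0"
    using u by (intro limit_of_sublinear[OF f z v limit_of_zero]) simp
  have 2: "AE x in gam \<alpha>. v x \<le> u x + 0"
    using v by (intro limit_of_sublinear[OF f z u limit_of_zero]) simp
  from 1 2 show ?thesis by eventually_elim simp
qed

text \<open>
  Since $Uh \ge 0$, the absolute value of a limit is a limit too.
\<close>

lemma limit_of_nonneg:
  assumes f: "f \<in> Lp \<alpha> 1" and u: "limit_of f u"
  shows "AE x in gam \<alpha>. 0 \<le> u x"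
proof -
  have [measurable]: "u \<in> borel_measurable (gam \<alpha>)" using u by (rule limit_of_meas)
  have "limit_of f (\<lambda>x. \<bar>u x\<bar>)"
    unfolding limit_of_def
  proof (intro conjI ballI allI impI)
    fix h :: "real \<Rightarrow> complex" and s :: real assume h: "h \<in> Lp \<alpha> 2" and s: "s > 0"
    have [measurable]: "U h \<in> borel_measurable (gam \<alpha>)" by (rule U_meas[OF h])
    have "emeasure (gam \<alpha>) {x \<in> {0<..}. s < \<bar>U h x - \<bar>u x\<bar>\<bar>} \<le> emeasure (gam \<alpha>) {x \<in> {0<..}. s < \<bar>U h x - u x\<bar>}"
    proof (intro emeasure_mono_AE gt_sets)
      show "AE x in gam \<alpha>. x \<in> {x \<in> {0<..}. s < \<bar>U h x - \<bar>u x\<bar>\<bar>} \<longrightarrow> x \<in> {x \<in> {0<..}. s < \<bar>U h x - u x\<bar>}"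
        using U_nonneg[OF h] by eventually_elim auto
    qed measurable
    also have "\<dots> \<le> ennreal (C / s) * nnorm1 \<alpha> (\<lambda>x. h x - f x)"
      by (rule limit_ofD[OF u h s])
    finally show "emeasure (gam \<alpha>) {x \<in> {0<..}. s < \<bar>U h x - \<bar>u x\<bar>\<bar>} \<le> \<dots>" .
  qed measurable
  from limit_of_unique[OF f u this] show ?thesis by eventually_elim simp
qed

lemma limit_of_cmult:
  assumes f: "f \<in> Lp \<alpha> 1" and u: "limit_of f u"
  shows "limit_of (\<lambda>x. c * f x) (\<lambda>x. cmod c * u x)"
proof (cases "c = 0")
  case False
  have [measurable]: "u \<in> borel_measurable (gam \<alpha>)" using u by (rule limit_of_meas)
  show ?thesis
    unfolding limit_of_def
  proof (intro conjI ballI allI impI)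
    fix h :: "real \<Rightarrow> complex" and s :: real assume h: "h \<in> Lp \<alpha> 2" and s: "s > 0"
    have hm [measurable]: "h \<in> borel_measurable (gam \<alpha>)" using h by (simp add: Lp2_iff)
    define k where "k = (\<lambda>x. (1 / c) * h x)"
    have k: "k \<in> Lp \<alpha> 2" unfolding k_def by (rule Lp2_cmult[OF h])
    have ck: "(\<lambda>x. c * k x) = h" using False by (simp add: k_def)
    have [measurable]: "U k \<in> borel_measurable (gam \<alpha>)" by (rule U_meas[OF k])
    have sc: "s / cmod c > 0" using s False by simp
    have "AE x in gam \<alpha>. U h x = cmod c * U k x" using U_cmult[OF k, of c] by (simp add: ck)
    then have "emeasure (gam \<alpha>) {x \<in> {0<..}. s < \<bar>U h x - cmod c * u x\<bar>}
      \<le> emeasure (gam \<alpha>) {x \<in> {0<..}. s / cmod c < \<bar>U k x - u x\<bar>}"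
    proof (intro emeasure_mono_AE gt_sets)
      assume "AE x in gam \<alpha>. U h x = cmod c * U k x"
      then show "AE x in gam \<alpha>. x \<in> {x \<in> {0<..}. s < \<bar>U h x - cmod c * u x\<bar>} \<longrightarrow>
          x \<in> {x \<in> {0<..}. s / cmod c < \<bar>U k x - u x\<bar>}"
      proof eventually_elim
        case (elim x)
        have "\<bar>U h x - cmod c * u x\<bar> = cmod c * \<bar>U k x - u x\<bar>"
          unfolding elim by (simp flip: right_diff_distrib add: abs_mult)
        then show ?case using False by (simp add: field_simps)
      qed
    qed measurable
    also have "\<dots> \<le> ennreal (C / (s / cmod c)) * nnorm1 \<alpha> (\<lambda>x. k x - f x)"
      by (rule limit_ofD[OF u k sc])
    also have "\<dots> \<le> ennreal (C / s) * nnorm1 \<alpha> (\<lambda>x. h x - c * f x)"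
    proof -
      have "cmod (h x - c * f x) = cmod c * cmod (k x - f x)" for x
        unfolding ck[symmetric] by (simp flip: right_diff_distrib add: norm_mult)
      then have "nnorm1 \<alpha> (\<lambda>x. h x - c * f x)
          = (\<integral>\<^sup>+x. ennreal (cmod c) * ennreal (cmod (k x - f x)) \<partial>gam \<alpha>)"
        by (simp add: ennreal_mult)
      also have "\<dots> = ennreal (cmod c) * nnorm1 \<alpha> (\<lambda>x. k x - f x)"
        using f k by (intro nn_integral_cmult) (auto simp: Lp1_iff Lp2_iff)
      finally have "ennreal (C / s) * (ennreal (cmod c) * nnorm1 \<alpha> (\<lambda>x. k x - f x))
        = ennreal (C / s) * nnorm1 \<alpha> (\<lambda>x. h x - c * f x)"
        by simp
      moreover have "ennreal (C / (s / cmod c)) = ennreal (C / s) * ennreal (cmod c)"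
        using s C_nonneg by (simp flip: ennreal_mult)
      ultimately show ?thesis by (simp add: mult.assoc)
    qed
    finally show "emeasure (gam \<alpha>) {x \<in> {0<..}. s < \<bar>U h x - cmod c * u x\<bar>} \<le> \<dots>" .
  qed measurable
qed (simp add: limit_of_zero)

text \<open>
  The approximations \<open>h k\<close> converge so fast in $L^1$ that by the weak bound the images at
  consecutive indices differ by more than $2^{-k}$ only on sets of summable measure. By the
  Borel-Cantelli lemma the images converge almost everywhere. The defining inequality passes
  to the limit by Fatou's lemma for the indicators of the level sets.
\<close>

lemma limit_of_exists:
  assumes f: "f \<in> Lp \<alpha> 1"
  shows "\<exists>u. limit_of f u"
proof -
  have fm [measurable]: "f \<in> borel_measurable (gam \<alpha>)" using f by (simp add: Lp1_iff)
  have "\<forall>k. \<exists>h. h \<in> Lp \<alpha> 2 \<and> nnorm1 \<alpha> (\<lambda>x. h x - f x) \<le> ennreal ((1 / 4) ^ k)"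
  proof
    fix k :: nat
    have "(0::real) < (1 / 4) ^ k" by simp
    from L1_approx[OF alpha f this]
    show "\<exists>h. h \<in> Lp \<alpha> 2 \<and> nnorm1 \<alpha> (\<lambda>x. h x - f x) \<le> ennreal ((1 / 4) ^ k)"
      by blast
  qed
  from choice[OF this] obtain h where h: "\<And>k. h k \<in> Lp \<alpha> 2"
    "\<And>k. nnorm1 \<alpha> (\<lambda>x. h k x - f x) \<le> ennreal ((1 / 4) ^ k)" by blast
  have hm [measurable]: "h k \<in> borel_measurable (gam \<alpha>)" for k using h(1)[of k] by (simp add: Lp2_iff)
  define v where "v k = U (h k)" for k
  have vm [measurable]: "v k \<in> borel_measurable (gam \<alpha>)" for k unfolding v_def by (rule U_meas[OF h(1)])
  define E where "E k = {x \<in> {0<..}. (1 / 2) ^ k < \<bar>v (Suc k) x - v k x\<bar>}" for k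
  have E: "E k \<in> sets (gam \<alpha>)" for k unfolding E_def by (intro gt_sets) measurable
  have mE: "measure (gam \<alpha>) (E k) \<le> 2 * C * (1 / 2) ^ k" for k
  proof -
    have "emeasure (gam \<alpha>) (E k) \<le> ennreal (C / (1 / 2) ^ k) * nnorm1 \<alpha> (\<lambda>x. h (Suc k) x - h k x)"
      unfolding E_def v_def by (intro U_diff_weak h) simp
    also have "nnorm1 \<alpha> (\<lambda>x. h (Suc k) x - h k x) \<le> ennreal ((1 / 4) ^ Suc k) + ennreal ((1 / 4) ^ k)"
    proof -
      have "nnorm1 \<alpha> (\<lambda>x. f x - h k x) \<le> ennreal ((1 / 4) ^ k)"
        using h(2)[of k] by (simp add: norm_minus_commute)
      then show ?thesis
        by (intro order_trans[OF nn_integral_cmod_triangle[of _ _ f]] add_mono h(2)) auto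
    qed
    also have "\<dots> \<le> ennreal (2 * (1 / 4) ^ k)" by (simp flip: ennreal_plus add: ennreal_leI)
    also have "ennreal (C / (1 / 2) ^ k) * ennreal (2 * (1 / 4) ^ k) = ennreal (2 * C * (1 / 2) ^ k)"
    proof -
      have "C / (1 / 2) ^ k * (2 * (1 / 4) ^ k) = 2 * C * ((1 / 4) ^ k / (1 / 2) ^ k)" by simp
      also have "(1 / 4 :: real) ^ k / (1 / 2) ^ k = (1 / 2) ^ k" by (simp flip: power_divide)
      finally show ?thesis using C_nonneg by (simp flip: ennreal_mult)
    qed
    finally show ?thesis using C_nonneg by (simp add: emeasure_eq_measure mult_left_mono)
  qed
  have sumE: "summable (\<lambda>k. measure (gam \<alpha>) (E k))"
    by (rule summable_comparison_test'[of "\<lambda>k. 2 * C * (1 / 2) ^ k" 0])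
      (use mE in \<open>auto intro!: summable_mult summable_geometric\<close>)
  have "AE x in gam \<alpha>. eventually (\<lambda>k. x \<in> space (gam \<alpha>) - E k) sequentially"
    by (intro borel_cantelli_AE1 E sumE) (simp add: less_top[symmetric])
  then have conv: "AE x in gam \<alpha>. (\<lambda>k. v k x) \<longlonglongrightarrow> lim (\<lambda>k. v k x)"
  proof eventually_elim
    case (elim x)
    have "eventually (\<lambda>k. norm (v (Suc k) x - v k x) \<le> (1 / 2) ^ k) sequentially"
      using elim by eventually_elim (auto simp: E_def)
    then have "summable (\<lambda>k. v (Suc k) x - v k x)"
      by (rule summable_comparison_test_ev) (simp add: summable_geometric)
    then have "convergent (\<lambda>n. \<Sum>k<n. v (Suc k) x - v k x)" by (simp add: summable_iff_convergent)
    then have "convergent (\<lambda>n. v n x - v 0 x)" by (simp only: sum_lessThan_telescope[of "\<lambda>k. v k x"])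
    then have "convergent (\<lambda>n. (v n x - v 0 x) + v 0 x)" by (intro convergent_add convergent_const)
    then show ?case by (simp add: convergent_LIMSEQ_iff)
  qed
  define u where "u x = lim (\<lambda>k. v k x)" for x
  have um [measurable]: "u \<in> borel_measurable (gam \<alpha>)" unfolding u_def by (rule borel_measurable_lim_metric) measurable
  have "limit_of f u"
    unfolding limit_of_def
  proof (intro conjI ballI allI impI)
    fix g :: "real \<Rightarrow> complex" and s :: real assume g: "g \<in> Lp \<alpha> 2" and s: "s > 0"
    have [measurable]: "U g \<in> borel_measurable (gam \<alpha>)" by (rule U_meas[OF g])
    have [measurable]: "g \<in> borel_measurable (gam \<alpha>)" using g by (simp add: Lp2_iff)
    define Q where "Q = nnorm1 \<alpha> (\<lambda>x. g x - f x)"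
    have S: "{x \<in> {0<..}. s < \<bar>U g x - u x\<bar>} \<in> sets (gam \<alpha>)" by (intro gt_sets) measurable
    have S': "{x \<in> {0<..}. s < \<bar>U g x - v k x\<bar>} \<in> sets (gam \<alpha>)" for k by (intro gt_sets) measurable
    have "emeasure (gam \<alpha>) {x \<in> {0<..}. s < \<bar>U g x - u x\<bar>} = (\<integral>\<^sup>+x. indicator {x \<in> {0<..}. s < \<bar>U g x - u x\<bar>} x \<partial>gam \<alpha>)"
      using S by simp
    also have "\<dots> \<le> (\<integral>\<^sup>+x. liminf (\<lambda>k. indicator {x \<in> {0<..}. s < \<bar>U g x - v k x\<bar>} x) \<partial>gam \<alpha>)"
    proof (rule nn_integral_mono_AE)
      show "AE x in gam \<alpha>. (indicator {x \<in> {0<..}. s < \<bar>U g x - u x\<bar>} x :: ennreal)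
          \<le> liminf (\<lambda>k. indicator {x \<in> {0<..}. s < \<bar>U g x - v k x\<bar>} x)"
        using conv
      proof eventually_elim
        case (elim x)
        show ?case
        proof (cases "0 < x \<and> s < \<bar>U g x - u x\<bar>")
          case True
          have "(\<lambda>k. \<bar>U g x - v k x\<bar>) \<longlonglongrightarrow> \<bar>U g x - u x\<bar>"
            using elim unfolding u_def by (intro tendsto_intros)
          then have "eventually (\<lambda>k. s < \<bar>U g x - v k x\<bar>) sequentially"
            using True by (intro order_tendstoD) auto
          then have "1 \<le> liminf (\<lambda>k. indicator {x \<in> {0<..}. s < \<bar>U g x - v k x\<bar>} x :: ennreal)"
            using True by (intro Liminf_bounded) (auto elim!: eventually_mono)
          then show ?thesis using True by simp
        qed simp
      qed
    qed
    also have "\<dots> \<le> liminf (\<lambda>k. \<integral>\<^sup>+x. indicator {x \<in> {0<..}. s < \<bar>U g x - v k x\<bar>} x \<partial>gam \<alpha>)"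
      using S' by (intro nn_integral_liminf) auto
    also have "\<dots> = liminf (\<lambda>k. emeasure (gam \<alpha>) {x \<in> {0<..}. s < \<bar>U g x - v k x\<bar>})"
      using S' by simp
    also have "\<dots> \<le> liminf (\<lambda>k. ennreal (C / s) * (Q + ennreal ((1 / 4) ^ k)))"
    proof (intro Liminf_mono always_eventually allI)
      fix k
      have "emeasure (gam \<alpha>) {x \<in> {0<..}. s < \<bar>U g x - v k x\<bar>}
        \<le> ennreal (C / s) * nnorm1 \<alpha> (\<lambda>x. g x - h k x)"
        unfolding v_def by (intro U_diff_weak g h s)
      also have "nnorm1 \<alpha> (\<lambda>x. g x - h k x) \<le> Q + ennreal ((1 / 4) ^ k)"
      proof -
        have "nnorm1 \<alpha> (\<lambda>x. f x - h k x) \<le> ennreal ((1 / 4) ^ k)"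
          using h(2)[of k] by (simp add: norm_minus_commute)
        then show ?thesis unfolding Q_def
          by (intro order_trans[OF nn_integral_cmod_triangle[of _ _ f]] add_mono) auto
      qed
      finally show "emeasure (gam \<alpha>) {x \<in> {0<..}. s < \<bar>U g x - v k x\<bar>} \<le> ennreal (C / s) * (Q + ennreal ((1 / 4) ^ k))"
        by (simp add: mult_left_mono)
    qed
    also have "\<dots> = ennreal (C / s) * Q"
    proof (rule lim_imp_Liminf)
      have "(\<lambda>k. ennreal ((1 / 4) ^ k)) \<longlonglongrightarrow> ennreal 0"
        by (intro tendsto_ennrealI LIMSEQ_power_zero) simp
      then have "(\<lambda>k. Q + ennreal ((1 / 4) ^ k)) \<longlonglongrightarrow> Q + ennreal 0"
        by (intro tendsto_add tendsto_const)
      then show "(\<lambda>k. ennreal (C / s) * (Q + ennreal ((1 / 4) ^ k))) \<longlonglongrightarrow> ennreal (C / s) * Q"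
        by (intro ennreal_tendsto_cmult) auto
    qed simp
    finally show "emeasure (gam \<alpha>) {x \<in> {0<..}. s < \<bar>U g x - u x\<bar>}
      \<le> ennreal (C / s) * nnorm1 \<alpha> (\<lambda>x. g x - f x)" by (simp add: Q_def)
  qed measurable
  then show ?thesis by blast
qed

text \<open>
  Convergence in measure alone gives control over bounded functions only. So $\min(|u|,n)$ is
  estimated first, by $Uh$ plus a small constant plus $n$ times the indicator of a small set.
  Then $n$ tends to infinity.
\<close>

lemma limit_of_L1_bound:
  assumes f: "f \<in> Lp \<alpha> 1" and u: "limit_of f u" and \<Lambda>: "\<Lambda> \<ge> 0"
    and approx: "\<And>e. e > 0 \<Longrightarrow> \<exists>h\<in>Lp \<alpha> 2. nnorm1 \<alpha> (\<lambda>x. h x - f x) \<le> ennreal e \<and>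
      (\<integral>\<^sup>+x. ennreal (U h x) \<partial>gam \<alpha>) \<le> ennreal \<Lambda>"
  shows "(\<integral>\<^sup>+x. ennreal \<bar>u x\<bar> \<partial>gam \<alpha>) \<le> ennreal \<Lambda>"
proof -
  have um [measurable]: "u \<in> borel_measurable (gam \<alpha>)" using u by (rule limit_of_meas)
  define m0 where "m0 = measure (gam \<alpha>) (space (gam \<alpha>))"
  have m0: "m0 \<ge> 0" by (simp add: m0_def)
  have trunc: "(\<integral>\<^sup>+x. ennreal (min \<bar>u x\<bar> (real n)) \<partial>gam \<alpha>) \<le> ennreal \<Lambda>" for n
  proof (rule ennreal_le_epsilon)
    fix e :: real assume e: "e > 0"
    \<comment> \<open>half of the error \<open>e\<close> is for the constant \<open>s\<close>, which costs at most \<open>s * m0\<close>, and half for the exceptional set\<close>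
    define s where "s = e / (2 * (m0 + 1))"
    have s: "s > 0" "s * m0 \<le> e / 2"
    proof -
      show "s > 0" using e m0 by (simp add: s_def)
      have "e * m0 \<le> e * (m0 + 1)" using e by (intro mult_left_mono) auto
      then show "s * m0 \<le> e / 2" using m0 by (simp add: s_def field_simps)
    qed
    have e': "e / (2 * (real n + 1)) > 0" using e by simp
    obtain d where d: "d > 0" "\<And>h. h \<in> Lp \<alpha> 2 \<Longrightarrow> nnorm1 \<alpha> (\<lambda>x. h x - f x) \<le> ennreal d \<Longrightarrow>
        emeasure (gam \<alpha>) {x \<in> {0<..}. s < \<bar>U h x - u x\<bar>} \<le> ennreal (e / (2 * (real n + 1)))"
      using limit_of_close[OF f u s(1) e'] by blast
    obtain h where h: "h \<in> Lp \<alpha> 2" "nnorm1 \<alpha> (\<lambda>x. h x - f x) \<le> ennreal d"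
      "(\<integral>\<^sup>+x. ennreal (U h x) \<partial>gam \<alpha>) \<le> ennreal \<Lambda>"
      using approx[OF d(1)] by blast
    have [measurable]: "U h \<in> borel_measurable (gam \<alpha>)" by (rule U_meas[OF h(1)])
    define E where "E = {x \<in> {0<..}. s < \<bar>U h x - u x\<bar>}"
    have E [measurable]: "E \<in> sets (gam \<alpha>)" unfolding E_def by (intro gt_sets) measurable
    have "(\<integral>\<^sup>+x. ennreal (min \<bar>u x\<bar> (real n)) \<partial>gam \<alpha>)
      \<le> (\<integral>\<^sup>+x. ennreal (U h x) + (ennreal s + ennreal (real n) * indicator E x) \<partial>gam \<alpha>)"
    proof (rule nn_integral_mono_AE)
      show "AE x in gam \<alpha>. ennreal (min \<bar>u x\<bar> (real n)) \<le> ennreal (U h x) + (ennreal s + ennreal (real n) * indicator E x)"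
        using U_nonneg[OF h(1)] AE_space
      proof eventually_elim
        case (elim x)
        show ?case
        proof (cases "x \<in> E")
          case True
          have "min \<bar>u x\<bar> (real n) \<le> U h x + (s + real n)" using elim s by linarith
          then show ?thesis using True elim s by (simp flip: ennreal_plus add: ennreal_leI)
        next
          case False
          then have "min \<bar>u x\<bar> (real n) \<le> U h x + s" using elim unfolding E_def by auto
          then show ?thesis using False elim s by (simp flip: ennreal_plus add: ennreal_leI)
        qed
      qed
    qed
    also have "\<dots> = (\<integral>\<^sup>+x. ennreal (U h x) \<partial>gam \<alpha>) + (ennreal s * ennreal m0 + ennreal (real n) * emeasure (gam \<alpha>) E)"
      by (simp add: nn_integral_add nn_integral_cmult_indicator m0_def emeasure_eq_measure)
    also have "\<dots> \<le> ennreal \<Lambda> + (ennreal s * ennreal m0 + ennreal (real n) * ennreal (e / (2 * (real n + 1))))"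
      unfolding E_def by (intro add_mono mult_left_mono h(3) d(2) h) auto
    also have "\<dots> = ennreal (\<Lambda> + (s * m0 + real n * (e / (2 * (real n + 1)))))"
      using \<Lambda> s m0 e by (simp flip: ennreal_mult ennreal_plus)
    also have "\<dots> \<le> ennreal (\<Lambda> + e)"
    proof (rule ennreal_leI)
      have "real n * e \<le> (real n + 1) * e" using e by (intro mult_right_mono) auto
      then have "real n * (e / (2 * (real n + 1))) \<le> e / 2" by (simp add: field_simps)
      then show "\<Lambda> + (s * m0 + real n * (e / (2 * (real n + 1)))) \<le> \<Lambda> + e" using s by linarith
    qed
    finally show "(\<integral>\<^sup>+x. ennreal (min \<bar>u x\<bar> (real n)) \<partial>gam \<alpha>) \<le> ennreal \<Lambda> + ennreal e"
      using \<Lambda> e by (simp add: ennreal_plus)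
  qed
  have "(\<integral>\<^sup>+x. ennreal \<bar>u x\<bar> \<partial>gam \<alpha>) = (\<integral>\<^sup>+x. liminf (\<lambda>n. ennreal (min \<bar>u x\<bar> (real n))) \<partial>gam \<alpha>)"
  proof (rule nn_integral_cong)
    fix x
    have "eventually (\<lambda>n. ennreal (min \<bar>u x\<bar> (real n)) = ennreal \<bar>u x\<bar>) sequentially"
      using eventually_ge_at_top[of "nat \<lceil>\<bar>u x\<bar>\<rceil>"]
    proof eventually_elim
      case (elim n)
      then have "\<bar>u x\<bar> \<le> real n" by linarith
      then show ?case by (simp add: min_def)
    qed
    then have "(\<lambda>n. ennreal (min \<bar>u x\<bar> (real n))) \<longlonglongrightarrow> ennreal \<bar>u x\<bar>" by (rule tendsto_eventually)
    then show "ennreal \<bar>u x\<bar> = liminf (\<lambda>n. ennreal (min \<bar>u x\<bar> (real n)))"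
      using lim_imp_Liminf[of sequentially] by fastforce
  qed
  also have "\<dots> \<le> liminf (\<lambda>n. \<integral>\<^sup>+x. ennreal (min \<bar>u x\<bar> (real n)) \<partial>gam \<alpha>)"
    by (rule nn_integral_liminf) measurable
  also have "\<dots> \<le> liminf (\<lambda>n::nat. ennreal \<Lambda>)"
    by (intro Liminf_mono always_eventually allI trunc)
  also have "\<dots> = ennreal \<Lambda>" by (simp add: Liminf_const)
  finally show ?thesis .
qed

text \<open>
  Replace each atom of a long partial sum by one of its truncations. The errors add up to at
  most \<open>d\<close> times $\sum_j|\lambda_j|$.
\<close>

lemma limit_of_H1_bound:
  assumes a: "a > 0" and q: "1 < q"
  obtains K where "K \<ge> 0"
    "\<And>f l b u. f \<in> Lp \<alpha> 1 \<Longrightarrow> atomic_rep \<alpha> a q f l b \<Longrightarrow> limit_of f u \<Longrightarrow>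
      (\<integral>\<^sup>+x. ennreal \<bar>u x\<bar> \<partial>gam \<alpha>) \<le> ennreal (K * (\<Sum>j. cmod (l j)))"
proof -
  obtain K where K: "K \<ge> 0" and approx: "\<And>b e. atom \<alpha> a q b \<Longrightarrow> e > 0 \<Longrightarrow> \<exists>g\<in>Lp \<alpha> 2.
       nnorm1 \<alpha> (\<lambda>x. g x - b x) \<le> ennreal e \<and> (\<integral>\<^sup>+x. ennreal (U g x) \<partial>gam \<alpha>) \<le> ennreal K"
    using atom_approx[OF a q] by blast
  show thesis
  proof (rule that[OF K])
    fix f l b u assume f: "f \<in> Lp \<alpha> 1" and rep: "atomic_rep \<alpha> a q f l b" and u: "limit_of f u"
    have fm [measurable]: "f \<in> borel_measurable (gam \<alpha>)" using f by (simp add: Lp1_iff)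
    have atom: "\<And>j. atom \<alpha> a q (b j)" and sl: "summable (\<lambda>j. cmod (l j))"
      and lim: "(\<lambda>n. Lp_norm \<alpha> 1 (\<lambda>x. f x - (\<Sum>j<n. l j * b j x))) \<longlonglongrightarrow> 0"
      using rep by (auto simp: atomic_rep_def)
    define \<Lambda> where "\<Lambda> = (\<Sum>j. cmod (l j))"
    have \<Lambda>: "\<Lambda> \<ge> 0" unfolding \<Lambda>_def by (intro suminf_nonneg sl) simp
    have part: "(\<Sum>j<n. cmod (l j)) \<le> \<Lambda>" for n
      unfolding \<Lambda>_def by (intro sum_le_suminf sl) auto
    have bm [measurable]: "b j \<in> borel_measurable (gam \<alpha>)" for j using atom[of j] by (simp add: atom_def)
    have bL1: "b j \<in> Lp \<alpha> 1" for j
    proof -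
      obtain g where g: "g \<in> Lp \<alpha> 2" "nnorm1 \<alpha> (\<lambda>x. g x - b j x) \<le> ennreal 1"
        using approx[OF atom[of j], of 1] by auto
      then have [measurable]: "g \<in> borel_measurable (gam \<alpha>)" by (simp add: Lp2_iff)
      have "integrable (gam \<alpha>) (\<lambda>x. g x - b j x)"
        by (rule integrableI_bounded) (use g(2) in \<open>auto intro: le_less_trans\<close>)
      moreover have "integrable (gam \<alpha>) g" using Lp2_Lp1[OF alpha g(1)] by (simp add: Lp1_integrable)
      ultimately have "integrable (gam \<alpha>) (\<lambda>x. g x - (g x - b j x))"
        by (rule Bochner_Integration.integrable_diff[rotated])
      moreover have "(\<lambda>x. g x - (g x - b j x)) = b j" by simp
      ultimately show ?thesis by (simp only: Lp1_integrable)
    qed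
    show "(\<integral>\<^sup>+x. ennreal \<bar>u x\<bar> \<partial>gam \<alpha>) \<le> ennreal (K * (\<Sum>j. cmod (l j)))"
      unfolding \<Lambda>_def[symmetric]
    proof (rule limit_of_L1_bound[OF f u])
      show "K * \<Lambda> \<ge> 0" using K \<Lambda> by simp
      fix e :: real assume e: "e > 0"
      define d where "d = e / (2 * (\<Lambda> + 1))"
      have d: "d > 0" using e \<Lambda> by (simp add: d_def)
      have "\<forall>j. \<exists>g. g \<in> Lp \<alpha> 2 \<and> nnorm1 \<alpha> (\<lambda>x. g x - b j x) \<le> ennreal d
          \<and> (\<integral>\<^sup>+x. ennreal (U g x) \<partial>gam \<alpha>) \<le> ennreal K"
        using approx[OF atom d] by blast
      from choice[OF this] obtain g where g: "\<And>j. g j \<in> Lp \<alpha> 2"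
        "\<And>j. nnorm1 \<alpha> (\<lambda>x. g j x - b j x) \<le> ennreal d"
        "\<And>j. (\<integral>\<^sup>+x. ennreal (U (g j) x) \<partial>gam \<alpha>) \<le> ennreal K" by blast
      have [measurable]: "g j \<in> borel_measurable (gam \<alpha>)" for j using g(1)[of j] by (simp add: Lp2_iff)
      define h where "h n x = (\<Sum>j<n. l j * g j x)" for n x
      define sb where "sb n x = (\<Sum>j<n. l j * b j x)" for n x
      have [measurable]: "sb n \<in> borel_measurable (gam \<alpha>)" for n unfolding sb_def by measurable
      have h: "h n \<in> Lp \<alpha> 2 \<and> (\<integral>\<^sup>+x. ennreal (U (h n) x) \<partial>gam \<alpha>) \<le> ennreal (K * (\<Sum>j<n. cmod (l j)))
          \<and> nnorm1 \<alpha> (\<lambda>x. h n x - sb n x) \<le> ennreal (d * (\<Sum>j<n. cmod (l j)))" for n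
      proof (induction n)
        case 0
        have "(\<integral>\<^sup>+x. ennreal (U (\<lambda>x. 0) x) \<partial>gam \<alpha>) = (\<integral>\<^sup>+x. 0 \<partial>gam \<alpha>)"
          using U_zero by (intro nn_integral_cong_AE) (auto elim!: eventually_mono)
        then show ?case by (simp add: h_def[abs_def] sb_def zero_L2)
      next
        case (Suc n)
        have lg: "(\<lambda>x. l n * g n x) \<in> Lp \<alpha> 2" by (rule Lp2_cmult[OF g(1)])
        have hS: "h (Suc n) = (\<lambda>x. h n x + l n * g n x)" by (simp add: h_def fun_eq_iff)
        have hn: "h n \<in> Lp \<alpha> 2" using Suc by blast
        have [measurable]: "h n \<in> borel_measurable (gam \<alpha>)" using hn by (simp add: Lp2_iff)
        have [measurable]: "U (h n) \<in> borel_measurable (gam \<alpha>)" "U (g n) \<in> borel_measurable (gam \<alpha>)"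
          using hn g by (auto intro: U_meas)
        have s0: "0 \<le> (\<Sum>j<n. cmod (l j))" by (intro sum_nonneg) simp
        have 1: "h (Suc n) \<in> Lp \<alpha> 2" unfolding hS by (rule Lp2_add[OF hn lg])
        have "(\<integral>\<^sup>+x. ennreal (U (h (Suc n)) x) \<partial>gam \<alpha>)
          \<le> (\<integral>\<^sup>+x. ennreal (U (h n) x) + ennreal (cmod (l n)) * ennreal (U (g n) x) \<partial>gam \<alpha>)"
        proof (rule nn_integral_mono_AE)
          show "AE x in gam \<alpha>. ennreal (U (h (Suc n)) x) \<le> ennreal (U (h n) x) + ennreal (cmod (l n)) * ennreal (U (g n) x)"
            using U_add[OF hn lg] U_cmult[OF g(1)[of n], of "l n"] U_nonneg[OF hn] U_nonneg[OF g(1)[of n]]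
            unfolding hS by eventually_elim (auto simp flip: ennreal_plus ennreal_mult intro!: ennreal_leI)
        qed
        also have "\<dots> = (\<integral>\<^sup>+x. ennreal (U (h n) x) \<partial>gam \<alpha>) + ennreal (cmod (l n)) * (\<integral>\<^sup>+x. ennreal (U (g n) x) \<partial>gam \<alpha>)"
          by (simp add: nn_integral_add nn_integral_cmult)
        also have "\<dots> \<le> ennreal (K * (\<Sum>j<n. cmod (l j))) + ennreal (cmod (l n)) * ennreal K"
          using Suc by (intro add_mono mult_left_mono g(3)) auto
        also have "\<dots> = ennreal (K * (\<Sum>j<Suc n. cmod (l j)))"
          using K s0 by (simp add: algebra_simps flip: ennreal_plus ennreal_mult)
        finally have 2: "(\<integral>\<^sup>+x. ennreal (U (h (Suc n)) x) \<partial>gam \<alpha>) \<le> ennreal (K * (\<Sum>j<Suc n. cmod (l j)))" .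
        have "nnorm1 \<alpha> (\<lambda>x. h (Suc n) x - sb (Suc n) x)
          \<le> (\<integral>\<^sup>+x. ennreal (cmod (h n x - sb n x)) + ennreal (cmod (l n)) * ennreal (cmod (g n x - b n x)) \<partial>gam \<alpha>)"
        proof (rule nn_integral_mono)
          fix x
          have "h (Suc n) x - sb (Suc n) x = (h n x - sb n x) + l n * (g n x - b n x)"
            by (simp add: h_def sb_def algebra_simps)
          then have "cmod (h (Suc n) x - sb (Suc n) x) \<le> cmod (h n x - sb n x) + cmod (l n) * cmod (g n x - b n x)"
            using norm_triangle_ineq[of "h n x - sb n x" "l n * (g n x - b n x)"] by (simp add: norm_mult)
          then show "ennreal (cmod (h (Suc n) x - sb (Suc n) x))
            \<le> ennreal (cmod (h n x - sb n x)) + ennreal (cmod (l n)) * ennreal (cmod (g n x - b n x))"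
            by (simp flip: ennreal_plus ennreal_mult add: ennreal_leI)
        qed
        also have "\<dots> = nnorm1 \<alpha> (\<lambda>x. h n x - sb n x) + ennreal (cmod (l n)) * nnorm1 \<alpha> (\<lambda>x. g n x - b n x)"
          by (simp add: nn_integral_add nn_integral_cmult)
        also have "\<dots> \<le> ennreal (d * (\<Sum>j<n. cmod (l j))) + ennreal (cmod (l n)) * ennreal d"
          using Suc by (intro add_mono mult_left_mono g(2)) auto
        also have "\<dots> = ennreal (d * (\<Sum>j<Suc n. cmod (l j)))"
          using d s0 by (simp add: algebra_simps flip: ennreal_plus ennreal_mult)
        finally show ?case using 1 2 by blast
      qed
      have "eventually (\<lambda>n. Lp_norm \<alpha> 1 (\<lambda>x. f x - sb n x) < e / 2) sequentially"
        using lim e unfolding sb_def by (intro order_tendstoD) auto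
      then obtain n where n: "Lp_norm \<alpha> 1 (\<lambda>x. f x - sb n x) < e / 2"
        by (auto simp: eventually_sequentially)
      have sbL1: "(\<lambda>x. f x - sb n x) \<in> Lp \<alpha> 1"
        using f bL1 unfolding Lp1_integrable sb_def by auto
      have hm [measurable]: "h n \<in> borel_measurable (gam \<alpha>)" using h[of n] by (simp add: Lp2_iff)
      have "nnorm1 \<alpha> (\<lambda>x. sb n x - f x) = ennreal (Lp_norm \<alpha> 1 (\<lambda>x. f x - sb n x))"
        unfolding Lp1_norm[OF sbL1] by (simp add: norm_minus_commute)
      also have "\<dots> \<le> ennreal (e / 2)" using n by (intro ennreal_leI) simp
      finally have 1: "nnorm1 \<alpha> (\<lambda>x. sb n x - f x) \<le> ennreal (e / 2)" .
      have "d * (\<Sum>j<n. cmod (l j)) \<le> d * \<Lambda>" using d part by (intro mult_left_mono) auto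
      also have "d * \<Lambda> \<le> e / 2"
      proof -
        have "e * \<Lambda> \<le> e * (\<Lambda> + 1)" using e by (intro mult_left_mono) auto
        then show ?thesis using \<Lambda> by (simp add: d_def field_simps)
      qed
      finally have "d * (\<Sum>j<n. cmod (l j)) \<le> e / 2" .
      then have 2: "nnorm1 \<alpha> (\<lambda>x. h n x - sb n x) \<le> ennreal (e / 2)"
        using h[of n] ennreal_leI order_trans by blast
      have "nnorm1 \<alpha> (\<lambda>x. h n x - f x) \<le> ennreal (e / 2) + ennreal (e / 2)"
        by (intro order_trans[OF nn_integral_cmod_triangle[of _ _ "sb n"]] add_mono 1 2) auto
      also have "\<dots> = ennreal e" using e by (simp flip: ennreal_plus)
      finally have 3: "nnorm1 \<alpha> (\<lambda>x. h n x - f x) \<le> ennreal e" .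
      have "(\<integral>\<^sup>+x. ennreal (U (h n) x) \<partial>gam \<alpha>) \<le> ennreal (K * \<Lambda>)"
        using h[of n] ennreal_leI[OF mult_left_mono[OF part[of n] K]] order_trans by blast
      with 3 show "\<exists>h\<in>Lp \<alpha> 2. nnorm1 \<alpha> (\<lambda>x. h x - f x) \<le> ennreal e \<and>
        (\<integral>\<^sup>+x. ennreal (U h x) \<partial>gam \<alpha>) \<le> ennreal (K * \<Lambda>)"
        using h[of n] by blast
    qed
  qed
qed

end

section \<open>Integration in a space of functions\<close>

lemma simple_indicator_expansion:
  fixes \<psi> :: "'b \<Rightarrow> 'c::real_vector"
  assumes "simple_function M z" "p \<in> space M"
  shows "\<psi> (z p) = (\<Sum>w\<in>z ` space M. indicator (z -` {w} \<inter> space M) p *\<^sub>R \<psi> w)"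
proof -
  have "(\<Sum>w\<in>z ` space M. indicator (z -` {w} \<inter> space M) p *\<^sub>R \<psi> w) = (\<Sum>w\<in>{z p}. \<psi> w)"
    using assms by (intro sum.mono_neutral_cong_right) (auto simp: simple_function_def indicator_def)
  then show ?thesis by simp
qed

lemma simple_bochner:
  fixes \<psi> :: "'b \<Rightarrow> complex"
  assumes "finite_measure M" and z: "simple_function M z"
  shows "integrable M (\<lambda>p. \<psi> (z p))"
    and "(\<integral>p. \<psi> (z p) \<partial>M) = (\<Sum>w\<in>z ` space M. of_real (measure M (z -` {w} \<inter> space M)) * \<psi> w)"
proof -
  interpret finite_measure M by fact
  have S: "z -` {w} \<inter> space M \<in> sets M" for w by (rule simple_functionD[OF z])
  have i: "integrable M (\<lambda>p. indicator (z -` {w} \<inter> space M) p *\<^sub>R \<psi> w)" for w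
    using S by (intro integrable_scaleR_left) (auto simp: less_top[symmetric])
  have eq: "\<And>p. p \<in> space M \<Longrightarrow> \<psi> (z p) = (\<Sum>w\<in>z ` space M. indicator (z -` {w} \<inter> space M) p *\<^sub>R \<psi> w)"
    by (rule simple_indicator_expansion[OF z])
  show "integrable M (\<lambda>p. \<psi> (z p))"
    by (subst Bochner_Integration.integrable_cong[OF refl eq], assumption) (intro Bochner_Integration.integrable_sum i)
  have one: "(\<integral>p. indicator (z -` {w} \<inter> space M) p *\<^sub>R \<psi> w \<partial>M) = of_real (measure M (z -` {w} \<inter> space M)) * \<psi> w" for w
    using S by (subst integral_scaleR_left) (auto simp: less_top[symmetric] scaleR_conv_of_real)
  show "(\<integral>p. \<psi> (z p) \<partial>M) = (\<Sum>w\<in>z ` space M. of_real (measure M (z -` {w} \<inter> space M)) * \<psi> w)"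
    by (subst Bochner_Integration.integral_cong[OF refl eq], assumption)
      (simp add: Bochner_Integration.integral_sum i one)
qed

lemma simple_nn_integral:
  fixes \<nu> :: "'b \<Rightarrow> real"
  assumes z: "simple_function M z" and \<nu>: "\<And>p. p \<in> space M \<Longrightarrow> 0 \<le> \<nu> (z p)"
  shows "(\<integral>\<^sup>+p. ennreal (\<nu> (z p)) \<partial>M)
    = (\<Sum>w\<in>z ` space M. ennreal (\<nu> w) * emeasure M (z -` {w} \<inter> space M))"
proof -
  have S: "z -` {w} \<inter> space M \<in> sets M" for w by (rule simple_functionD[OF z])
  have "(\<integral>\<^sup>+p. ennreal (\<nu> (z p)) \<partial>M)
    = (\<integral>\<^sup>+p. (\<Sum>w\<in>z ` space M. ennreal (\<nu> w) * indicator (z -` {w} \<inter> space M) p) \<partial>M)"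
  proof (rule nn_integral_cong)
    fix p assume p: "p \<in> space M"
    have "(\<Sum>w\<in>z ` space M. ennreal (\<nu> w) * indicator (z -` {w} \<inter> space M) p) = (\<Sum>w\<in>{z p}. ennreal (\<nu> w))"
      using z p by (intro sum.mono_neutral_cong_right) (auto simp: simple_function_def indicator_def)
    then show "ennreal (\<nu> (z p)) = (\<Sum>w\<in>z ` space M. ennreal (\<nu> w) * indicator (z -` {w} \<inter> space M) p)" by simp
  qed
  also have "\<dots> = (\<Sum>w\<in>z ` space M. \<integral>\<^sup>+p. ennreal (\<nu> w) * indicator (z -` {w} \<inter> space M) p \<partial>M)"
    using S by (intro nn_integral_sum) auto
  also have "\<dots> = (\<Sum>w\<in>z ` space M. ennreal (\<nu> w) * emeasure M (z -` {w} \<inter> space M))"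
    using S by (intro sum.cong refl nn_integral_cmult_indicator) auto
  finally show ?thesis .
qed

text \<open>
  The norm \<open>N\<close> is only a seminorm on the functions in \<open>X\<close>, and two functions that agree on the
  positive half line need not be equal. So limits in \<open>X\<close> are not unique, and all statements
  are about norms of differences.
\<close>

locale fun_space =
  fixes X :: "(real \<Rightarrow> complex) set" and N :: "(real \<Rightarrow> complex) \<Rightarrow> real"
  assumes bfs: "banach_fun_space X N"
begin

lemma X_cong: "u \<in> X \<Longrightarrow> (\<And>t. t > 0 \<Longrightarrow> v t = u t) \<Longrightarrow> v \<in> X \<and> N v = N u"
  using bfs unfolding banach_fun_space_def by blast

lemma X_zero: "(\<lambda>t. 0) \<in> X"
  using bfs unfolding banach_fun_space_def by blast

lemma X_add: "u \<in> X \<Longrightarrow> v \<in> X \<Longrightarrow> (\<lambda>t. u t + v t) \<in> X \<and> N (\<lambda>t. u t + v t) \<le> N u + N v"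
  using bfs unfolding banach_fun_space_def by blast

lemma X_cmult: "u \<in> X \<Longrightarrow> (\<lambda>t. c * u t) \<in> X \<and> N (\<lambda>t. c * u t) = cmod c * N u"
  using bfs unfolding banach_fun_space_def by blast

lemma N_nonneg: "u \<in> X \<Longrightarrow> 0 \<le> N u"
  using bfs unfolding banach_fun_space_def by blast

lemma N_zero: "N (\<lambda>t. 0) = 0"
  using X_cmult[OF X_zero, of 0] by simp

lemma X_diff:
  assumes "u \<in> X" "v \<in> X"
  shows "u - v \<in> X"
proof -
  have "(\<lambda>t. -1 * v t) \<in> X" using X_cmult[OF assms(2)] by blast
  from X_add[OF assms(1) this] show ?thesis by (simp add: fun_diff_def)
qed

lemma N_tri:
  assumes "u \<in> X" "v \<in> X" "w \<in> X"
  shows "N (u - w) \<le> N (u - v) + N (v - w)"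
  using X_add[OF X_diff[OF assms(1,2)] X_diff[OF assms(2,3)]] by (simp add: fun_diff_def)

lemma N_minus_commute:
  assumes "u \<in> X" "v \<in> X"
  shows "N (u - v) = N (v - u)"
  using X_cmult[OF X_diff[OF assms], of "-1"] by (simp add: fun_diff_def)

lemma N_diff_abs:
  assumes "u \<in> X" "v \<in> X"
  shows "\<bar>N u - N v\<bar> \<le> N (u - v)"
proof -
  have "u - (\<lambda>t. 0) = u" "v - (\<lambda>t. 0) = v" by (auto simp: fun_diff_def)
  then have "N u \<le> N (u - v) + N v" "N v \<le> N (v - u) + N u"
    using N_tri[OF assms(1,2) X_zero] N_tri[OF assms(2,1) X_zero] by simp_all
  then show ?thesis using N_minus_commute[OF assms] by linarith
qed

lemma N_sum:
  assumes "finite R" "\<And>r. r \<in> R \<Longrightarrow> u r \<in> X" "\<And>r. r \<in> R \<Longrightarrow> c r \<ge> 0"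
  shows "(\<lambda>t. \<Sum>r\<in>R. of_real (c r) * u r t) \<in> X \<and>
    N (\<lambda>t. \<Sum>r\<in>R. of_real (c r) * u r t) \<le> (\<Sum>r\<in>R. c r * N (u r))"
  using assms
proof (induction R)
  case empty
  then show ?case using X_zero N_zero by simp
next
  case (insert r R)
  have 1: "(\<lambda>t. of_real (c r) * u r t) \<in> X \<and> N (\<lambda>t. of_real (c r) * u r t) = cmod (of_real (c r)) * N (u r)"
    using insert.prems by (intro X_cmult) auto
  have 2: "(\<lambda>t. \<Sum>r\<in>R. of_real (c r) * u r t) \<in> X \<and>
    N (\<lambda>t. \<Sum>r\<in>R. of_real (c r) * u r t) \<le> (\<Sum>r\<in>R. c r * N (u r))"
    using insert by simp
  from X_add[OF conjunct1[OF 1] conjunct1[OF 2]] 1 2 insert show ?case by simp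
qed

lemma simple_intoD:
  assumes "simple_into X M s"
  shows "simple_function M s" "\<And>p. p \<in> space M \<Longrightarrow> s p \<in> X"
  using assms by (auto simp: simple_into_def)

text \<open>
  Pointwise in \<open>t\<close> the integral of a simple function is an ordinary integral, so that a
  difference of two of them is the sum over the common values \<open>r\<close> of the pair.
\<close>

lemma simple_integral_diff_bound:
  assumes M: "finite_measure M" and s: "simple_into X M s" and s': "simple_into X M s'"
  shows "simple_integral_X M s \<in> X" "simple_integral_X M s' \<in> X"
    "ennreal (N (simple_integral_X M s - simple_integral_X M s')) \<le> (\<integral>\<^sup>+p. ennreal (N (s p - s' p)) \<partial>M)"
proof -
  interpret finite_measure M by fact
  have in_X: "simple_integral_X M s \<in> X" if "simple_into X M s" for s
    unfolding simple_integral_X_def using that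
    by (intro conjunct1[OF N_sum]) (auto simp: simple_into_def simple_function_def)
  show "simple_integral_X M s \<in> X" "simple_integral_X M s' \<in> X" using in_X s s' by auto
  note ss = simple_intoD[OF s] and ss' = simple_intoD[OF s']
  define z where "z p = (s p, s' p)" for p
  have z: "simple_function M z" unfolding z_def by (rule simple_function_Pair[OF ss(1) ss'(1)])
  have rX: "fst r - snd r \<in> X" if r: "r \<in> z ` space M" for r
  proof -
    obtain p where "p \<in> space M" "r = (s p, s' p)" using r by (auto simp: z_def)
    then show ?thesis using X_diff[OF ss(2) ss'(2)] by (simp only: fst_conv snd_conv)
  qed
  have "simple_integral_X M s - simple_integral_X M s'
    = (\<lambda>t. \<Sum>r\<in>z ` space M. of_real (measure M (z -` {r} \<inter> space M)) * (fst r - snd r) t)"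
  proof
    fix t
    have "simple_integral_X M s t = (\<integral>p. s p t \<partial>M)" "simple_integral_X M s' t = (\<integral>p. s' p t \<partial>M)"
      using simple_bochner(2)[OF M ss(1), of "\<lambda>w. w t"] simple_bochner(2)[OF M ss'(1), of "\<lambda>w. w t"]
      by (simp_all add: simple_integral_X_def)
    then have "(simple_integral_X M s - simple_integral_X M s') t = (\<integral>p. s p t \<partial>M) - (\<integral>p. s' p t \<partial>M)"
      by (simp add: fun_diff_def)
    also have "\<dots> = (\<integral>p. s p t - s' p t \<partial>M)"
      using simple_bochner(1)[OF M ss(1), of "\<lambda>w. w t"] simple_bochner(1)[OF M ss'(1), of "\<lambda>w. w t"]
      by simp
    also have "\<dots> = (\<Sum>r\<in>z ` space M. of_real (measure M (z -` {r} \<inter> space M)) * (fst r - snd r) t)"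
      using simple_bochner(2)[OF M z, of "\<lambda>r. (fst r - snd r) t"] by (simp add: z_def fun_diff_def)
    finally show "(simple_integral_X M s - simple_integral_X M s') t
      = (\<Sum>r\<in>z ` space M. of_real (measure M (z -` {r} \<inter> space M)) * (fst r - snd r) t)" .
  qed
  then have "N (simple_integral_X M s - simple_integral_X M s')
    = N (\<lambda>t. \<Sum>r\<in>z ` space M. of_real (measure M (z -` {r} \<inter> space M)) * (fst r - snd r) t)"
    by (rule arg_cong)
  also have "\<dots> \<le> (\<Sum>r\<in>z ` space M. measure M (z -` {r} \<inter> space M) * N (fst r - snd r))"
    using z rX
    by (intro conjunct2[OF N_sum[where u = "\<lambda>r. fst r - snd r"]]) (auto simp only: simple_function_def measure_nonneg)
  finally have "ennreal (N (simple_integral_X M s - simple_integral_X M s'))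
    \<le> ennreal (\<Sum>r\<in>z ` space M. measure M (z -` {r} \<inter> space M) * N (fst r - snd r))"
    by (rule ennreal_leI)
  also have "\<dots> = (\<Sum>r\<in>z ` space M. ennreal (measure M (z -` {r} \<inter> space M) * N (fst r - snd r)))"
    by (intro sum_ennreal[symmetric] mult_nonneg_nonneg measure_nonneg N_nonneg rX)
  also have "\<dots> = (\<Sum>r\<in>z ` space M. ennreal (N (fst r - snd r)) * emeasure M (z -` {r} \<inter> space M))"
    using N_nonneg[OF rX]
    by (intro sum.cong refl) (simp only: emeasure_eq_measure ennreal_mult measure_nonneg mult.commute)
  also have "\<dots> = (\<integral>\<^sup>+p. ennreal (N (fst (z p) - snd (z p))) \<partial>M)"
    by (intro simple_nn_integral[OF z, where \<nu> = "\<lambda>r. N (fst r - snd r)", symmetric] N_nonneg rX imageI)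
  finally show "ennreal (N (simple_integral_X M s - simple_integral_X M s')) \<le> (\<integral>\<^sup>+p. ennreal (N (s p - s' p)) \<partial>M)"
    by (simp add: z_def)
qed

lemma simple_strongly_measurable:
  assumes "simple_into X M s"
  shows "strongly_measurable X N M s"
proof -
  have "N (s p - s p) = 0" for p using N_zero by (simp add: fun_diff_def)
  then show ?thesis
    using assms unfolding strongly_measurable_def by (auto simp: simple_into_def intro!: exI[of _ "\<lambda>_. s"])
qed

lemma strongly_measurable_comp:
  assumes "strongly_measurable X N M k" "\<phi> \<in> M' \<rightarrow>\<^sub>M M"
  shows "strongly_measurable X N M' (\<lambda>p. k (\<phi> p))"
proof -
  obtain s where s: "\<And>n. simple_into X M (s n)" "\<And>p. p \<in> space M \<Longrightarrow> (\<lambda>n. N (s n p - k p)) \<longlonglongrightarrow> 0"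
    and k: "k ` space M \<subseteq> X"
    using assms(1) unfolding strongly_measurable_def by blast
  note \<phi> = measurable_space[OF assms(2)]
  show ?thesis
    unfolding strongly_measurable_def
  proof (intro conjI exI[of _ "\<lambda>n p. s n (\<phi> p)"] allI ballI)
    show "(\<lambda>p. k (\<phi> p)) ` space M' \<subseteq> X" using k \<phi> by auto
    show "simple_into X M' (\<lambda>p. s n (\<phi> p))" for n
      using s(1)[of n] \<phi> simple_function_comp[OF assms(2), of "s n"] by (auto simp: simple_into_def)
    show "(\<lambda>n. N (s n (\<phi> p) - k (\<phi> p))) \<longlonglongrightarrow> 0" if "p \<in> space M'" for p
      using s(2)[OF \<phi>[OF that]] .
  qed
qed

text \<open>
  The norm of a difference of simple functions is simple, and converges to that of the
  difference of the limits.
\<close>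

lemma N_diff_measurable:
  assumes "strongly_measurable X N M k" "strongly_measurable X N M k'"
  shows "(\<lambda>p. N (k p - k' p)) \<in> borel_measurable M"
proof -
  obtain s where s: "\<And>n. simple_into X M (s n)" "\<And>p. p \<in> space M \<Longrightarrow> (\<lambda>n. N (s n p - k p)) \<longlonglongrightarrow> 0"
    and k: "k ` space M \<subseteq> X"
    using assms(1) unfolding strongly_measurable_def by blast
  obtain s' where s': "\<And>n. simple_into X M (s' n)" "\<And>p. p \<in> space M \<Longrightarrow> (\<lambda>n. N (s' n p - k' p)) \<longlonglongrightarrow> 0"
    and k': "k' ` space M \<subseteq> X"
    using assms(2) unfolding strongly_measurable_def by blast
  show ?thesis
  proof (rule borel_measurable_LIMSEQ_real)
    fix n
    have "simple_function M (\<lambda>p. N (s n p - s' n p))"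
      by (intro simple_function_compose2[where h = "\<lambda>a b. N (a - b)"] simple_intoD s s')
    then show "(\<lambda>p. N (s n p - s' n p)) \<in> borel_measurable M"
      by (rule borel_measurable_simple_function)
  next
    fix p assume p: "p \<in> space M"
    have X: "s n p \<in> X" "s' n p \<in> X" "k p \<in> X" "k' p \<in> X" for n
      using p k k' simple_intoD[OF s(1)] simple_intoD[OF s'(1)] by auto
    have "(\<lambda>n. N (s n p - s' n p) - N (k p - k' p)) \<longlonglongrightarrow> 0"
    proof (rule Lim_null_comparison)
      show "(\<lambda>n. N (s n p - k p) + N (s' n p - k' p)) \<longlonglongrightarrow> 0"
        using tendsto_add[OF s(2)[OF p] s'(2)[OF p]] by simp
      show "\<forall>\<^sub>F n in sequentially. norm (N (s n p - s' n p) - N (k p - k' p)) \<le> N (s n p - k p) + N (s' n p - k' p)"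
      proof (intro always_eventually allI)
        fix n
        note X = X(1)[of n] X(2)[of n] X(3,4)
        have "N (s n p - s' n p) \<le> N (s n p - k p) + (N (k p - k' p) + N (k' p - s' n p))"
          by (intro order_trans[OF N_tri[OF X(1,3,2)]] add_left_mono N_tri X)
        moreover have "N (k p - k' p) \<le> N (k p - s n p) + (N (s n p - s' n p) + N (s' n p - k' p))"
          by (intro order_trans[OF N_tri[OF X(3,1,4)]] add_left_mono N_tri X)
        ultimately show "norm (N (s n p - s' n p) - N (k p - k' p)) \<le> N (s n p - k p) + N (s' n p - k' p)"
          using N_minus_commute[OF X(3,1)] N_minus_commute[OF X(4,2)] by simp
      qed
    qed
    then show "(\<lambda>n. N (s n p - s' n p)) \<longlonglongrightarrow> N (k p - k' p)" by (rule LIM_zero_cancel)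
  qed
qed

text \<open>
  The norm inequality for the integral of the difference. Both integrals are compared with
  those of approximating simple functions.
\<close>

lemma integral_X_diff_bound:
  assumes M: "finite_measure M" and h: "has_integral_X X N M k v" and h': "has_integral_X X N M k' v'"
  shows "ennreal (N (v - v')) \<le> (\<integral>\<^sup>+p. ennreal (N (k p - k' p)) \<partial>M)"
proof -
  have sm: "strongly_measurable X N M k" "strongly_measurable X N M k'" and v: "v \<in> X" "v' \<in> X"
    using h h' by (auto simp: has_integral_X_def)
  have kX: "k p \<in> X" "k' p \<in> X" if "p \<in> space M" for p
    using sm that by (auto simp: strongly_measurable_def)
  obtain s where s: "\<And>n. simple_into X M (s n)" "(\<lambda>n. \<integral>\<^sup>+p. ennreal (N (k p - s n p)) \<partial>M) \<longlonglongrightarrow> 0"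
    "(\<lambda>n. N (simple_integral_X M (s n) - v)) \<longlonglongrightarrow> 0"
    using h unfolding has_integral_X_def by blast
  obtain s' where s': "\<And>n. simple_into X M (s' n)" "(\<lambda>n. \<integral>\<^sup>+p. ennreal (N (k' p - s' n p)) \<partial>M) \<longlonglongrightarrow> 0"
    "(\<lambda>n. N (simple_integral_X M (s' n) - v')) \<longlonglongrightarrow> 0"
    using h' unfolding has_integral_X_def by blast
  define Q where "Q = (\<integral>\<^sup>+p. ennreal (N (k p - k' p)) \<partial>M)"
  define R where "R n = ennreal (N (simple_integral_X M (s n) - v)) + ennreal (N (simple_integral_X M (s' n) - v'))
    + (\<integral>\<^sup>+p. ennreal (N (k p - s n p)) \<partial>M) + (\<integral>\<^sup>+p. ennreal (N (k' p - s' n p)) \<partial>M)" for n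
  have "R \<longlonglongrightarrow> ennreal 0 + ennreal 0 + 0 + 0"
    unfolding R_def by (intro tendsto_add s s' tendsto_ennrealI)
  then have lim: "(\<lambda>n. R n + Q) \<longlonglongrightarrow> 0 + Q" by (intro tendsto_add tendsto_const) simp
  have "ennreal (N (v - v')) \<le> R n + Q" for n
  proof -
    let ?S = "simple_integral_X M (s n)" and ?S' = "simple_integral_X M (s' n)"
    note b = simple_integral_diff_bound[OF M s(1)[of n] s'(1)[of n]]
    have [measurable]: "(\<lambda>p. N (k p - k' p)) \<in> borel_measurable M" "(\<lambda>p. N (k p - s n p)) \<in> borel_measurable M"
      "(\<lambda>p. N (k' p - s' n p)) \<in> borel_measurable M"
      by (intro N_diff_measurable sm simple_strongly_measurable s s')+
    have "N (v - v') \<le> N (v - ?S) + (N (?S - ?S') + N (?S' - v'))"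
      by (intro order_trans[OF N_tri[OF v(1) b(1) v(2)]] add_left_mono N_tri b v)
    then have i1: "ennreal (N (v - v')) \<le> ennreal (N (v - ?S)) + (ennreal (N (?S - ?S')) + ennreal (N (?S' - v')))"
      using v b by (simp add: N_nonneg X_diff ennreal_leI flip: ennreal_plus)
    have "ennreal (N (?S - ?S')) \<le> (\<integral>\<^sup>+p. ennreal (N (s n p - s' n p)) \<partial>M)" by (rule b(3))
    also have "\<dots> \<le> (\<integral>\<^sup>+p. ennreal (N (k p - s n p)) + (ennreal (N (k p - k' p)) + ennreal (N (k' p - s' n p))) \<partial>M)"
    proof (rule nn_integral_mono)
      fix p assume p: "p \<in> space M"
      have X: "s n p \<in> X" "s' n p \<in> X" "k p \<in> X" "k' p \<in> X"
        using p kX simple_intoD[OF s(1)] simple_intoD[OF s'(1)] by auto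
      have "N (s n p - s' n p) \<le> N (s n p - k p) + (N (k p - k' p) + N (k' p - s' n p))"
        by (intro order_trans[OF N_tri[OF X(1,3,2)]] add_left_mono N_tri X)
      then show "ennreal (N (s n p - s' n p)) \<le> ennreal (N (k p - s n p)) + (ennreal (N (k p - k' p)) + ennreal (N (k' p - s' n p)))"
        using X N_minus_commute[OF X(1,3)] by (simp add: N_nonneg X_diff ennreal_leI flip: ennreal_plus)
    qed
    also have "\<dots> = (\<integral>\<^sup>+p. ennreal (N (k p - s n p)) \<partial>M) + (Q + (\<integral>\<^sup>+p. ennreal (N (k' p - s' n p)) \<partial>M))"
      unfolding Q_def by (simp add: nn_integral_add)
    finally have i2: "ennreal (N (?S - ?S')) \<le> (\<integral>\<^sup>+p. ennreal (N (k p - s n p)) \<partial>M)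
      + (Q + (\<integral>\<^sup>+p. ennreal (N (k' p - s' n p)) \<partial>M))" .
    have arith: "x \<le> a + c + d + e + Q" if "x \<le> a + (b + c)" "b \<le> d + (Q + e)" for x a b c d e :: ennreal
    proof -
      have "x \<le> a + ((d + (Q + e)) + c)" using that by (meson add_mono order_refl order_trans)
      then show ?thesis by (simp add: ac_simps)
    qed
    show ?thesis
      using arith[OF i1 i2] unfolding R_def N_minus_commute[OF v(1) b(1)] .
  qed
  then have "ennreal (N (v - v')) \<le> 0 + Q"
    by (intro tendsto_lowerbound[OF lim] always_eventually allI) auto
  then show ?thesis by (simp add: Q_def)
qed

text \<open>
  Scalar simple approximations of \<open>f\<close>, multiplied by the fixed function \<open>w\<close>.
\<close>

lemma has_integral_X_zero:
  fixes f :: "'a \<Rightarrow> complex"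
  assumes M: "finite_measure M" and w: "w \<in> X" and f: "integrable M f" "(\<integral>p. f p \<partial>M) = 0"
  shows "has_integral_X X N M (\<lambda>p t. w t * f p) (\<lambda>t. 0)"
proof -
  have fm [measurable]: "f \<in> borel_measurable M" using f by auto
  obtain F where F: "\<And>i. simple_function M (F i)" "\<And>x. x \<in> space M \<Longrightarrow> (\<lambda>i. F i x) \<longlonglongrightarrow> f x"
    "\<And>i x. x \<in> space M \<Longrightarrow> dist (F i x) 0 \<le> 2 * dist (f x) 0"
    using borel_measurable_implies_sequence_metric[OF fm, of 0] by blast
  have Fm [measurable]: "F i \<in> borel_measurable M" for i by (rule borel_measurable_simple_function[OF F(1)])
  define s where "s i p = (\<lambda>t. w t * F i p)" for i p
  have wX: "(\<lambda>t. w t * c) \<in> X \<and> N (\<lambda>t. w t * c) = cmod c * N w" for c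
    using X_cmult[OF w, of c] by (simp add: mult.commute)
  have sX: "simple_into X M (s i)" for i
    unfolding simple_into_def s_def using wX
    by (auto intro: simple_function_compose1[OF F(1)])
  have d1: "N (s i p - (\<lambda>t. w t * f p)) = cmod (F i p - f p) * N w" for i p
  proof -
    have "s i p - (\<lambda>t. w t * f p) = (\<lambda>t. w t * (F i p - f p))" by (auto simp: s_def right_diff_distrib)
    then show ?thesis using wX by simp
  qed
  have d2: "N ((\<lambda>t. w t * f p) - s i p) = cmod (F i p - f p) * N w" for i p
    using d1[of i p] N_minus_commute[of "s i p" "\<lambda>t. w t * f p"] wX by (simp add: s_def)
  have L1: "(\<lambda>i. \<integral>\<^sup>+p. ennreal (cmod (F i p - f p)) \<partial>M) \<longlonglongrightarrow> (\<integral>\<^sup>+p. 0 \<partial>M)"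
  proof (rule nn_integral_dominated_convergence[where w = "\<lambda>p. ennreal (3 * cmod (f p))"])
    show "AE p in M. (\<lambda>i. ennreal (cmod (F i p - f p))) \<longlonglongrightarrow> 0"
    proof (rule AE_I2)
      fix p assume "p \<in> space M"
      then have "(\<lambda>i. cmod (F i p - f p)) \<longlonglongrightarrow> 0"
        using F(2) by (intro tendsto_norm_zero LIM_zero)
      then show "(\<lambda>i. ennreal (cmod (F i p - f p))) \<longlonglongrightarrow> 0"
        using tendsto_ennrealI by fastforce
    qed
    show "AE p in M. ennreal (cmod (F i p - f p)) \<le> ennreal (3 * cmod (f p))" for i
    proof (rule AE_I2, rule ennreal_leI)
      fix p assume "p \<in> space M"
      then have "cmod (F i p) \<le> 2 * cmod (f p)" using F(3)[of p i] by (simp add: dist_norm)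
      then show "cmod (F i p - f p) \<le> 3 * cmod (f p)"
        using norm_triangle_ineq4[of "F i p" "f p"] by linarith
    qed
    have "integrable M (\<lambda>p. 3 * cmod (f p))" using f by auto
    then show "(\<integral>\<^sup>+p. ennreal (3 * cmod (f p)) \<partial>M) < \<infinity>"
      by (subst nn_integral_eq_integral) auto
  qed measurable
  have iF: "integrable M (F i)" for i using simple_bochner(1)[OF M F(1)[of i], of "\<lambda>c. c"] .
  have SI: "simple_integral_X M (s i) - (\<lambda>t. 0) = (\<lambda>t. w t * (\<integral>p. F i p \<partial>M))" for i
  proof
    fix t
    have "simple_integral_X M (s i) t = (\<integral>p. s i p t \<partial>M)"
      using simple_bochner(2)[OF M simple_intoD(1)[OF sX[of i]], of "\<lambda>u. u t"] by (simp add: simple_integral_X_def)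
    also have "\<dots> = w t * (\<integral>p. F i p \<partial>M)" by (simp add: s_def)
    finally show "(simple_integral_X M (s i) - (\<lambda>t. 0)) t = w t * (\<integral>p. F i p \<partial>M)" by (simp add: fun_diff_def)
  qed
  show ?thesis
    unfolding has_integral_X_def
  proof (intro conjI X_zero exI[of _ s] allI sX)
    show "strongly_measurable X N M (\<lambda>p t. w t * f p)"
      unfolding strongly_measurable_def
    proof (intro conjI exI[of _ s] allI sX ballI)
      show "(\<lambda>p t. w t * f p) ` space M \<subseteq> X" using wX by auto
      fix p assume "p \<in> space M"
      then have "(\<lambda>i. cmod (F i p - f p) * N w) \<longlonglongrightarrow> 0 * N w"
        using F(2) by (intro tendsto_mult tendsto_const tendsto_norm_zero LIM_zero)
      then show "(\<lambda>n. N (s n p - (\<lambda>t. w t * f p))) \<longlonglongrightarrow> 0" unfolding d1 by simp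
    qed
    have "(\<lambda>i. ennreal (N w) * (\<integral>\<^sup>+p. ennreal (cmod (F i p - f p)) \<partial>M)) \<longlonglongrightarrow> ennreal (N w) * 0"
      using L1 by (intro ennreal_tendsto_cmult) auto
    moreover have "(\<integral>\<^sup>+p. ennreal (N ((\<lambda>t. w t * f p) - s i p)) \<partial>M) = ennreal (N w) * (\<integral>\<^sup>+p. ennreal (cmod (F i p - f p)) \<partial>M)" for i
      unfolding d2 using N_nonneg[OF w] by (subst nn_integral_cmult[symmetric]) (auto simp: ennreal_mult mult.commute)
    ultimately show "(\<lambda>i. \<integral>\<^sup>+p. ennreal (N ((\<lambda>t. w t * f p) - s i p)) \<partial>M) \<longlonglongrightarrow> 0" by simp
    have "(\<lambda>i. \<integral>p. F i p \<partial>M) \<longlonglongrightarrow> (\<integral>p. f p \<partial>M)"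
      using L1 by (intro tendsto_L1_int f iF) simp
    then have "(\<lambda>i. cmod (\<integral>p. F i p \<partial>M) * N w) \<longlonglongrightarrow> cmod 0 * N w"
      unfolding f(2) by (intro tendsto_mult tendsto_norm tendsto_const)
    then show "(\<lambda>i. N (simple_integral_X M (s i) - (\<lambda>t. 0))) \<longlonglongrightarrow> 0"
      unfolding SI using wX by simp
  qed
qed

end

section \<open>The two types of operators\<close>

lemma H1_norm_bound:
  assumes f: "f \<in> H1 \<alpha> a q" and K: "K \<ge> 0"
    and le: "\<And>l b. atomic_rep \<alpha> a q f l b \<Longrightarrow> Y \<le> K * (\<Sum>j. cmod (l j))"
  shows "Y \<le> K * H1_norm \<alpha> a q f"
proof (cases "K = 0")
  case True
  then show ?thesis using f le by (auto simp: H1_def)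
next
  case False
  have "Y / K \<le> H1_norm \<alpha> a q f"
    unfolding H1_norm_def
  proof (rule cInf_greatest)
    show "{(\<Sum>j. cmod (l j)) | l b. atomic_rep \<alpha> a q f l b} \<noteq> {}"
      using f by (auto simp: H1_def)
    fix z assume "z \<in> {(\<Sum>j. cmod (l j)) | l b. atomic_rep \<alpha> a q f l b}"
    then show "Y / K \<le> z" using le K False by (auto simp: field_simps)
  qed
  then show ?thesis using K False by (simp add: field_simps)
qed

lemma SUP_pairs_bound:
  fixes \<Phi> :: "real \<Rightarrow> real \<Rightarrow> real \<Rightarrow> real \<Rightarrow> ennreal"
  assumes "(SUP (c, r)\<in>adm 1. SUP (x, z)\<in>ivl c r \<times> ivl c r. \<Phi> c r x z) = B"
    and "(c, r) \<in> adm 1" "x \<in> ivl c r" "z \<in> ivl c r"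
  shows "\<Phi> c r x z \<le> B"
proof -
  have "\<Phi> c r x z \<le> (SUP (x, z)\<in>ivl c r \<times> ivl c r. \<Phi> c r x z)"
    using assms(3,4) by (intro SUP_upper2[of "(x, z)"]) auto
  also have "\<dots> \<le> (SUP (c, r)\<in>adm 1. SUP (x, z)\<in>ivl c r \<times> ivl c r. \<Phi> c r x z)"
    using assms(2) by (intro SUP_upper2[of "(c, r)"]) auto
  finally show ?thesis using assms(1) by simp
qed

lemma (in kernel_dist) regular_first_regular:
  assumes "regular_first \<alpha> N K" and D: "\<And>u v y. D (u, y) (v, y) = N (K u y - K v y)"
  obtains B where "B < \<infinity>" "regular Pair 1 B"
proof -
  define B where "B = (SUP (c, r)\<in>adm 1. SUP (x, z)\<in>ivl c r \<times> ivl c r.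
    \<integral>\<^sup>+y\<in>{0<..} - ivl c (2 * r). ennreal (N (K x y - K z y)) \<partial>gam \<alpha>)"
  have "regular Pair 1 B"
    unfolding regular_def D using SUP_pairs_bound[OF B_def[symmetric]] by auto
  then show thesis using that assms(1) by (simp add: regular_first_def B_def)
qed

lemma (in kernel_dist) regular_second_regular:
  assumes "regular_second \<alpha> N K" and D: "\<And>x u v. D (x, u) (x, v) = N (K x u - K x v)"
  obtains B where "B < \<infinity>" "regular (\<lambda>x y. (y, x)) 1 B"
proof -
  define B where "B = (SUP (c, r)\<in>adm 1. SUP (y, z)\<in>ivl c r \<times> ivl c r.
    \<integral>\<^sup>+x\<in>{0<..} - ivl c (2 * r). ennreal (N (K x y - K x z)) \<partial>gam \<alpha>)"
  have "regular (\<lambda>x y. (y, x)) 1 B"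
    unfolding regular_def D using SUP_pairs_bound[OF B_def[symmetric]] by auto
  then show thesis using that assms(1) by (simp add: regular_second_def B_def)
qed

text \<open>
  A bound by $\sum_j|\lambda_j|$ for every representation is a bound by the norm of the Hardy
  space.
\<close>

lemma (in kernel_dist) bounded_H1_L1:
  fixes S :: "(real \<Rightarrow> complex) \<Rightarrow> real \<Rightarrow> 'b::{banach, second_countable_topology}"
  assumes K: "K \<ge> 0" and m: "\<And>f. f \<in> H1 \<alpha> a q \<Longrightarrow> S f \<in> borel_measurable (gam \<alpha>)"
    and bound: "\<And>f l b. f \<in> H1 \<alpha> a q \<Longrightarrow> atomic_rep \<alpha> a q f l b \<Longrightarrow>
      nnorm1 \<alpha> (S f) \<le> ennreal (K * (\<Sum>j. cmod (l j)))"
  shows "bounded_op (H1 \<alpha> a q) (H1_norm \<alpha> a q) (Lp \<alpha> 1) (Lp_norm \<alpha> 1) S"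
  unfolding bounded_op_def
proof (intro exI[of _ K] ballI conjI)
  fix f assume f: "f \<in> H1 \<alpha> a q"
  then obtain l b where "atomic_rep \<alpha> a q f l b" by (auto simp: H1_def)
  from bound[OF f this] show S: "S f \<in> Lp \<alpha> 1"
    using m[OF f] by (auto simp: Lp1_iff intro: le_less_trans)
  show "Lp_norm \<alpha> 1 (S f) \<le> K * H1_norm \<alpha> a q f"
  proof (rule H1_norm_bound[OF f K])
    fix l b assume rep: "atomic_rep \<alpha> a q f l b"
    then have "0 \<le> K * (\<Sum>j. cmod (l j))"
      using K by (intro mult_nonneg_nonneg suminf_nonneg) (auto simp: atomic_rep_def)
    then show "Lp_norm \<alpha> 1 (S f) \<le> K * (\<Sum>j. cmod (l j))"
      using bound[OF f rep] unfolding Lp1_norm[OF S, symmetric] by simp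
  qed
qed

lemma linear_diff:
  assumes T: "linear_operator_on \<alpha> E T" and f: "f \<in> E" and g: "g \<in> E" and ng: "(\<lambda>y. -1 * g y) \<in> E"
  shows "AE x in gam \<alpha>. T (\<lambda>y. f y - g y) x = T f x - T g x"
proof -
  have add: "\<forall>f\<in>E. \<forall>g\<in>E. AE x in gam \<alpha>. T (\<lambda>y. f y + g y) x = T f x + T g x"
    and mult: "\<forall>c. \<forall>f\<in>E. AE x in gam \<alpha>. T (\<lambda>y. c * f y) x = c * T f x"
    using T unfolding linear_operator_on_def by blast+
  have "AE x in gam \<alpha>. T (\<lambda>y. f y + (-1 * g y)) x = T f x + T (\<lambda>y. -1 * g y) x"
    by (rule bspec[OF bspec[OF add f] ng])
  moreover have "AE x in gam \<alpha>. T (\<lambda>y. -1 * g y) x = -1 * T g x"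
    by (rule bspec[OF spec[OF mult] g])
  ultimately show ?thesis by eventually_elim simp
qed

text \<open>
  What the abstract results need, for operators of the first type. The second kernel value, at
  \<open>(x, w)\<close>, can be subtracted when the integral of \<open>f\<close> vanishes.
\<close>

lemma type_I_parts:
  fixes T :: "(real \<Rightarrow> complex) \<Rightarrow> real \<Rightarrow> complex"
  assumes \<alpha>: "\<alpha> > - 1 / 2" and T: "type_I \<alpha> T K"
    and D_def: "D = (\<lambda>p p'. cmod (case_prod K p - case_prod K p'))"
  shows "kernel_dist \<alpha> D"
    and "\<And>f g. f \<in> Lp \<alpha> 2 \<Longrightarrow> g \<in> Lp \<alpha> 2 \<Longrightarrow> AE x in gam \<alpha>. T (\<lambda>y. f y - g y) x = T f x - T g x"
    and "\<And>f c. f \<in> Lp \<alpha> 2 \<Longrightarrow> AE x in gam \<alpha>. T (\<lambda>y. c * f y) x = c * T f x"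
    and "\<And>f. f \<in> Lp \<alpha> \<infinity> \<Longrightarrow> \<exists>G. (AE x in gam \<alpha>. x \<in> G) \<and>
        (\<forall>x\<in>G - supp f. \<forall>z\<in>G - supp f. ennreal (norm (T f x - T f z))
          \<le> (\<integral>\<^sup>+y. ennreal (D (x, y) (z, y)) * ennreal (cmod (f y)) \<partial>gam \<alpha>))"
    and "\<And>f. f \<in> Lp \<alpha> \<infinity> \<Longrightarrow> (\<integral>x. f x \<partial>gam \<alpha>) = 0 \<Longrightarrow>
      AE x in gam \<alpha>. x \<notin> supp f \<longrightarrow> (\<forall>w>0. w \<noteq> x \<longrightarrow>
        ennreal (cmod (T f x)) \<le> (\<integral>\<^sup>+y. ennreal (D (x, y) (x, w)) * ennreal (cmod (f y)) \<partial>gam \<alpha>))"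
proof -
  have lin: "linear_operator_on \<alpha> (Lp \<alpha> 2) T"
    and Km [measurable]: "case_prod K \<in> borel_measurable off_diag"
    and rep: "\<And>f. f \<in> Lp \<alpha> 2 \<Longrightarrow> AE x in gam \<alpha>. x \<notin> supp f \<longrightarrow>
        integrable (gam \<alpha>) (\<lambda>y. K x y * f y) \<and> T f x = (\<integral>y. K x y * f y \<partial>gam \<alpha>)"
    using T unfolding type_I_def by auto
  show "kernel_dist \<alpha> D"
  proof
    note measurable_compose[OF borel_measurable_diff[OF
      measurable_compose[OF measurable_fst[of off_diag off_diag] Km]
      measurable_compose[OF measurable_snd[of off_diag off_diag] Km]] borel_measurable_norm]
    then show "case_prod D \<in> borel_measurable (off_diag \<Otimes>\<^sub>M off_diag)"
      by (simp add: D_def case_prod_beta')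
    show "D p s \<le> D p q + D q s" for p q s
      using norm_triangle_ineq[of "case_prod K p - case_prod K q" "case_prod K q - case_prod K s"] by (simp add: D_def)
  qed (rule \<alpha>, simp add: D_def)
  show "AE x in gam \<alpha>. T (\<lambda>y. f y - g y) x = T f x - T g x" if "f \<in> Lp \<alpha> 2" "g \<in> Lp \<alpha> 2" for f g
    using that by (intro linear_diff[OF lin] Lp2_cmult)
  show "AE x in gam \<alpha>. T (\<lambda>y. c * f y) x = c * T f x" if "f \<in> Lp \<alpha> 2" for f c
    using lin that unfolding linear_operator_on_def by blast
  show "\<exists>G. (AE x in gam \<alpha>. x \<in> G) \<and>
        (\<forall>x\<in>G - supp f. \<forall>z\<in>G - supp f. ennreal (norm (T f x - T f z))
          \<le> (\<integral>\<^sup>+y. ennreal (D (x, y) (z, y)) * ennreal (cmod (f y)) \<partial>gam \<alpha>))" if f: "f \<in> Lp \<alpha> \<infinity>" for f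
  proof (intro exI conjI ballI)
    let ?G = "{x. x \<notin> supp f \<longrightarrow> integrable (gam \<alpha>) (\<lambda>y. K x y * f y) \<and> T f x = (\<integral>y. K x y * f y \<partial>gam \<alpha>)}"
    show "AE x in gam \<alpha>. x \<in> ?G" using rep[OF Linf_L2[OF \<alpha> f]] by simp
    fix x z assume "x \<in> ?G - supp f" "z \<in> ?G - supp f"
    then have x: "integrable (gam \<alpha>) (\<lambda>y. K x y * f y)" "T f x = (\<integral>y. K x y * f y \<partial>gam \<alpha>)"
      and z: "integrable (gam \<alpha>) (\<lambda>y. K z y * f y)" "T f z = (\<integral>y. K z y * f y \<partial>gam \<alpha>)" by auto
    have "T f x - T f z = (\<integral>y. K x y * f y - K z y * f y \<partial>gam \<alpha>)"
      using x z by simp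
    also have "ennreal (norm \<dots>) \<le> nnorm1 \<alpha> (\<lambda>y. K x y * f y - K z y * f y)"
      using x z by (intro integral_norm_bound_ennreal) auto
    also have "\<dots> = (\<integral>\<^sup>+y. ennreal (D (x, y) (z, y)) * ennreal (cmod (f y)) \<partial>gam \<alpha>)"
      by (simp add: D_def norm_mult flip: left_diff_distrib ennreal_mult)
    finally show "ennreal (norm (T f x - T f z))
          \<le> (\<integral>\<^sup>+y. ennreal (D (x, y) (z, y)) * ennreal (cmod (f y)) \<partial>gam \<alpha>)" .
  qed
  show "AE x in gam \<alpha>. x \<notin> supp f \<longrightarrow> (\<forall>w>0. w \<noteq> x \<longrightarrow>
        ennreal (cmod (T f x)) \<le> (\<integral>\<^sup>+y. ennreal (D (x, y) (x, w)) * ennreal (cmod (f y)) \<partial>gam \<alpha>))"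
    if f: "f \<in> Lp \<alpha> \<infinity>" and mean: "(\<integral>x. f x \<partial>gam \<alpha>) = 0" for f
    using rep[OF Linf_L2[OF \<alpha> f]]
  proof eventually_elim
    case (elim x)
    have fi: "integrable (gam \<alpha>) f" using Lp2_Lp1[OF \<alpha> Linf_L2[OF \<alpha> f]] by (simp add: Lp1_integrable)
    show ?case
    proof (intro impI allI)
      fix w :: real assume "x \<notin> supp f"
      then have x: "integrable (gam \<alpha>) (\<lambda>y. K x y * f y)" "T f x = (\<integral>y. K x y * f y \<partial>gam \<alpha>)" using elim by auto
      have "T f x = (\<integral>y. K x y * f y - K x w * f y \<partial>gam \<alpha>)"
        using x fi mean by simp
      also have "ennreal (norm \<dots>) \<le> nnorm1 \<alpha> (\<lambda>y. K x y * f y - K x w * f y)"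
        using x fi by (intro integral_norm_bound_ennreal) auto
      also have "\<dots> = (\<integral>\<^sup>+y. ennreal (D (x, y) (x, w)) * ennreal (cmod (f y)) \<partial>gam \<alpha>)"
        by (simp add: D_def norm_mult flip: left_diff_distrib ennreal_mult)
      finally show "ennreal (cmod (T f x)) \<le> (\<integral>\<^sup>+y. ennreal (D (x, y) (x, w)) * ennreal (cmod (f y)) \<partial>gam \<alpha>)" .
    qed
  qed
qed

lemma type_I_Linf_BMO:
  fixes T :: "(real \<Rightarrow> complex) \<Rightarrow> real \<Rightarrow> complex"
  assumes \<alpha>: "\<alpha> > - 1 / 2" and a: "a > 0" and T: "type_I \<alpha> T K"
    and bd: "bounded_op (Lp \<alpha> 2) (Lp_norm \<alpha> 2) (Lp \<alpha> 2) (Lp_norm \<alpha> 2) T"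
    and reg: "regular_first \<alpha> cmod K"
  shows "bounded_op (Lp \<alpha> \<infinity>) (Lp_norm \<alpha> \<infinity>) (BMO \<alpha> a) (BMO_norm \<alpha> a) T"
proof -
  define D where "D = (\<lambda>p p'. cmod (case_prod K p - case_prod K p'))"
  note P = type_I_parts[OF \<alpha> T D_def]
  interpret kernel_dist \<alpha> D by (rule P(1))
  obtain A where A: "A \<ge> 0" "\<And>f. f \<in> Lp \<alpha> 2 \<Longrightarrow> T f \<in> Lp \<alpha> 2"
    "\<And>f. f \<in> Lp \<alpha> 2 \<Longrightarrow> nnorm2 \<alpha> (T f)
        \<le> ennreal A * nnorm2 \<alpha> f"
    using bounded_op_L2[OF bd] by blast
  obtain B where B: "B < \<infinity>" "regular Pair 1 B"
    using regular_first_regular[OF reg] by (auto simp: D_def)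
  show ?thesis
  proof (rule bounded_Linf_BMO[OF B(2) B(1) a A(1)])
    fix f g :: "real \<Rightarrow> complex" assume f: "f \<in> Lp \<alpha> 2" and g: "g \<in> Lp \<alpha> 2"
    have "nnorm2 \<alpha> (\<lambda>x. T f x - T g x) = nnorm2 \<alpha> (\<lambda>x. T (\<lambda>y. f y - g y) x)"
      using P(2)[OF f g] by (intro nn_integral_cong_AE) (auto elim!: eventually_mono)
    also have "\<dots> \<le> ennreal A * nnorm2 \<alpha> (\<lambda>x. f x - g x)"
      by (rule A(3)[OF Lp2_diff[OF f g]])
    finally show "nnorm2 \<alpha> (\<lambda>x. T f x - T g x) \<le> \<dots>" .
  qed (use A(2,3) P(4) in auto)
qed

text \<open>
  The given weak type extension to $L^1$ is linear, so that its absolute value is a limit in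
  the sense of \<open>limit_of\<close>. Restricting it to the Hardy space is therefore enough.
\<close>

lemma type_I_H1_L1:
  fixes T S :: "(real \<Rightarrow> complex) \<Rightarrow> real \<Rightarrow> complex"
  assumes \<alpha>: "\<alpha> > - 1 / 2" and a: "a > 0" and q: "1 < q" and T: "type_I \<alpha> T K"
    and bd: "bounded_op (Lp \<alpha> 2) (Lp_norm \<alpha> 2) (Lp \<alpha> 2) (Lp_norm \<alpha> 2) T"
    and S: "linear_operator_on \<alpha> (Lp \<alpha> 1) S" and ext: "extends \<alpha> (Lp \<alpha> 2) T S"
    and weak: "bounded_op (Lp \<alpha> 1) (Lp_norm \<alpha> 1) (weak_L1 \<alpha>) (weak_L1_norm \<alpha>) S"
    and reg: "regular_second \<alpha> cmod K"
  shows "linear_operator_on \<alpha> (H1 \<alpha> a q) S" "extends \<alpha> (H1 \<alpha> a q \<inter> Lp \<alpha> 2) T S"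
    "bounded_op (H1 \<alpha> a q) (H1_norm \<alpha> a q) (Lp \<alpha> 1) (Lp_norm \<alpha> 1) S"
proof -
  have H1: "f \<in> Lp \<alpha> 1" if "f \<in> H1 \<alpha> a q" for f using that by (simp add: H1_def)
  show "linear_operator_on \<alpha> (H1 \<alpha> a q) S"
    using S H1 unfolding linear_operator_on_def operator_on_def by blast
  show "extends \<alpha> (H1 \<alpha> a q \<inter> Lp \<alpha> 2) T S" using ext by (auto simp: extends_def)
  define D where "D = (\<lambda>p p'. cmod (case_prod K p - case_prod K p'))"
  note P = type_I_parts[OF \<alpha> T D_def]
  interpret kernel_dist \<alpha> D by (rule P(1))
  obtain A where A: "A \<ge> 0" "\<And>f. f \<in> Lp \<alpha> 2 \<Longrightarrow> T f \<in> Lp \<alpha> 2"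
    "\<And>f. f \<in> Lp \<alpha> 2 \<Longrightarrow> nnorm2 \<alpha> (T f)
        \<le> ennreal A * nnorm2 \<alpha> f"
    using bounded_op_L2[OF bd] by blast
  obtain C where C: "C \<ge> 0" "\<And>f s. f \<in> Lp \<alpha> 1 \<Longrightarrow> s > 0 \<Longrightarrow> emeasure (gam \<alpha>) {x \<in> {0<..}. s < norm (S f x)}
        \<le> ennreal (C / s) * nnorm1 \<alpha> f"
    using bounded_op_weak[OF \<alpha> weak] by blast
  obtain B where B: "B < \<infinity>" "regular (\<lambda>x y. (y, x)) 1 B"
    using regular_second_regular[OF reg] by (auto simp: D_def)
  have Sm: "S f \<in> borel_measurable (gam \<alpha>)" if "f \<in> Lp \<alpha> 1" for f
    using S that by (auto simp: linear_operator_on_def operator_on_def)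
  have Tm: "T f \<in> borel_measurable (gam \<alpha>)" if "f \<in> Lp \<alpha> 2" for f
    using A(2)[OF that] by (simp add: Lp2_iff)
  interpret sublinear_op \<alpha> D "\<lambda>f x. cmod (T f x)" A C B
  proof
    fix f g :: "real \<Rightarrow> complex" assume f: "f \<in> Lp \<alpha> 2"
    show "(\<lambda>x. cmod (T f x)) \<in> borel_measurable (gam \<alpha>)" using Tm[OF f] by measurable
    show "AE x in gam \<alpha>. cmod (T (\<lambda>y. c * f y) x) = cmod c * cmod (T f x)" for c
      using P(3)[OF f, of c] by eventually_elim (simp add: norm_mult)
    show "nnorm2 \<alpha> (T f) \<le> ennreal A * nnorm2 \<alpha> f"
      by (rule A(3)[OF f])
    show "emeasure (gam \<alpha>) {x \<in> {0<..}. s < cmod (T f x)}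
        \<le> ennreal (C / s) * nnorm1 \<alpha> f" if s: "s > 0" for s
    proof -
      have f1: "f \<in> Lp \<alpha> 1" by (rule Lp2_Lp1[OF \<alpha> f])
      have "AE x in gam \<alpha>. S f x = T f x" using ext f by (simp add: extends_def)
      then have "emeasure (gam \<alpha>) {x \<in> {0<..}. s < cmod (T f x)} \<le> emeasure (gam \<alpha>) {x \<in> {0<..}. s < cmod (S f x)}"
        using Sm[OF f1] by (intro emeasure_mono_AE gt_sets borel_measurable_norm) (auto elim!: eventually_mono)
      also have "\<dots> \<le> ennreal (C / s) * nnorm1 \<alpha> f" by (rule C(2)[OF f1 s])
      finally show ?thesis .
    qed
    assume g: "g \<in> Lp \<alpha> 2"
    show "AE x in gam \<alpha>. \<bar>cmod (T f x) - cmod (T g x)\<bar> \<le> cmod (T (\<lambda>y. f y - g y) x)"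
      using P(2)[OF f g] by eventually_elim (simp add: norm_triangle_ineq3)
  qed (use A(1) C(1) B P(5) in auto)
  have lim: "limit_of f (\<lambda>x. cmod (S f x))" if f: "f \<in> Lp \<alpha> 1" for f
    unfolding limit_of_def
  proof (intro conjI ballI allI impI)
    show "(\<lambda>x. cmod (S f x)) \<in> borel_measurable (gam \<alpha>)" using Sm[OF f] by measurable
    fix h :: "real \<Rightarrow> complex" and s :: real assume h: "h \<in> Lp \<alpha> 2" and s: "s > 0"
    have h1: "h \<in> Lp \<alpha> 1" by (rule Lp2_Lp1[OF \<alpha> h])
    have hf: "(\<lambda>y. h y - f y) \<in> Lp \<alpha> 1" using h1 f by (simp add: Lp1_integrable)
    have nf: "(\<lambda>y. -1 * f y) \<in> Lp \<alpha> 1" using f by (simp add: Lp1_integrable)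
    have "AE x in gam \<alpha>. S h x = T h x" using ext h by (simp add: extends_def)
    moreover have "AE x in gam \<alpha>. S (\<lambda>y. h y - f y) x = S h x - S f x"
      by (rule linear_diff[OF S h1 f nf])
    ultimately have "AE x in gam \<alpha>. \<bar>cmod (T h x) - cmod (S f x)\<bar> \<le> cmod (S (\<lambda>y. h y - f y) x)"
      by eventually_elim (simp add: norm_triangle_ineq3)
    then have "emeasure (gam \<alpha>) {x \<in> {0<..}. s < \<bar>cmod (T h x) - cmod (S f x)\<bar>}
      \<le> emeasure (gam \<alpha>) {x \<in> {0<..}. s < cmod (S (\<lambda>y. h y - f y) x)}"
      using Sm[OF hf] by (intro emeasure_mono_AE gt_sets borel_measurable_norm) (auto elim!: eventually_mono)
    also have "\<dots> \<le> ennreal (C / s) * nnorm1 \<alpha> (\<lambda>x. h x - f x)" by (rule C(2)[OF hf s])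
    finally show "emeasure (gam \<alpha>) {x \<in> {0<..}. s < \<bar>cmod (T h x) - cmod (S f x)\<bar>} \<le> \<dots>" .
  qed
  obtain M where M: "M \<ge> 0" "\<And>f l b u. f \<in> Lp \<alpha> 1 \<Longrightarrow> atomic_rep \<alpha> a q f l b \<Longrightarrow> limit_of f u \<Longrightarrow>
      (\<integral>\<^sup>+x. ennreal \<bar>u x\<bar> \<partial>gam \<alpha>) \<le> ennreal (M * (\<Sum>j. cmod (l j)))"
    using limit_of_H1_bound[OF a q] by blast
  show "bounded_op (H1 \<alpha> a q) (H1_norm \<alpha> a q) (Lp \<alpha> 1) (Lp_norm \<alpha> 1) S"
    using M(2)[OF H1 _ lim[OF H1]] by (intro bounded_H1_L1[OF M(1)] Sm H1) auto
qed

text \<open>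
  For each $t>0$ the integral formula holds at every point \<open>x\<close>. This makes the operators
  linear at every point and for all \<open>t\<close> at once, whereas linearity almost everywhere for each
  single \<open>t\<close> says nothing about a function of \<open>t\<close> at a given \<open>x\<close>.
\<close>

lemma type_II_pointwise:
  assumes \<alpha>: "\<alpha> > - 1 / 2" and T: "type_II \<alpha> T K X N" and x: "x > 0" and t: "t > 0"
    and f: "f \<in> Lp \<alpha> 2"
  shows "T t (\<lambda>y. c * f y) x = c * T t f x"
    and "g \<in> Lp \<alpha> 2 \<Longrightarrow> T t (\<lambda>y. f y - g y) x = T t f x - T t g x"
proof -
  have rep: "integrable (gam \<alpha>) (\<lambda>y. K t x y * f y) \<and> T t f x = (\<integral>y. K t x y * f y \<partial>gam \<alpha>)" if "f \<in> Lp \<alpha> 2" for f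
    using T x t that unfolding type_II_def by blast
  show "T t (\<lambda>y. c * f y) x = c * T t f x"
    using rep[OF f] rep[OF Lp2_cmult[OF f, of c]] by (simp add: mult.left_commute)
  show "T t (\<lambda>y. f y - g y) x = T t f x - T t g x" if g: "g \<in> Lp \<alpha> 2"
    using rep[OF f] rep[OF g] rep[OF Lp2_diff[OF f g]] by (simp add: right_diff_distrib)
qed

text \<open>
  The same facts for the second type. The functions of \<open>t\<close> are only determined for $t>0$,
  which is enough for their norms.
\<close>

lemma type_II_parts:
  assumes \<alpha>: "\<alpha> > - 1 / 2" and T: "type_II \<alpha> T K X N"
    and \<kappa>_def: "\<kappa> = (\<lambda>(x, y) t. K t x y)" and D_def: "D = (\<lambda>p p'. N (\<kappa> p - \<kappa> p'))"
    and U_def: "U = norm_op X N T"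
  shows "kernel_dist \<alpha> D"
    and "\<And>f. f \<in> Lp \<alpha> 2 \<Longrightarrow> U f \<in> borel_measurable (gam \<alpha>)"
    and "\<And>f. f \<in> Lp \<alpha> 2 \<Longrightarrow> AE x in gam \<alpha>. 0 \<le> U f x"
    and "\<And>f g. f \<in> Lp \<alpha> 2 \<Longrightarrow> g \<in> Lp \<alpha> 2 \<Longrightarrow> AE x in gam \<alpha>. \<bar>U f x - U g x\<bar> \<le> U (\<lambda>y. f y - g y) x"
    and "\<And>f c. f \<in> Lp \<alpha> 2 \<Longrightarrow> AE x in gam \<alpha>. U (\<lambda>y. c * f y) x = cmod c * U f x"
    and "\<And>f. f \<in> Lp \<alpha> \<infinity> \<Longrightarrow> \<exists>G. (AE x in gam \<alpha>. x \<in> G) \<and>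
        (\<forall>x\<in>G - supp f. \<forall>z\<in>G - supp f. ennreal (norm (U f x - U f z))
          \<le> (\<integral>\<^sup>+y. ennreal (D (x, y) (z, y)) * ennreal (cmod (f y)) \<partial>gam \<alpha>))"
    and "\<And>f. f \<in> Lp \<alpha> \<infinity> \<Longrightarrow> (\<integral>x. f x \<partial>gam \<alpha>) = 0 \<Longrightarrow>
      AE x in gam \<alpha>. x \<notin> supp f \<longrightarrow> (\<forall>w>0. w \<noteq> x \<longrightarrow>
        ennreal (U f x) \<le> (\<integral>\<^sup>+y. ennreal (D (x, y) (x, w)) * ennreal (cmod (f y)) \<partial>gam \<alpha>))"
proof -
  have bfs: "banach_fun_space X N" and sm: "strongly_measurable X N off_diag \<kappa>"
    using T unfolding type_II_def \<kappa>_def by blast+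
  have inX: "AE x in gam \<alpha>. (\<lambda>t. T t f x) \<in> X" and Um: "U f \<in> borel_measurable (gam \<alpha>)" if "f \<in> Lp \<alpha> 2" for f
    using T that unfolding type_II_def U_def by blast+
  have rep: "AE x in gam \<alpha>. x \<notin> supp f \<longrightarrow> has_integral_X X N (gam \<alpha>) (\<lambda>y t. K t x y * f y) (\<lambda>t. T t f x)"
    if "f \<in> Lp \<alpha> \<infinity>" for f
    using T that unfolding type_II_def by blast
  interpret fun_space X N by (rule fun_space.intro[OF bfs])
  have fin: "finite_measure (gam \<alpha>)" by (rule finite_measure_gam[OF \<alpha>])
  have kX: "\<kappa> p \<in> X" if "p \<in> space off_diag" for p
    using sm that by (auto simp: strongly_measurable_def)
  have UN: "U f x = N (\<lambda>t. T t f x)" if "(\<lambda>t. T t f x) \<in> X" for f x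
    using that by (simp add: U_def norm_op_def)
  show "kernel_dist \<alpha> D"
  proof
    show "case_prod D \<in> borel_measurable (off_diag \<Otimes>\<^sub>M off_diag)"
      using N_diff_measurable[OF strongly_measurable_comp[OF sm measurable_fst[of off_diag off_diag]]
        strongly_measurable_comp[OF sm measurable_snd[of off_diag off_diag]]]
      by (simp add: D_def case_prod_beta')
  qed (rule \<alpha>, auto simp: D_def intro!: N_nonneg X_diff kX N_tri)
  show "U f \<in> borel_measurable (gam \<alpha>)" if "f \<in> Lp \<alpha> 2" for f by (rule Um[OF that])
  show "AE x in gam \<alpha>. 0 \<le> U f x" if "f \<in> Lp \<alpha> 2" for f
    using inX[OF that] by eventually_elim (simp add: UN N_nonneg)
  show "AE x in gam \<alpha>. \<bar>U f x - U g x\<bar> \<le> U (\<lambda>y. f y - g y) x" if f: "f \<in> Lp \<alpha> 2" and g: "g \<in> Lp \<alpha> 2" for f g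
    using inX[OF f] inX[OF g] AE_space
  proof eventually_elim
    case (elim x)
    \<comment> \<open>the two functions of \<open>t\<close> agree for $t > 0$\<close>
    have "(\<lambda>t. T t (\<lambda>y. f y - g y) x) \<in> X \<and> N (\<lambda>t. T t (\<lambda>y. f y - g y) x) = N ((\<lambda>t. T t f x) - (\<lambda>t. T t g x))"
      using elim type_II_pointwise(2)[OF \<alpha> T _ _ f g, of x]
      by (intro X_cong X_diff) (auto simp: fun_diff_def)
    then show ?case using N_diff_abs[OF elim(1,2)] UN elim by simp
  qed
  show "AE x in gam \<alpha>. U (\<lambda>y. c * f y) x = cmod c * U f x" if f: "f \<in> Lp \<alpha> 2" for f c
    using inX[OF f] AE_space
  proof eventually_elim
    case (elim x)
    have "(\<lambda>t. T t (\<lambda>y. c * f y) x) \<in> X \<and> N (\<lambda>t. T t (\<lambda>y. c * f y) x) = N (\<lambda>t. c * T t f x)"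
      using elim X_cmult[OF elim(1)] type_II_pointwise(1)[OF \<alpha> T _ _ f, of x]
      by (intro X_cong) auto
    then show ?case using X_cmult[OF elim(1), of c] UN elim by simp
  qed
  show "\<exists>G. (AE x in gam \<alpha>. x \<in> G) \<and>
        (\<forall>x\<in>G - supp f. \<forall>z\<in>G - supp f. ennreal (norm (U f x - U f z))
          \<le> (\<integral>\<^sup>+y. ennreal (D (x, y) (z, y)) * ennreal (cmod (f y)) \<partial>gam \<alpha>))" if f: "f \<in> Lp \<alpha> \<infinity>" for f
  proof (intro exI conjI ballI)
    let ?G = "{x. 0 < x \<and> (x \<notin> supp f \<longrightarrow> has_integral_X X N (gam \<alpha>) (\<lambda>y t. K t x y * f y) (\<lambda>t. T t f x))}"
    show "AE x in gam \<alpha>. x \<in> ?G" using rep[OF f] AE_space by eventually_elim auto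
    fix x z assume xz: "x \<in> ?G - supp f" "z \<in> ?G - supp f"
    then have x: "has_integral_X X N (gam \<alpha>) (\<lambda>y t. K t x y * f y) (\<lambda>t. T t f x)"
      and z: "has_integral_X X N (gam \<alpha>) (\<lambda>y t. K t z y * f y) (\<lambda>t. T t f z)" by auto
    then have X: "(\<lambda>t. T t f x) \<in> X" "(\<lambda>t. T t f z) \<in> X" by (auto simp: has_integral_X_def)
    have "ennreal (norm (U f x - U f z)) \<le> ennreal (N ((\<lambda>t. T t f x) - (\<lambda>t. T t f z)))"
      using N_diff_abs[OF X] UN X by (intro ennreal_leI) simp
    also have "\<dots> \<le> (\<integral>\<^sup>+y. ennreal (N ((\<lambda>t. K t x y * f y) - (\<lambda>t. K t z y * f y))) \<partial>gam \<alpha>)"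
      by (rule integral_X_diff_bound[OF fin x z])
    also have "\<dots> = (\<integral>\<^sup>+y. ennreal (D (x, y) (z, y)) * ennreal (cmod (f y)) \<partial>gam \<alpha>)"
    proof (rule nn_integral_cong)
      fix y assume y: "y \<in> space (gam \<alpha>)"
      have eq: "(\<lambda>t. K t x y * f y) - (\<lambda>t. K t z y * f y) = (\<lambda>t. f y * (\<kappa> (x, y) - \<kappa> (z, y)) t)"
        by (auto simp: \<kappa>_def fun_diff_def algebra_simps)
      show "ennreal (N ((\<lambda>t. K t x y * f y) - (\<lambda>t. K t z y * f y))) = ennreal (D (x, y) (z, y)) * ennreal (cmod (f y))"
      \<comment> \<open>off the zeros of \<open>f\<close> the points are off the diagonal, where the kernel has values in \<open>X\<close>\<close>
      proof (cases "f y = 0")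
        case True
        then show ?thesis unfolding eq using N_zero by simp
      next
        case False
        then have "y \<in> supp f"
          using y closure_subset[of "{x \<in> {0<..}. f x \<noteq> 0}"] by (auto simp: supp_def)
        then have "\<kappa> (x, y) \<in> X" "\<kappa> (z, y) \<in> X" using xz y by (auto intro!: kX)
        then have "\<kappa> (x, y) - \<kappa> (z, y) \<in> X" by (rule X_diff)
        then show ?thesis
          unfolding eq D_def using X_cmult[of "\<kappa> (x, y) - \<kappa> (z, y)" "f y"] N_nonneg
          by (simp add: mult.commute flip: ennreal_mult)
      qed
    qed
    finally show "ennreal (norm (U f x - U f z))
          \<le> (\<integral>\<^sup>+y. ennreal (D (x, y) (z, y)) * ennreal (cmod (f y)) \<partial>gam \<alpha>)" .
  qed
  show "AE x in gam \<alpha>. x \<notin> supp f \<longrightarrow> (\<forall>w>0. w \<noteq> x \<longrightarrow>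
        ennreal (U f x) \<le> (\<integral>\<^sup>+y. ennreal (D (x, y) (x, w)) * ennreal (cmod (f y)) \<partial>gam \<alpha>))"
    if f: "f \<in> Lp \<alpha> \<infinity>" and mean: "(\<integral>x. f x \<partial>gam \<alpha>) = 0" for f
    using rep[OF f] AE_space
  proof eventually_elim
    case (elim x)
    have fi: "integrable (gam \<alpha>) f" using Lp2_Lp1[OF \<alpha> Linf_L2[OF \<alpha> f]] by (simp add: Lp1_integrable)
    show ?case
    proof (intro impI allI)
      fix w :: real assume xs: "x \<notin> supp f" and w: "w > 0" "w \<noteq> x"
      then have x: "has_integral_X X N (gam \<alpha>) (\<lambda>y t. K t x y * f y) (\<lambda>t. T t f x)" using elim by auto
      then have X: "(\<lambda>t. T t f x) \<in> X" by (auto simp: has_integral_X_def)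
      have kw: "\<kappa> (x, w) \<in> X" using w elim by (intro kX) auto
      have "(\<lambda>t. T t f x) - (\<lambda>t. 0) = (\<lambda>t. T t f x)" by (auto simp: fun_diff_def)
      then have "ennreal (U f x) = ennreal (N ((\<lambda>t. T t f x) - (\<lambda>t. 0)))" using UN[OF X] by simp
      also have "\<dots> \<le> (\<integral>\<^sup>+y. ennreal (N ((\<lambda>t. K t x y * f y) - (\<lambda>t. \<kappa> (x, w) t * f y))) \<partial>gam \<alpha>)"
        by (rule integral_X_diff_bound[OF fin x has_integral_X_zero[OF fin kw fi mean]])
      also have "\<dots> = (\<integral>\<^sup>+y. ennreal (D (x, y) (x, w)) * ennreal (cmod (f y)) \<partial>gam \<alpha>)"
      proof (rule nn_integral_cong)
        fix y assume y: "y \<in> space (gam \<alpha>)"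
        have eq: "(\<lambda>t. K t x y * f y) - (\<lambda>t. \<kappa> (x, w) t * f y) = (\<lambda>t. f y * (\<kappa> (x, y) - \<kappa> (x, w)) t)"
          by (auto simp: \<kappa>_def fun_diff_def algebra_simps)
        show "ennreal (N ((\<lambda>t. K t x y * f y) - (\<lambda>t. \<kappa> (x, w) t * f y))) = ennreal (D (x, y) (x, w)) * ennreal (cmod (f y))"
        \<comment> \<open>off the zeros of \<open>f\<close> the points are off the diagonal, where the kernel has values in \<open>X\<close>\<close>
        proof (cases "f y = 0")
          case True
          then show ?thesis unfolding eq using N_zero by simp
        next
          case False
          then have "y \<in> supp f"
            using y closure_subset[of "{x \<in> {0<..}. f x \<noteq> 0}"] by (auto simp: supp_def)
          then have "\<kappa> (x, y) \<in> X" using xs y elim by (auto intro!: kX)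
          then have "\<kappa> (x, y) - \<kappa> (x, w) \<in> X" by (rule X_diff[OF _ kw])
          then show ?thesis
            unfolding eq D_def using X_cmult[of "\<kappa> (x, y) - \<kappa> (x, w)" "f y"] N_nonneg
            by (simp add: mult.commute flip: ennreal_mult)
        qed
      qed
      finally show "ennreal (U f x) \<le> (\<integral>\<^sup>+y. ennreal (D (x, y) (x, w)) * ennreal (cmod (f y)) \<partial>gam \<alpha>)" .
    qed
  qed
qed

lemma type_II_Linf_BMO:
  assumes \<alpha>: "\<alpha> > - 1 / 2" and a: "a > 0" and T: "type_II \<alpha> T K X N"
    and bd: "bounded_op (Lp \<alpha> 2) (Lp_norm \<alpha> 2) (Lp \<alpha> 2) (Lp_norm \<alpha> 2) (norm_op X N T)"
    and reg: "regular_first \<alpha> N (\<lambda>x y t. K t x y)"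
  shows "bounded_op (Lp \<alpha> \<infinity>) (Lp_norm \<alpha> \<infinity>) (BMO \<alpha> a) (BMO_norm \<alpha> a) (norm_op X N T)"
proof -
  define U where "U = norm_op X N T"
  define \<kappa> where "\<kappa> = (\<lambda>(x, y) t. K t x y)"
  define D where "D = (\<lambda>p p'. N (\<kappa> p - \<kappa> p'))"
  note P = type_II_parts[OF \<alpha> T \<kappa>_def D_def U_def]
  interpret kernel_dist \<alpha> D by (rule P(1))
  obtain A where A: "A \<ge> 0" "\<And>f. f \<in> Lp \<alpha> 2 \<Longrightarrow> U f \<in> Lp \<alpha> 2"
    "\<And>f. f \<in> Lp \<alpha> 2 \<Longrightarrow> nnorm2 \<alpha> (U f)
        \<le> ennreal A * nnorm2 \<alpha> f"
    using bounded_op_L2[OF bd] unfolding U_def by blast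
  obtain B where B: "B < \<infinity>" "regular Pair 1 B"
    using regular_first_regular[OF reg] by (auto simp: D_def \<kappa>_def)
  show ?thesis unfolding U_def[symmetric]
  proof (rule bounded_Linf_BMO[OF B(2) B(1) a A(1)])
    fix f g :: "real \<Rightarrow> complex" assume f: "f \<in> Lp \<alpha> 2" and g: "g \<in> Lp \<alpha> 2"
    have "nnorm2 \<alpha> (\<lambda>x. U f x - U g x) \<le> nnorm2 \<alpha> (\<lambda>x. U (\<lambda>y. f y - g y) x)"
      using P(4)[OF f g]
      by (intro nn_integral_mono_AE) (auto elim!: eventually_mono intro!: ennreal_leI power2_le_iff_abs_le[THEN iffD2])
    also have "\<dots> \<le> ennreal A * nnorm2 \<alpha> (\<lambda>x. f x - g x)"
      by (rule A(3)[OF Lp2_diff[OF f g]])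
    finally show "nnorm2 \<alpha> (\<lambda>x. U f x - U g x) \<le> \<dots>" .
  qed (use A(2,3) P(6) in auto)
qed

text \<open>
  The given extension to $L^1$ provides the weak bound on $L^2$. The operator on the Hardy
  space is the extension by continuity, which inherits sublinearity from $L^2$.
\<close>

lemma type_II_H1_L1:
  fixes S0 :: "(real \<Rightarrow> complex) \<Rightarrow> real \<Rightarrow> real"
  assumes \<alpha>: "\<alpha> > - 1 / 2" and a: "a > 0" and q: "1 < q" and T: "type_II \<alpha> T K X N"
    and bd: "bounded_op (Lp \<alpha> 2) (Lp_norm \<alpha> 2) (Lp \<alpha> 2) (Lp_norm \<alpha> 2) (norm_op X N T)"
    and S0: "operator_on \<alpha> (Lp \<alpha> 1) S0" and ext: "extends \<alpha> (Lp \<alpha> 2) (norm_op X N T) S0"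
    and weak: "bounded_op (Lp \<alpha> 1) (Lp_norm \<alpha> 1) (weak_L1 \<alpha>) (weak_L1_norm \<alpha>) S0"
    and reg: "regular_second \<alpha> N (\<lambda>x y t. K t x y)"
  shows "\<exists>S. sublinear_operator_on \<alpha> (H1 \<alpha> a q) S \<and> extends \<alpha> (H1 \<alpha> a q \<inter> Lp \<alpha> 2) (norm_op X N T) S \<and>
    bounded_op (H1 \<alpha> a q) (H1_norm \<alpha> a q) (Lp \<alpha> 1) (Lp_norm \<alpha> 1) S"
proof -
  have H1: "f \<in> Lp \<alpha> 1" if "f \<in> H1 \<alpha> a q" for f using that by (simp add: H1_def)
  define U where "U = norm_op X N T"
  define \<kappa> where "\<kappa> = (\<lambda>(x, y) t. K t x y)"
  define D where "D = (\<lambda>p p'. N (\<kappa> p - \<kappa> p'))"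
  note P = type_II_parts[OF \<alpha> T \<kappa>_def D_def U_def]
  interpret kernel_dist \<alpha> D by (rule P(1))
  obtain A where A: "A \<ge> 0" "\<And>f. f \<in> Lp \<alpha> 2 \<Longrightarrow> U f \<in> Lp \<alpha> 2"
    "\<And>f. f \<in> Lp \<alpha> 2 \<Longrightarrow> nnorm2 \<alpha> (U f)
        \<le> ennreal A * nnorm2 \<alpha> f"
    using bounded_op_L2[OF bd] unfolding U_def by blast
  obtain C where C: "C \<ge> 0" "\<And>f s. f \<in> Lp \<alpha> 1 \<Longrightarrow> s > 0 \<Longrightarrow> emeasure (gam \<alpha>) {x \<in> {0<..}. s < norm (S0 f x)}
        \<le> ennreal (C / s) * nnorm1 \<alpha> f"
    using bounded_op_weak[OF \<alpha> weak] by blast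
  obtain B where B: "B < \<infinity>" "regular (\<lambda>x y. (y, x)) 1 B"
    using regular_second_regular[OF reg] by (auto simp: D_def \<kappa>_def)
  interpret sublinear_op \<alpha> D U A C B
  proof
    fix f :: "real \<Rightarrow> complex" and s :: real assume f: "f \<in> Lp \<alpha> 2" and s: "s > 0"
    have f1: "f \<in> Lp \<alpha> 1" by (rule Lp2_Lp1[OF \<alpha> f])
    have "S0 f \<in> borel_measurable (gam \<alpha>)" using S0 f1 by (simp add: operator_on_def)
    moreover have "AE x in gam \<alpha>. S0 f x = U f x" using ext f by (simp add: extends_def U_def)
    ultimately have "emeasure (gam \<alpha>) {x \<in> {0<..}. s < U f x} \<le> emeasure (gam \<alpha>) {x \<in> {0<..}. s < norm (S0 f x)}"
      by (intro emeasure_mono_AE gt_sets borel_measurable_norm) (auto elim!: eventually_mono)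
    also have "\<dots> \<le> ennreal (C / s) * nnorm1 \<alpha> f" by (rule C(2)[OF f1 s])
    finally show "emeasure (gam \<alpha>) {x \<in> {0<..}. s < U f x} \<le> \<dots>" .
  qed (use A(1,3) C(1) B P(2-5,7) in auto)
  define S where "S f = (SOME u. limit_of f u)" for f
  have S: "limit_of f (S f)" if "f \<in> Lp \<alpha> 1" for f
    unfolding S_def using limit_of_exists[OF that] by (rule someI_ex)
  have Sm: "S f \<in> borel_measurable (gam \<alpha>)" if "f \<in> Lp \<alpha> 1" for f
    using S[OF that] by (rule limit_of_meas)
  have "sublinear_operator_on \<alpha> (H1 \<alpha> a q) S"
    unfolding sublinear_operator_on_def operator_on_def
  proof (intro conjI ballI allI impI)
    fix f g assume f: "f \<in> H1 \<alpha> a q" and g: "g \<in> H1 \<alpha> a q"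
    have fg: "(\<lambda>y. f y + g y) \<in> Lp \<alpha> 1" using H1[OF f] H1[OF g] by (simp add: Lp1_integrable)
    show "AE x in gam \<alpha>. S (\<lambda>y. f y + g y) x \<le> S f x + S g x"
      by (intro limit_of_sublinear[OF H1[OF f] H1[OF g]] S H1 f g fg)
    assume "AE x in gam \<alpha>. f x = g x"
    from limit_of_cong[OF S[OF H1[OF f]] this] show "AE x in gam \<alpha>. S f x = S g x"
      by (intro limit_of_unique[OF H1[OF g]] S H1 g)
  next
    fix f c assume f: "f \<in> H1 \<alpha> a q"
    have cf: "(\<lambda>y. c * f y) \<in> Lp \<alpha> 1" using H1[OF f] by (simp add: Lp1_integrable)
    show "AE x in gam \<alpha>. S (\<lambda>y. c * f y) x = cmod c * S f x"
      by (intro limit_of_unique[OF cf S[OF cf]] limit_of_cmult S H1 f)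
  qed (auto intro!: Sm H1 limit_of_nonneg[OF H1 S[OF H1]])
  moreover have "extends \<alpha> (H1 \<alpha> a q \<inter> Lp \<alpha> 2) (norm_op X N T) S"
    unfolding extends_def U_def[symmetric]
    using limit_of_unique[OF H1 S[OF H1] limit_of_self] by auto
  moreover obtain M where M: "M \<ge> 0" "\<And>f l b u. f \<in> Lp \<alpha> 1 \<Longrightarrow> atomic_rep \<alpha> a q f l b \<Longrightarrow> limit_of f u \<Longrightarrow>
      (\<integral>\<^sup>+x. ennreal \<bar>u x\<bar> \<partial>gam \<alpha>) \<le> ennreal (M * (\<Sum>j. cmod (l j)))"
    using limit_of_H1_bound[OF a q] by blast
  have "bounded_op (H1 \<alpha> a q) (H1_norm \<alpha> a q) (Lp \<alpha> 1) (Lp_norm \<alpha> 1) S"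
    using M(2)[OF H1 _ S[OF H1]] by (intro bounded_H1_L1[OF M(1)] Sm H1) auto
  ultimately show ?thesis by blast
qed

theorem theorem1p2:
  fixes \<alpha> a :: real and q :: ereal
  assumes "\<alpha> > - 1 / 2" and "a > 0" and "1 < q"
  shows
    "(\<forall>(T :: (real \<Rightarrow> complex) \<Rightarrow> real \<Rightarrow> complex) (K :: real \<Rightarrow> real \<Rightarrow> complex).
        type_I \<alpha> T K \<longrightarrow>
        bounded_op (Lp \<alpha> 2) (Lp_norm \<alpha> 2) (Lp \<alpha> 2) (Lp_norm \<alpha> 2) T \<longrightarrow>
        (regular_first \<alpha> cmod K \<longrightarrow>
           bounded_op (Lp \<alpha> \<infinity>) (Lp_norm \<alpha> \<infinity>) (BMO \<alpha> a) (BMO_norm \<alpha> a) T) \<and>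
        ((\<exists>S. linear_operator_on \<alpha> (Lp \<alpha> 1) S \<and> extends \<alpha> (Lp \<alpha> 2) T S \<and>
            bounded_op (Lp \<alpha> 1) (Lp_norm \<alpha> 1) (weak_L1 \<alpha>) (weak_L1_norm \<alpha>) S) \<and>
         regular_second \<alpha> cmod K \<longrightarrow>
           (\<exists>S. linear_operator_on \<alpha> (H1 \<alpha> a q) S \<and> extends \<alpha> (H1 \<alpha> a q \<inter> Lp \<alpha> 2) T S \<and>
              bounded_op (H1 \<alpha> a q) (H1_norm \<alpha> a q) (Lp \<alpha> 1) (Lp_norm \<alpha> 1) S))) \<and>
     (\<forall>(Tt :: real \<Rightarrow> (real \<Rightarrow> complex) \<Rightarrow> real \<Rightarrow> complex) (K :: real \<Rightarrow> real \<Rightarrow> real \<Rightarrow> complex)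
        (X :: (real \<Rightarrow> complex) set) (N :: (real \<Rightarrow> complex) \<Rightarrow> real).
        type_II \<alpha> Tt K X N \<longrightarrow>
        bounded_op (Lp \<alpha> 2) (Lp_norm \<alpha> 2) (Lp \<alpha> 2) (Lp_norm \<alpha> 2) (norm_op X N Tt) \<longrightarrow>
        (regular_first \<alpha> N (\<lambda>x y t. K t x y) \<longrightarrow>
           bounded_op (Lp \<alpha> \<infinity>) (Lp_norm \<alpha> \<infinity>) (BMO \<alpha> a) (BMO_norm \<alpha> a) (norm_op X N Tt)) \<and>
        ((\<exists>S. operator_on \<alpha> (Lp \<alpha> 1) S \<and> extends \<alpha> (Lp \<alpha> 2) (norm_op X N Tt) S \<and>
            bounded_op (Lp \<alpha> 1) (Lp_norm \<alpha> 1) (weak_L1 \<alpha>) (weak_L1_norm \<alpha>) S) \<and>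
         regular_second \<alpha> N (\<lambda>x y t. K t x y) \<longrightarrow>
           (\<exists>S. sublinear_operator_on \<alpha> (H1 \<alpha> a q) S \<and>
              extends \<alpha> (H1 \<alpha> a q \<inter> Lp \<alpha> 2) (norm_op X N Tt) S \<and>
              bounded_op (H1 \<alpha> a q) (H1_norm \<alpha> a q) (Lp \<alpha> 1) (Lp_norm \<alpha> 1) S)))"
  by (intro conjI allI impI type_I_Linf_BMO[OF assms(1,2)] type_II_Linf_BMO[OF assms(1,2)];
      (assumption | elim conjE exE))
    (blast intro: type_I_H1_L1[OF assms] type_II_H1_L1[OF assms])+

end
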